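(* Let $L/K$ be a totally ramified extension of degree $n=up^\nu$ with $p\nmid u$. Let $j$ be an integer with $0\le j\le\nu$ and $\min\{v_p(i_j),\nu\}\ge j$. Then for every $r\in\mathbb{Z}$, $\mathcal{O}_K\cdot E_{p^j}(\mathcal{M}_L^r)=\mathcal{M}_K^{\lceil(i_j+rp^j)/n\rceil}$, i.e. $g_{p^j}(r)=\lceil(i_j+rp^j)/n\rceil$.
   Context: $K$ is a field complete with respect to a discrete valuation $v_K$ whose residue field is perfect of characteristic $p$; $K^{sep}$ is a separable closure and $L\subset K^{sep}$ is a finite (separable) totally ramified extension. $\mathcal{O}_K$ is the valuation ring of $K$; $\mathcal{M}_K,\mathcal{M}_L$ are the maximal ideals; $v_L$ is normalized with $v_L=nv_K$ on $K$; $e_L=v_L(p)$ ($=\infty$ if $\mathrm{char}\,K=p$); $v_p(0)=\infty$. $\sigma_1,\dots,\sigma_n$ are the $K$-embeddings $L\to K^{sep}$, and $E_h(\alpha)=e_h(\sigma_1(\alpha),\dots,\sigma_n(\alpha))$ where $e_h$ is the $h$th elementary symmetric polynomial; $g_h(r)=\min\{v_K(E_h(\alpha)):\alpha\in\mathcal{M}_L^r\}$. Indices of inseparability: let $\pi_L$ be a uniformizer of $L$ with minimal polynomial $X^n-c_1X^{n-1}+\dots+(-1)^nc_n$ over $K$; with $\overline{v}_p(k)=\min\{v_p(k),\nu\}$, set $i_j^{\pi_L}=\min\{nv_K(c_h)-h:1\le h\le n,\ \overline{v}_p(h)\le j\}$ and $i_j=\min\{i_{j'}^{\pi_L}+(j'-j)e_L:j\le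 j'\le\nu\}$ for $0\le j\le\nu$ (independent of $\pi_L$). *)

theory Defs
  imports
    "HOL-Algebra.QuotRing"
    "HOL-Library.Extended_Real"
    "HOL-Library.Extended_Nat"
    "HOL-Computational_Algebra.Computational_Algebra"
    "Jordan_Normal_Form.Char_Poly"
begin

section \<open>Complete discretely valued fields\<close>

text \<open>
  Valuations take values in \<open>\<int> \<union> {\<infinity>}\<close>, seen inside the extended reals, and are
  normalized: the value group is exactly \<open>\<int>\<close>.
\<close>

definition discrete_valuation :: "('a::field \<Rightarrow> ereal) \<Rightarrow> bool" where
  "discrete_valuation v \<longleftrightarrow>
     (\<forall>x. v x = \<infinity> \<longleftrightarrow> x = 0) \<and>
     v ` (UNIV - {0}) = range (\<lambda>m::int. ereal (real_of_int m)) \<and>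
     (\<forall>x y. v (x * y) = v x + v y) \<and>
     (\<forall>x y. min (v x) (v y) \<le> v (x + y))"

definition complete_valuation :: "('a::field \<Rightarrow> ereal) \<Rightarrow> bool" where
  "complete_valuation v \<longleftrightarrow>
     (\<forall>X :: nat \<Rightarrow> 'a.
        (\<forall>M::int. \<exists>N. \<forall>k\<ge>N. \<forall>l\<ge>N. ereal (real_of_int M) \<le> v (X k - X l)) \<longrightarrow>
        (\<exists>x. \<forall>M::int. \<exists>N. \<forall>k\<ge>N. ereal (real_of_int M) \<le> v (X k - x)))"

text \<open>
  The fractional ideal \<open>M\<^sup>r\<close> (\<open>r \<in> \<int>\<close>), where \<open>M\<close> is the maximal ideal of the
  valuation ring; \<open>r = 0\<close> is the valuation ring itself and \<open>r = 1\<close> is \<open>M\<close>.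
\<close>

definition max_ideal_power :: "('a::field \<Rightarrow> ereal) \<Rightarrow> int \<Rightarrow> 'a set" where
  "max_ideal_power v r = {x. ereal (real_of_int r) \<le> v x}"

definition valuation_ring :: "('a::field \<Rightarrow> ereal) \<Rightarrow> 'a ring" where
  "valuation_ring v =
     \<lparr>carrier = max_ideal_power v 0, monoid.mult = (*), one = 1, zero = 0, add = (+)\<rparr>"

definition residue_field :: "('a::field \<Rightarrow> ereal) \<Rightarrow> 'a set ring" where
  "residue_field v = valuation_ring v Quot max_ideal_power v 1"

definition perfect_of_char :: "('b, 'c) ring_scheme \<Rightarrow> nat \<Rightarrow> bool" where
  "perfect_of_char R p \<longleftrightarrow>
     field R \<and> prime p \<and> [p] \<cdot>\<^bsub>R\<^esub> \<one>\<^bsub>R\<^esub> = \<zero>\<^bsub>R\<^esub> \<and>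
     (\<forall>a\<in>carrier R. \<exists>b\<in>carrier R. b [^]\<^bsub>R\<^esub> p = a)"

text \<open>The submodule over the valuation ring generated by a set.\<close>

definition valuation_ring_span :: "('a::field \<Rightarrow> ereal) \<Rightarrow> 'a set \<Rightarrow> 'a set" where
  "valuation_ring_span v S =
     {\<Sum>i<m. a i * s i | (m::nat) a s. \<forall>i<m. a i \<in> max_ideal_power v 0 \<and> s i \<in> S}"

section \<open>Field extensions\<close>

text \<open>
  An extension is given by a field homomorphism from the base field; a tower
  \<open>K \<subseteq> L \<subseteq> K\<^sup>s\<^sup>e\<^sup>p\<close> by \<open>\<iota> : K \<rightarrow> L\<close> and \<open>\<kappa> : L \<rightarrow> K\<^sup>s\<^sup>e\<^sup>p\<close>.
\<close>

definition ext_degree :: "('k::field \<Rightarrow> 'l::field) \<Rightarrow> nat" where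
  "ext_degree \<iota> = vector_space.dim (\<lambda>c x. \<iota> c * x) (UNIV :: 'l set)"

definition separable_poly :: "'a::field poly \<Rightarrow> bool" where
  "separable_poly f \<longleftrightarrow> coprime f (pderiv f)"

definition separable_closure :: "('k::field \<Rightarrow> 's::field) \<Rightarrow> bool" where
  "separable_closure \<iota> \<longleftrightarrow>
     field_hom \<iota> \<and>
     (\<forall>x. \<exists>f. separable_poly f \<and> poly (map_poly \<iota> f) x = 0) \<and>
     (\<forall>f :: 's poly. separable_poly f \<and> degree f > 0 \<longrightarrow> (\<exists>x. poly f x = 0))"

definition min_poly :: "('k::field \<Rightarrow> 'l::field) \<Rightarrow> 'l \<Rightarrow> 'k poly" where
  "min_poly \<iota> x =
     (THE f. lead_coeff f = 1 \<and> poly (map_poly \<iota> f) x = 0 \<and>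
             (\<forall>g. g \<noteq> 0 \<and> poly (map_poly \<iota> g) x = 0 \<longrightarrow> degree f \<le> degree g))"

text \<open>
  \<open>v\<^sub>L\<close> is normalized, so this says that \<open>v\<^sub>L\<close> lies over \<open>v\<^sub>K\<close> and that the
  ramification index equals the degree.
\<close>

definition totally_ramified ::
  "('k::field \<Rightarrow> 'l::field) \<Rightarrow> ('k \<Rightarrow> ereal) \<Rightarrow> ('l \<Rightarrow> ereal) \<Rightarrow> bool" where
  "totally_ramified \<iota> vK vL \<longleftrightarrow>
     discrete_valuation vL \<and> (\<forall>x. vL (\<iota> x) = ereal (real (ext_degree \<iota>)) * vK x)"

definition embeddings :: "('k::field \<Rightarrow> 'l::field) \<Rightarrow> ('l \<Rightarrow> 's::field) \<Rightarrow> ('l \<Rightarrow> 's) set" where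
  "embeddings \<iota> \<kappa> = {\<sigma>. field_hom \<sigma> \<and> \<sigma> \<circ> \<iota> = \<kappa> \<circ> \<iota>}"

section \<open>Elementary symmetric functions of conjugates\<close>

text \<open>The \<open>h\<close>th elementary symmetric polynomial in the family \<open>(x i)\<close>, \<open>i \<in> I\<close>.\<close>

definition elem_sym :: "nat \<Rightarrow> ('i \<Rightarrow> 'a::comm_ring_1) \<Rightarrow> 'i set \<Rightarrow> 'a" where
  "elem_sym h x I = (\<Sum>S | S \<subseteq> I \<and> card S = h. \<Prod>i\<in>S. x i)"

text \<open>
  A symmetric function of the conjugates lies in the image of \<open>K\<close> in \<open>K\<^sup>s\<^sup>e\<^sup>p\<close>;
  \<open>conj_sym\<close> (the function \<open>E\<^sub>h\<close>) is its preimage in \<open>K\<close>.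
\<close>

definition conj_sym :: "('k::field \<Rightarrow> 'l::field) \<Rightarrow> ('l \<Rightarrow> 's::field) \<Rightarrow> nat \<Rightarrow> 'l \<Rightarrow> 'k" where
  "conj_sym \<iota> \<kappa> h \<alpha> = the_inv (\<kappa> \<circ> \<iota>) (elem_sym h (\<lambda>\<sigma>. \<sigma> \<alpha>) (embeddings \<iota> \<kappa>))"

text \<open>
  The function \<open>g\<^sub>h(r)\<close>: the values lie in \<open>\<int> \<union> {\<infinity>}\<close>, so a finite infimum is attained, i.e. it is a minimum.
\<close>

definition min_val_conj_sym ::
  "('k::field \<Rightarrow> 'l::field) \<Rightarrow> ('l \<Rightarrow> 's::field) \<Rightarrow> ('k \<Rightarrow> ereal) \<Rightarrow> ('l \<Rightarrow> ereal) \<Rightarrow>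
   nat \<Rightarrow> int \<Rightarrow> ereal" where
  "min_val_conj_sym \<iota> \<kappa> vK vL h r = (INF \<alpha>\<in>max_ideal_power vL r. vK (conj_sym \<iota> \<kappa> h \<alpha>))"

section \<open>Indices of inseparability\<close>

text \<open>The \<open>p\<close>-adic valuation of an integer, with value \<open>\<infinity>\<close> at \<open>0\<close>, truncated at \<open>\<nu>\<close>.\<close>

definition vp :: "nat \<Rightarrow> int \<Rightarrow> enat" where
  "vp p k = (if k = 0 then \<infinity> else enat (multiplicity (int p) k))"

definition vp_trunc :: "nat \<Rightarrow> nat \<Rightarrow> int \<Rightarrow> enat" where
  "vp_trunc p \<nu> k = min (vp p k) (enat \<nu>)"

text \<open>
  \<open>c\<^sub>h\<close> for the minimal polynomial \<open>X\<^sup>n - c\<^sub>1 X\<^sup>n\<^sup>-\<^sup>1 + \<dots> + (-1)\<^sup>n c\<^sub>n\<close> of \<open>\<pi>\<close>.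
\<close>

definition min_poly_c :: "('k::field \<Rightarrow> 'l::field) \<Rightarrow> 'l \<Rightarrow> nat \<Rightarrow> 'k" where
  "min_poly_c \<iota> \<pi> h = (-1) ^ h * coeff (min_poly \<iota> \<pi>) (ext_degree \<iota> - h)"

definition insep_index_unif ::
  "('k::field \<Rightarrow> 'l::field) \<Rightarrow> ('k \<Rightarrow> ereal) \<Rightarrow> nat \<Rightarrow> nat \<Rightarrow> 'l \<Rightarrow> nat \<Rightarrow> ereal" where
  "insep_index_unif \<iota> vK p \<nu> \<pi> j =
     Min {ereal (real (ext_degree \<iota>)) * vK (min_poly_c \<iota> \<pi> h) - ereal (real h) | h.
            1 \<le> h \<and> h \<le> ext_degree \<iota> \<and> vp_trunc p \<nu> (int h) \<le> enat j}"

text \<open>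
  Here \<open>vL (of_nat p)\<close> is \<open>e\<^sub>L\<close>; it is \<open>\<infinity>\<close> in characteristic \<open>p\<close>, in which case the term
  for \<open>j' = j\<close> is unaffected because \<open>0 * \<infinity> = 0\<close>.
\<close>

definition insep_index_ereal ::
  "('k::field \<Rightarrow> 'l::field) \<Rightarrow> ('k \<Rightarrow> ereal) \<Rightarrow> ('l \<Rightarrow> ereal) \<Rightarrow> nat \<Rightarrow> nat \<Rightarrow> 'l \<Rightarrow> nat \<Rightarrow> ereal"
  where
  "insep_index_ereal \<iota> vK vL p \<nu> \<pi> j =
     Min {insep_index_unif \<iota> vK p \<nu> \<pi> j' + ereal (real (j' - j)) * vL (of_nat p) | j'.
            j \<le> j' \<and> j' \<le> \<nu>}"

text \<open>
  For a separable extension the minimum is a (finite) integer; the floor only changes its type.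
\<close>

definition insep_index ::
  "('k::field \<Rightarrow> 'l::field) \<Rightarrow> ('k \<Rightarrow> ereal) \<Rightarrow> ('l \<Rightarrow> ereal) \<Rightarrow> nat \<Rightarrow> nat \<Rightarrow> 'l \<Rightarrow> nat \<Rightarrow> int"
  where
  "insep_index \<iota> vK vL p \<nu> \<pi> j = \<lfloor>real_of_ereal (insep_index_ereal \<iota> vK vL p \<nu> \<pi> j)\<rfloor>"

end

theory Submission
  imports Defs "HOL-Number_Theory.Cong" "HOL-Algebra.Exponent"
begin

text \<open>
  Let \<open>F = \<Prod>(1 - \<sigma>(\<pi>) X)\<close>, a series over \<open>K\<close> whose coefficients are the \<open>\<plusminus>c\<^sub>h\<close>. The operation
  \<open>1 - y X \<mapsto> 1 - y\<^sup>s X\<close> extends multiplicatively to all power series with constant term 1: it is the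
  Frobenius of the big Witt vectors, and it is a composite of norms \<open>F(X) \<mapsto> \<Prod>\<^sub>i F(\<omega>\<^sup>i X)\<close> for prime
  \<open>l\<close> and \<open>\<omega>\<^sup>l = 1\<close>. It maps \<open>F\<close> to \<open>\<Prod>(1 - \<sigma>(\<pi>)\<^sup>s X)\<close>, with coefficients \<open>\<plusminus>E\<^sub>k(\<pi>\<^sup>s)\<close>. Every series is a
  product of binomials \<open>1 - c X\<^sup>h\<close>, on which the operation is explicit. Reading valuations off the
  binomials shows that \<open>n v\<^sub>K(coeff\<^sub>k) \<ge> t k + i\<^sub>k\<close> (the index of inseparability at \<open>min {v\<^sub>p(k), \<nu>}\<close>)
  is preserved with \<open>t\<close> replaced by \<open>t s\<close>, and that the new \<open>k\<close>-th coefficient is \<open>s\<close> times the old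
  \<open>s k\<close>-th one up to terms of larger valuation.

  Lower bound: \<open>1 - \<alpha> X\<close> is a product of binomials \<open>1 - b \<pi>\<^sup>s X\<^sup>h\<close> with \<open>b\<close> in \<open>K\<close>, and so the norm of
  \<open>1 - \<alpha> X\<close> obeys the same estimate. Attainment: take \<open>\<alpha> = b \<pi>\<^sup>s\<close>. The index \<open>i\<^sub>j\<close> comes from
  exactly one \<open>c\<^sub>h\<close>, because its class modulo \<open>n\<close> determines \<open>h\<close>, and the contribution of this \<open>c\<^sub>h\<close> to
  \<open>E\<^bsub>p\<^sup>j\<^esub>(\<pi>\<^sup>s)\<close> is computed exactly.
\<close>

section \<open>Products of binomial series\<close>

no_notation vec_index (infixl "$" 100)

text \<open>Newton's identities would express the \<open>E_k\<close> of \<open>\<pi> ^ s\<close> by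
  divisions that cost valuation or are impossible in characteristic p. The Witt vector Frobenius is
  built from products alone and avoids them. Its roots of unity live in the separable closure, so
  every bound on a coefficient also asserts that the coefficient comes from K. When
  \<open>l = 0\<close> in the field there is no primitive root, but \<open>\<omega> = 1\<close>
  serves: (1 - X)^l = 1 - X^l. Call n v_K(c_h) - h the excess of c_h. In a product of two series the
  mixed terms lie above the bound by at least the minimum of the excesses. A gain of 0 is enough for
  the lower bound; isolating a leading term takes a gain of 1. Only c_n has excess 0, all others
  have excess at least 1 by integrality. So c_n is split off as one binomial, whose image is
  explicit. The condition v_p(i_j) \<ge> j enters twice. With p^j | n it makes (n m - i_j) / p^j an
  integer, the valuation of an \<alpha> that attains m. It also forces p^j | h when i_j comes from
  c_h with h < n, and then p^j plays its part in comparing s p^j with h modulo n.\<close>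

definition one_minus :: "'a::comm_ring_1 \<Rightarrow> nat \<Rightarrow> 'a fps" where
  "one_minus c h = 1 - fps_const c * fps_X ^ h"

lemma one_minus_mult_nth:
  "(one_minus c h * F) $ l = F $ l - (if h \<le> l then c * F $ (l - h) else 0)"
proof -
  have "one_minus c h * F = F - fps_const c * (fps_X ^ h * F)"
    by (simp add: one_minus_def algebra_simps)
  then show ?thesis by (simp add: fps_X_power_mult_nth)
qed

lemma one_minus_nth:
  "h \<ge> 1 \<Longrightarrow> one_minus c h $ l = (if l = 0 then 1 else if l = h then - c else 0)"
  using one_minus_mult_nth[of c h 1 l] by auto

lemma one_minus_nth_0 [simp]: "h > 0 \<Longrightarrow> one_minus c h $ 0 = 1"
  by (simp add: one_minus_nth)

lemma prod_one_minus_nth_0 [simp]: "h \<ge> 1 \<Longrightarrow> (\<Prod>i\<in>I. one_minus (a i) h) $ 0 = 1"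
  by (induction I rule: infinite_finite_induct) (auto simp: one_minus_mult_nth)

text \<open>Substitution of \<open>X ^ h\<close> for \<open>X\<close>, stated on coefficients: the
  recursion in \<open>l\<close> with step \<open>h\<close> is the recursion in
  \<open>l div h\<close> with step 1.\<close>

lemma prod_one_minus_nth:
  assumes "finite I" "h \<ge> 1"
  shows "(\<Prod>i\<in>I. one_minus (a i) h) $ l =
    (if h dvd l then (\<Prod>i\<in>I. one_minus (a i) 1) $ (l div h) else 0)"
  using assms(1)
proof (induction I arbitrary: l rule: finite_induct)
  case empty
  then show ?case using assms(2) by (auto simp: dvd_div_eq_0_iff)
next
  case (insert i I)
  show ?case
  proof (cases "l < h")
    case True
    then show ?thesis using insert assms(2)
      by (auto simp: one_minus_mult_nth dest: dvd_imp_le)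
  next
    case False
    then have "h dvd l - h \<longleftrightarrow> h dvd l"
      by (metis dvd_minus_self)
    moreover have "(l - h) div h = l div h - 1" "l div h \<ge> 1"
      using False assms(2) by (auto simp: div_if[of l h])
    ultimately show ?thesis using insert assms(2) False
      by (auto simp: one_minus_mult_nth)
  qed
qed

lemma prod_one_minus_scale_nth:
  assumes "finite I"
  shows "(\<Prod>i\<in>I. one_minus (c * a i) 1) $ k = c ^ k * (\<Prod>i\<in>I. one_minus (a i) 1) $ k"
  using assms
proof (induction I arbitrary: k rule: finite_induct)
  case empty
  then show ?case by auto
next
  case (insert i I)
  then show ?case by (cases k) (auto simp: one_minus_mult_nth algebra_simps)
qed

lemma one_minus_power_nth:
  assumes "h \<ge> 1"
  shows "(one_minus c h ^ m) $ l =
    (if h dvd l then of_nat (m choose (l div h)) * (- c) ^ (l div h) else 0)"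
proof -
  have 1: "(one_minus c 1 ^ m) $ k = of_nat (m choose k) * (- c) ^ k" for k
  proof (induction m arbitrary: k)
    case 0
    then show ?case by (cases k) auto
  next
    case (Suc m)
    then show ?case
      by (cases k) (auto simp: one_minus_mult_nth algebra_simps)
  qed
  have "one_minus c k ^ m = (\<Prod>i\<in>{..<m}. one_minus c k)" for k by simp
  then show ?thesis
    using prod_one_minus_nth[of "{..<m}" h "\<lambda>_. c" l] assms 1 by simp
qed

text \<open>Expansion over subsets; this is the bridge from norms of series to the functions
  \<open>E_h\<close>.\<close>

lemma prod_one_minus_elem_sym:
  assumes "finite I"
  shows "(\<Prod>i\<in>I. one_minus (x i) 1) $ k = (-1) ^ k * elem_sym k x I"
proof -
  have *: "(\<Prod>i\<in>B. - (fps_const (x i) * fps_X)) =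
    fps_const ((-1) ^ card B * (\<Prod>i\<in>B. x i)) * fps_X ^ card B" if "finite B" for B
    using that by (induction B rule: finite_induct)
      (auto simp: algebra_simps fps_const_mult[symmetric] fps_const_neg[symmetric] simp del: fps_const_mult fps_const_neg)
  have "(\<Prod>i\<in>I. one_minus (x i) 1) = (\<Prod>i\<in>I. - (fps_const (x i) * fps_X) + 1)"
    by (simp add: one_minus_def)
  also have "\<dots> = (\<Sum>B\<in>Pow I. (\<Prod>i\<in>B. - (fps_const (x i) * fps_X)) * (\<Prod>i\<in>I-B. 1))"
    by (rule prod_add[OF assms])
  also have "\<dots> = (\<Sum>B\<in>Pow I. fps_const ((-1) ^ card B * (\<Prod>i\<in>B. x i)) * fps_X ^ card B)"
    using assms by (intro sum.cong) (auto simp: * finite_subset)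
  finally have "(\<Prod>i\<in>I. one_minus (x i) 1) $ k =
      (\<Sum>B\<in>Pow I. (-1) ^ card B * (\<Prod>i\<in>B. x i) * (if k = card B then 1 else 0))"
    by (simp add: fps_sum_nth)
  also have "\<dots> = (\<Sum>B\<in>{B. B \<subseteq> I \<and> card B = k}. (-1) ^ k * (\<Prod>i\<in>B. x i))"
    using assms by (intro sum.mono_neutral_cong_right) auto
  finally show ?thesis by (simp add: elem_sym_def sum_distrib_left)
qed

text \<open>Congruence modulo \<open>X ^ (m + 1)\<close>. Infinite products of binomials are never
  formed: each coefficient of interest depends on finitely many others.\<close>

definition fps_agree :: "nat \<Rightarrow> 'a::comm_ring_1 fps \<Rightarrow> 'a fps \<Rightarrow> bool" where
  "fps_agree m F G \<longleftrightarrow> (\<forall>l\<le>m. F $ l = G $ l)"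

lemma fps_agree_mult:
  "fps_agree m F F' \<Longrightarrow> fps_agree m G G' \<Longrightarrow> fps_agree m (F * G) (F' * G')"
  unfolding fps_agree_def fps_mult_nth by (intro allI impI sum.cong) auto

lemma fps_agree_prod:
  assumes "\<And>i. i \<in> I \<Longrightarrow> fps_agree m (F i) (G i)"
  shows "fps_agree m (\<Prod>i\<in>I. F i) (\<Prod>i\<in>I. G i)"
  using assms
  by (induction I rule: infinite_finite_induct) (auto intro: fps_agree_mult simp: fps_agree_def[of m 1 1])

text \<open>\<open>G h\<close> is the permitted range of the coefficient of degree \<open>h\<close>;
  the conditions make series with constant term 1 and permitted coefficients closed under products.
  Instances: valuation bounds over K, powers of the maximal ideal of L, and no restriction.\<close>

definition graded_groups :: "(nat \<Rightarrow> 'a::comm_ring_1 set) \<Rightarrow> bool" where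
  "graded_groups G \<longleftrightarrow>
     (\<forall>h\<ge>1. 0 \<in> G h \<and> (\<forall>x\<in>G h. \<forall>y\<in>G h. x - y \<in> G h)) \<and>
     (\<forall>a\<ge>1. \<forall>b\<ge>1. \<forall>x\<in>G a. \<forall>y\<in>G b. x * y \<in> G (a + b))"

definition unit_series :: "(nat \<Rightarrow> 'a::comm_ring_1 set) \<Rightarrow> 'a fps \<Rightarrow> bool" where
  "unit_series G F \<longleftrightarrow> F $ 0 = 1 \<and> (\<forall>l\<ge>1. F $ l \<in> G l)"

lemma fps_mult_nth_units:
  fixes F G :: "'a::comm_ring_1 fps"
  assumes "F $ 0 = 1" "G $ 0 = 1" "l \<ge> 1"
  shows "(F * G) $ l = F $ l + G $ l + (\<Sum>i\<in>{1..<l}. F $ i * G $ (l - i))"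
proof -
  have "{0..l} = insert 0 (insert l {1..<l})" using assms by auto
  then show ?thesis using assms by (simp add: fps_mult_nth add_ac)
qed

lemma graded_groups_add:
  assumes "graded_groups G" "h \<ge> 1" "x \<in> G h" "y \<in> G h"
  shows "x + y \<in> G h"
proof -
  have "x - (0 - y) \<in> G h" using assms unfolding graded_groups_def by blast
  then show ?thesis by simp
qed

lemma graded_groups_sum:
  assumes "graded_groups G" "h \<ge> 1" "\<And>i. i \<in> I \<Longrightarrow> f i \<in> G h"
  shows "sum f I \<in> G h"
  using assms(3)
proof (induction I rule: infinite_finite_induct)
  case (insert x F)
  then show ?case using graded_groups_add[OF assms(1,2)] by simp
qed (use assms in \<open>auto simp: graded_groups_def\<close>)

lemma unit_series_mult:
  assumes G: "graded_groups G" and F: "unit_series G F" "unit_series G F'"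
  shows "unit_series G (F * F')"
  unfolding unit_series_def
proof (intro conjI allI impI)
  show "(F * F') $ 0 = 1" using F by (simp add: unit_series_def)
next
  fix l :: nat assume l: "1 \<le> l"
  have "F $ i * F' $ (l - i) \<in> G l" if "i \<in> {1..<l}" for i
  proof -
    have "F $ i * F' $ (l - i) \<in> G (i + (l - i))"
      using G F that unfolding graded_groups_def unit_series_def
      by (metis One_nat_def Suc_leI atLeastLessThan_iff zero_less_diff)
    then show ?thesis using that by simp
  qed
  then have "(\<Sum>i\<in>{1..<l}. F $ i * F' $ (l - i)) \<in> G l"
    by (rule graded_groups_sum[OF G l])
  then show "(F * F') $ l \<in> G l"
    using F l fps_mult_nth_units[of F F' l] graded_groups_add[OF G l]
    by (simp add: unit_series_def)
qed

lemma unit_series_one_minus: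
  assumes "graded_groups G" "h \<ge> 1" "c \<in> G h"
  shows "unit_series G (one_minus c h)"
proof -
  have "0 - c \<in> G h" using assms unfolding graded_groups_def by blast
  then show ?thesis using assms
    by (auto simp: unit_series_def one_minus_nth graded_groups_def)
qed

text \<open>A multiplicative property of the binomials \<open>1 - c X\<^sup>h\<close> spreads to all series with constant
  term 1, up to arbitrarily high order: coefficients are corrected one degree at a time.\<close>

lemma unit_series_approx:
  assumes G: "graded_groups G"
    and SG: "\<And>h. h \<ge> 1 \<Longrightarrow> S h \<subseteq> G h"
    and gen: "\<And>h x. h \<ge> 1 \<Longrightarrow> x \<in> G h \<Longrightarrow> \<exists>cs. set cs \<subseteq> S h \<and> x = sum_list cs"
    and F: "unit_series G F"
    and P1: "P 1"
    and Pm: "\<And>A B. unit_series G A \<Longrightarrow> unit_series G B \<Longrightarrow> P A \<Longrightarrow> P B \<Longrightarrow> P (A * B)"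
    and Pb: "\<And>c h. h \<ge> 1 \<Longrightarrow> c \<in> S h \<Longrightarrow> P (one_minus c h)"
  shows "\<exists>Q. P Q \<and> unit_series G Q \<and> fps_agree m F Q"
proof (induction m)
  case 0
  have "unit_series G 1" using G by (auto simp: unit_series_def graded_groups_def)
  then show ?case using P1 F by (intro exI[of _ 1]) (auto simp: fps_agree_def unit_series_def)
next
  case (Suc m)
  let ?h = "Suc m"
  obtain Q where Q: "P Q" "unit_series G Q" "fps_agree m F Q" using Suc by blast
  \<comment> \<open>A factor \<open>1 - c X ^ Suc m\<close> leaves lower coefficients alone and
    subtracts \<open>c\<close> in degree \<open>Suc m\<close>. One factor per summand is used
    because \<open>S h\<close> need not be closed under addition.\<close>
  have step: "\<exists>Q'. P Q' \<and> unit_series G Q' \<and> fps_agree m Q Q' \<and> Q' $ ?h = Q $ ?h - sum_list cs"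
    if "set cs \<subseteq> S ?h" for cs
    using that
  proof (induction cs)
    case Nil
    then show ?case using Q by (intro exI[of _ Q]) (auto simp: fps_agree_def)
  next
    case (Cons c cs)
    then obtain Q' where Q': "P Q'" "unit_series G Q'" "fps_agree m Q Q'"
      "Q' $ ?h = Q $ ?h - sum_list cs" by auto
    have c: "c \<in> S ?h" "c \<in> G ?h" using Cons SG[of ?h] by auto
    have "unit_series G (one_minus c ?h)" using unit_series_one_minus[OF G _ c(2)] by simp
    then have "P (one_minus c ?h * Q')" "unit_series G (one_minus c ?h * Q')"
      using Pm Pb[OF _ c(1)] Q' unit_series_mult[OF G] by auto
    moreover have "Q' $ 0 = 1" using Q' by (simp add: unit_series_def)
    ultimately show ?case using Q'
      by (intro exI[of _ "one_minus c ?h * Q'"]) (auto simp: fps_agree_def one_minus_mult_nth)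
  qed
  have "Q $ ?h - F $ ?h \<in> G ?h"
    using G Q F unfolding graded_groups_def unit_series_def by (metis One_nat_def Suc_le_mono le0)
  then obtain cs where cs: "set cs \<subseteq> S ?h" "Q $ ?h - F $ ?h = sum_list cs"
    using gen[of ?h] by auto
  obtain Q' where Q': "P Q'" "unit_series G Q'" "fps_agree m Q Q'" "Q' $ ?h = Q $ ?h - sum_list cs"
    using step[OF cs(1)] by blast
  then have "fps_agree ?h F Q'" using Q(3) cs(2)[symmetric]
    by (auto simp: fps_agree_def le_Suc_eq)
  then show ?case using Q' by blast
qed

section \<open>Witt vector Frobenius\<close>

lemma separable_poly_dvd:
  assumes "separable_poly f" "g dvd f"
  shows "separable_poly g"
proof -
  obtain k where k: "f = g * k" using assms(2) by blast
  have "pderiv f = g * pderiv k + k * pderiv g" by (simp add: k pderiv_mult)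
  moreover have "d dvd f" if "d dvd g" for d using that k by simp
  ultimately have "d dvd f \<and> d dvd pderiv f" if "d dvd g" "d dvd pderiv g" for d
    using that by simp
  then show ?thesis using assms(1) unfolding separable_poly_def coprime_def by blast
qed

text \<open>Stands in for a primitive \<open>l\<close>-th root of unity. The factorization is all
  that the norm construction uses, and unlike primitivity it is available in characteristic
  \<open>l\<close>.\<close>

definition splits_by_powers :: "'a::field \<Rightarrow> nat \<Rightarrow> bool" where
  "splits_by_powers \<omega> l \<longleftrightarrow> \<omega> ^ l = 1 \<and> (\<Prod>i<l. one_minus (\<omega> ^ i) 1) = one_minus 1 l"

lemma fps_of_poly_linear_one_minus: "fps_of_poly [:1, - c:] = one_minus c 1"
  by (rule fps_ext) (auto simp: one_minus_nth coeff_pCons split: nat.splits)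

lemma power_eq_one_prime:
  fixes \<omega> :: "'a::field"
  assumes "prime l" "\<omega> ^ l = 1" "\<omega> ^ k = 1" "\<not> l dvd k"
  shows "\<omega> = 1"
proof -
  have "coprime k l" using assms prime_imp_coprime coprime_commute by blast
  then obtain x y where xy: "k * x = l * y + 1"
    using assms(4) by (metis bezout_nat coprime_imp_gcd_eq_1 dvd_0_right)
  have "\<omega> ^ (k * x) = 1" using assms by (simp add: power_mult)
  moreover have "\<omega> ^ (l * y + 1) = \<omega>" using assms by (simp add: power_add power_mult)
  ultimately show ?thesis using xy by simp
qed

lemma exists_splits_by_powers:
  assumes closed: "\<forall>f :: 'a::field poly. separable_poly f \<and> degree f > 0 \<longrightarrow> (\<exists>x. poly f x = 0)"
    and l: "prime l"
  shows "\<exists>\<omega>::'a. splits_by_powers \<omega> l"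
proof (cases "of_nat l = (0::'a)")
  case True
  have l2: "l \<ge> 2" using l prime_ge_2_nat by blast
  have "(one_minus (1::'a) 1 ^ l) $ k = one_minus 1 l $ k" for k
  proof -
    consider "k = 0" | "0 < k" "k < l" | "k = l" | "k > l" by linarith
    then show ?thesis
    proof cases
      case 2
      then have "l dvd l choose k" using l by (intro dvd_choose_prime) auto
      then have "of_nat (l choose k) = (0::'a)" using True by (auto elim!: dvdE)
      then show ?thesis using 2 l2 by (simp add: one_minus_power_nth one_minus_nth)
    next
      case 3
      \<comment> \<open>The top coefficient of \<open>(1 - X) ^ l\<close> is
        \<open>(-1) ^ l\<close>; for \<open>l = 2\<close> the sign disappears because
        \<open>1 + 1 = 0\<close>.\<close>
      have "(-1::'a) ^ l = -1"
      proof (cases "odd l")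
        case False
        then have "l = 2" using l primes_dvd_imp_eq two_is_prime_nat by blast
        then have "(1::'a) + 1 = 0" using True by simp
        then show ?thesis using \<open>l = 2\<close> by (simp add: eq_neg_iff_add_eq_0)
      qed simp
      then show ?thesis using 3 l2 by (simp add: one_minus_power_nth one_minus_nth)
    qed (use l2 in \<open>simp_all add: one_minus_power_nth one_minus_nth binomial_eq_0\<close>)
  qed
  then have "splits_by_powers (1::'a) l"
    by (simp add: splits_by_powers_def fps_eq_iff)
  then show ?thesis by blast
next
  case False
  have l2: "l \<ge> 2" using l prime_ge_2_nat by blast
  define f :: "'a poly" where "f = monom 1 l - 1"
  define g :: "'a poly" where "g = (\<Sum>i<l. monom 1 i)"
  have fg: "f = [:-1, 1:] * g"
  proof -
    have "f = [:0, 1:] ^ l - 1" by (simp add: f_def monom_altdef)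
    also have "\<dots> = ([:0, 1:] - 1) * (\<Sum>i<l. [:0, 1:] ^ i)" by (rule power_diff_1_eq)
    also have "[:0, 1:] - 1 = [:-1, 1::'a:]" by (simp add: one_pCons)
    finally show ?thesis by (simp add: g_def monom_altdef)
  qed
  have "separable_poly f"
  proof -
    have "pderiv f = monom (of_nat l) (l - 1)"
      by (simp add: f_def pderiv_diff pderiv_monom)
    \<comment> \<open>Separability is witnessed by the identity (X / l) f' - f = 1.\<close>
    then have "monom (inverse (of_nat l)) 1 * pderiv f = monom 1 l"
      using False l2 by (simp add: mult_monom)
    then have "monom (inverse (of_nat l)) 1 * pderiv f - f = 1"
      by (simp add: f_def)
    then have "d dvd 1" if "d dvd f" "d dvd pderiv f" for d
      using that by (metis dvd_diff dvd_mult)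
    then show ?thesis unfolding separable_poly_def by (intro coprimeI) auto
  qed
  then have "separable_poly g" using separable_poly_dvd fg by (metis dvd_triv_right)
  moreover have "coeff g (l - 1) \<noteq> 0"
    using l2 by (simp add: g_def coeff_sum)
  then have "degree g \<ge> l - 1" using le_degree by blast
  ultimately obtain \<omega> where w: "poly g \<omega> = 0" using closed l2 by fastforce
  have w1: "\<omega> ^ l = 1"
    using arg_cong[OF fg, of "\<lambda>q. poly q \<omega>"] w by (simp add: f_def poly_monom)
  \<comment> \<open>At 1 the polynomial \<open>g\<close> takes the value \<open>l\<close>, which is
    nonzero in this case.\<close>
  have wn: "\<omega> \<noteq> 1"
    using w False by (auto simp: g_def poly_sum poly_monom)
  have w0: "\<omega> \<noteq> 0" using w1 l2 by (auto simp: power_0_left split: if_splits)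
  have inj: "inj_on (\<lambda>i. \<omega> ^ i) {..<l}"
  proof (rule linorder_inj_onI')
    fix i j assume ij: "i \<in> {..<l}" "j \<in> {..<l}" "i < j"
    show "\<omega> ^ i \<noteq> \<omega> ^ j"
    proof
      assume "\<omega> ^ i = \<omega> ^ j"
      moreover have "\<omega> ^ j = \<omega> ^ i * \<omega> ^ (j - i)" using ij by (simp add: power_add[symmetric])
      ultimately have "\<omega> ^ (j - i) = 1" using w0 by simp
      moreover have "\<not> l dvd j - i" using ij by (auto dest!: dvd_imp_le)
      ultimately show False using power_eq_one_prime[OF l w1] wn by blast
    qed
  qed
  define P where "P = (\<Prod>i<l. [:1, - (\<omega> ^ i):])"
  define Q where "Q = 1 - monom (1::'a) l"
  \<comment> \<open>These are \<open>l + 1\<close> points, one more than the degrees of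
    \<open>P\<close> and \<open>Q\<close>: both are 1 at 0 and vanish at the powers of
    \<open>\<omega>\<close>, whose inverses are again powers of \<open>\<omega>\<close>.\<close>
  define A where "A = insert 0 ((\<lambda>i. \<omega> ^ i) ` {..<l})"
  have cA: "card A = Suc l" using inj w0 by (auto simp: A_def card_image card_insert_if)
  have "P = Q"
  proof (rule poly_eqI_degree[where A = A])
    fix x assume "x \<in> A"
    then consider "x = 0" | j where "j < l" "x = \<omega> ^ j" by (auto simp: A_def)
    then show "poly P x = poly Q x"
    proof cases
      case 1
      then show ?thesis using l2 by (simp add: P_def Q_def poly_prod poly_monom power_0_left)
    next
      case 2
      define i where "i = (l - j) mod l"
      have "\<omega> ^ (i + j) = 1"
        using w1 2 by (cases "j = 0") (auto simp: i_def)
      then have "poly [:1, - (\<omega> ^ i):] x = 0" using 2 by (simp add: power_add mult.commute)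
      moreover have "i < l" using l2 by (simp add: i_def)
      ultimately have "poly P x = 0" by (auto simp: P_def poly_prod)
      moreover have "(\<omega> ^ j) ^ l = (\<omega> ^ l) ^ j" by (simp only: power_mult[symmetric] mult.commute)
      then have "poly Q x = 0" using 2 w1 by (simp add: Q_def poly_monom)
      ultimately show ?thesis by simp
    qed
  next
    have "degree P \<le> (\<Sum>i<l. degree [:1, - (\<omega> ^ i):])"
      unfolding P_def using degree_prod_sum_le[of "{..<l}" "\<lambda>i. [:1, - (\<omega> ^ i):]"]
      by (simp only: o_def finite_lessThan)
    also have "\<dots> \<le> (\<Sum>i<l. 1)" by (rule sum_mono) simp
    finally show "card A > degree P" by (simp add: cA)
    have "degree Q \<le> l" unfolding Q_def
      by (intro degree_diff_le) (auto simp: degree_monom_le)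
    then show "card A > degree Q" by (simp add: cA)
  qed
  then have "fps_of_poly P = fps_of_poly Q" by simp
  moreover have "fps_of_poly P = (\<Prod>i<l. one_minus (\<omega> ^ i) 1)"
    by (simp only: P_def fps_of_poly_prod fps_of_poly_linear_one_minus)
  moreover have "fps_of_poly Q = one_minus 1 l"
    by (simp add: Q_def fps_of_poly_diff fps_of_poly_monom one_minus_def)
  ultimately show ?thesis using w1 unfolding splits_by_powers_def by metis
qed

section \<open>Norms along the rotations X to omega^i X\<close>

definition fps_scale :: "'a::comm_ring_1 \<Rightarrow> 'a fps \<Rightarrow> 'a fps" where
  "fps_scale z F = Abs_fps (\<lambda>k. z ^ k * F $ k)"

lemma fps_scale_nth [simp]: "fps_scale z F $ k = z ^ k * F $ k"
  by (simp add: fps_scale_def)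

lemma fps_scale_mult: "fps_scale z (F * G) = fps_scale z F * fps_scale z G"
proof (rule fps_ext)
  fix l
  have "z ^ l * (F $ i * G $ (l - i)) = z ^ i * F $ i * (z ^ (l - i) * G $ (l - i))" if "i \<le> l" for i
  proof -
    have "z ^ l = z ^ i * z ^ (l - i)" using that by (simp add: power_add[symmetric])
    then show ?thesis by (simp add: mult_ac)
  qed
  then show "fps_scale z (F * G) $ l = (fps_scale z F * fps_scale z G) $ l"
    by (auto simp: fps_mult_nth sum_distrib_left intro!: sum.cong)
qed

lemma fps_scale_one_minus: "h \<ge> 1 \<Longrightarrow> fps_scale z (one_minus c h) = one_minus (c * z ^ h) h"
  by (rule fps_ext) (auto simp: one_minus_nth)

definition conj_prod :: "nat \<Rightarrow> 'a::comm_ring_1 \<Rightarrow> 'a fps \<Rightarrow> 'a fps" where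
  "conj_prod l \<omega> F = (\<Prod>i<l. fps_scale (\<omega> ^ i) F)"

text \<open>If \<open>\<omega>\<close> is a primitive \<open>l\<close>-th root of unity then \<open>conj_prod l \<omega>\<close> is the norm from
  \<open>A\<lbrakk>X\<rbrakk>\<close> to \<open>A\<lbrakk>X\<^sup>l\<rbrakk>\<close>; written as a series in \<open>X\<^sup>l\<close> it is the Frobenius of the big Witt vectors,
  determined by \<open>1 - y X \<mapsto> 1 - y\<^sup>l X\<close> and multiplicativity.\<close>

definition witt_frob :: "nat \<Rightarrow> 'a::comm_ring_1 \<Rightarrow> 'a fps \<Rightarrow> 'a fps" where
  "witt_frob l \<omega> F = Abs_fps (\<lambda>k. conj_prod l \<omega> F $ (l * k))"

lemma conj_prod_mult: "conj_prod l \<omega> (F * G) = conj_prod l \<omega> F * conj_prod l \<omega> G"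
  by (simp add: conj_prod_def fps_scale_mult prod.distrib)

lemma fps_prod_nth_0: "(\<Prod>i\<in>I. F i) $ 0 = (\<Prod>i\<in>I. (F i :: 'a::comm_ring_1 fps) $ 0)"
  by (induction I rule: infinite_finite_induct) auto

lemma conj_prod_nth_0: "F $ 0 = 1 \<Longrightarrow> conj_prod l \<omega> F $ 0 = 1"
  by (simp add: conj_prod_def fps_prod_nth_0)

lemma conj_prod_agree: "fps_agree m F G \<Longrightarrow> fps_agree m (conj_prod l \<omega> F) (conj_prod l \<omega> G)"
  unfolding conj_prod_def by (rule fps_agree_prod) (auto simp: fps_agree_def)

text \<open>If \<open>l\<close> divides \<open>h\<close>, all conjugates of
  \<open>1 - c X ^ h\<close> coincide. Otherwise multiplication by \<open>h\<close> permutes the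
  residues modulo \<open>l\<close>, and the factorization of \<open>1 - X ^ l\<close> applies with
  \<open>c X ^ h\<close> for \<open>X\<close>.\<close>

lemma conj_prod_one_minus:
  assumes l: "prime l" and w: "splits_by_powers \<omega> l" and h: "h \<ge> 1"
  shows "conj_prod l \<omega> (one_minus c h) =
    (if l dvd h then one_minus c h ^ l else one_minus (c ^ l) (h * l))"
proof (cases "l dvd h")
  case True
  then obtain q where "h = l * q" by blast
  then have "\<omega> ^ (i * h) = (\<omega> ^ l) ^ (i * q)" for i
    by (simp add: power_mult[symmetric] mult_ac)
  then have "\<omega> ^ (i * h) = 1" for i using w by (simp add: splits_by_powers_def)
  then show ?thesis using True h
    by (simp add: conj_prod_def fps_scale_one_minus power_mult[symmetric])
next
  case False
  have l0: "l > 0" using l prime_gt_0_nat by blast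
  have wl: "\<omega> ^ (i mod l) = \<omega> ^ i" for i
  proof -
    have "\<omega> ^ i = \<omega> ^ (l * (i div l) + i mod l)" by simp
    also have "\<dots> = \<omega> ^ (i mod l)"
      using w by (simp only: power_add power_mult) (simp add: splits_by_powers_def)
    finally show ?thesis by simp
  qed
  have cop: "coprime h l" using False l prime_imp_coprime coprime_commute by blast
  have inj: "inj_on (\<lambda>i. (i * h) mod l) {..<l}"
  proof (rule inj_onI)
    fix i j assume ij: "i \<in> {..<l}" "j \<in> {..<l}" "i * h mod l = j * h mod l"
    then have "[i * h = j * h] (mod l)" by (simp add: cong_def)
    then have "[i = j] (mod l)" using cop cong_mult_rcancel_nat by blast
    then show "i = j" using ij by (simp add: cong_def)
  qed
  have img: "(\<lambda>i. (i * h) mod l) ` {..<l} = {..<l}"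
    by (rule endo_inj_surj) (use inj l0 in auto)
  have "conj_prod l \<omega> (one_minus c h) = (\<Prod>i<l. one_minus (c * \<omega> ^ ((i * h) mod l)) h)"
    using h by (simp add: conj_prod_def fps_scale_one_minus power_mult[symmetric] wl)
  also have "\<dots> = (\<Prod>i\<in>(\<lambda>i. (i * h) mod l) ` {..<l}. one_minus (c * \<omega> ^ i) h)"
    using inj by (simp add: prod.reindex)
  finally have eq: "conj_prod l \<omega> (one_minus c h) = (\<Prod>i<l. one_minus (c * \<omega> ^ i) h)"
    by (simp only: img)
  have "(\<Prod>i<l. one_minus (c * \<omega> ^ i) h) $ m = one_minus (c ^ l) (h * l) $ m" for m
  proof (cases "h dvd m")
    case True
    have "(\<Prod>i<l. one_minus (c * \<omega> ^ i) h) $ m = c ^ (m div h) * one_minus 1 l $ (m div h)"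
      using True w h prod_one_minus_scale_nth[of "{..<l}" c "\<lambda>i. \<omega> ^ i" "m div h"]
        prod_one_minus_nth[of "{..<l}" h "\<lambda>i. c * \<omega> ^ i" m]
      by (simp add: splits_by_powers_def)
    moreover obtain q where "m = h * q" using True by blast
    moreover have "h * l \<ge> 1" using h l0 by (simp add: Suc_leI)
    ultimately show ?thesis using l0 h by (simp add: one_minus_nth)
  next
    case False
    then have "m \<noteq> 0" "m \<noteq> h * l" by (metis dvd_0_right) (use False in auto)
    moreover have "h * l \<ge> 1" using h l0 by (simp add: Suc_leI)
    ultimately show ?thesis using False h prod_one_minus_nth[of "{..<l}" h "\<lambda>i. c * \<omega> ^ i" m]
      by (simp add: one_minus_nth)
  qed
  then show ?thesis using False eq by (auto simp: fps_eq_iff)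
qed

lemma graded_groups_UNIV: "graded_groups (\<lambda>_. UNIV)"
  by (simp add: graded_groups_def)

text \<open>Visible on binomials and stable under products, hence true for all series by
  approximation. It is what makes extracting every \<open>l\<close>-th coefficient
  multiplicative.\<close>

lemma conj_prod_support:
  assumes l: "prime l" and w: "splits_by_powers \<omega> l" and F: "F $ 0 = 1" and m: "\<not> l dvd m"
  shows "conj_prod l \<omega> F $ m = 0"
proof -
  define P where "P = (\<lambda>A. \<forall>m. \<not> l dvd m \<longrightarrow> conj_prod l \<omega> A $ m = 0)"
  have "\<exists>Q. P Q \<and> unit_series (\<lambda>_. UNIV) Q \<and> fps_agree m F Q"
  proof (rule unit_series_approx[where S = "\<lambda>_. UNIV"])
    show "\<exists>cs. set cs \<subseteq> UNIV \<and> x = sum_list cs" for x :: 'a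
      by (rule exI[of _ "[x]"]) simp
    show "unit_series (\<lambda>_. UNIV) F" using F by (simp add: unit_series_def)
    show "P 1" unfolding P_def conj_prod_def
    proof (intro allI impI)
      fix m assume m: "\<not> l dvd m"
      have "fps_scale z 1 = (1 :: 'a fps)" for z by (rule fps_ext) simp
      then show "(\<Prod>i<l. fps_scale (\<omega> ^ i) 1) $ m = 0" using m by (auto intro: gr0I)
    qed
    show "P (A * B)" if "P A" "P B" for A B
      unfolding P_def conj_prod_mult
    proof (intro allI impI)
      fix m assume m: "\<not> l dvd m"
      have "conj_prod l \<omega> A $ i * conj_prod l \<omega> B $ (m - i) = 0" if "i \<le> m" for i
      proof -
        have "\<not> l dvd i \<or> \<not> l dvd m - i" using m that by (metis dvd_add le_add_diff_inverse)
        then show ?thesis using \<open>P A\<close> \<open>P B\<close> by (auto simp: P_def)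
      qed
      then show "(conj_prod l \<omega> A * conj_prod l \<omega> B) $ m = 0"
        unfolding fps_mult_nth by (intro sum.neutral) auto
    qed
    show "P (one_minus c h)" if h: "h \<ge> 1" for c h
      unfolding P_def
    proof (intro allI impI)
      fix m assume m: "\<not> l dvd m"
      then have "m \<noteq> 0" "m \<noteq> h * l" by (metis dvd_0_right) (use m in auto)
      moreover have "l dvd h \<Longrightarrow> \<not> h dvd m" using m dvd_trans by blast
      moreover have "h * l \<ge> 1" using h prime_gt_0_nat[OF l] by (simp add: Suc_leI)
      ultimately show "conj_prod l \<omega> (one_minus c h) $ m = 0"
        using h by (auto simp: conj_prod_one_minus[OF l w h] one_minus_power_nth one_minus_nth)
    qed
  qed (use graded_groups_UNIV in auto)
  then obtain Q where "P Q" "fps_agree m F Q" by blast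
  then have "conj_prod l \<omega> F $ m = conj_prod l \<omega> Q $ m"
    using conj_prod_agree[of m F Q l \<omega>] by (simp add: fps_agree_def)
  then show ?thesis using \<open>P Q\<close> m by (simp add: P_def)
qed

lemma witt_frob_nth_0: "F $ 0 = 1 \<Longrightarrow> witt_frob l \<omega> F $ 0 = 1"
  by (simp add: witt_frob_def conj_prod_nth_0)

lemma witt_frob_mult:
  assumes l: "prime l" and w: "splits_by_powers \<omega> l" and F: "F $ 0 = 1" "G $ 0 = 1"
  shows "witt_frob l \<omega> (F * G) = witt_frob l \<omega> F * witt_frob l \<omega> G"
proof (rule fps_ext)
  fix k
  let ?A = "conj_prod l \<omega> F" and ?B = "conj_prod l \<omega> G"
  have l0: "l > 0" using l prime_gt_0_nat by blast
  have "witt_frob l \<omega> (F * G) $ k = (\<Sum>i\<in>{0..l*k}. ?A $ i * ?B $ (l * k - i))"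
    by (simp add: witt_frob_def conj_prod_mult fps_mult_nth)
  also have "\<dots> = (\<Sum>i\<in>(\<lambda>i. l * i) ` {0..k}. ?A $ i * ?B $ (l * k - i))"
  proof (rule sum.mono_neutral_right)
    show "\<forall>i\<in>{0..l * k} - (*) l ` {0..k}. ?A $ i * ?B $ (l * k - i) = 0"
    proof
      fix i assume i: "i \<in> {0..l * k} - (*) l ` {0..k}"
      then have "\<not> l dvd i" using l0 by (auto elim!: dvdE)
      then show "?A $ i * ?B $ (l * k - i) = 0" using conj_prod_support[OF l w F(1)] by simp
    qed
  qed auto
  also have "\<dots> = (\<Sum>i\<in>{0..k}. ?A $ (l * i) * ?B $ (l * k - l * i))"
    using l0 by (subst sum.reindex) (auto simp: inj_on_def)
  also have "\<dots> = (witt_frob l \<omega> F * witt_frob l \<omega> G) $ k"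
    by (simp add: fps_mult_nth witt_frob_def diff_mult_distrib2)
  finally show "witt_frob l \<omega> (F * G) $ k = (witt_frob l \<omega> F * witt_frob l \<omega> G) $ k" .
qed

lemma witt_frob_one_minus:
  assumes l: "prime l" and w: "splits_by_powers \<omega> l" and h: "h \<ge> 1"
  shows "witt_frob l \<omega> (one_minus c h) =
    (if l dvd h then one_minus c (h div l) ^ l else one_minus (c ^ l) h)"
proof (rule fps_ext)
  fix k
  have l0: "l > 0" using l prime_gt_0_nat by blast
  show "witt_frob l \<omega> (one_minus c h) $ k =
    (if l dvd h then one_minus c (h div l) ^ l else one_minus (c ^ l) h) $ k"
  proof (cases "l dvd h")
    case True
    then obtain q where q: "h = l * q" by blast
    then have "q \<ge> 1" using h by (cases q) auto
    then show ?thesis using True q h l0 conj_prod_one_minus[OF l w h, of c]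
      by (simp add: witt_frob_def one_minus_power_nth)
  next
    case False
    then show ?thesis using h l0
      by (simp add: witt_frob_def conj_prod_one_minus[OF l w h] one_minus_nth mult.commute[of h])
  qed
qed

lemma witt_frob_agree:
  "fps_agree (l * k) F G \<Longrightarrow> witt_frob l \<omega> F $ k = witt_frob l \<omega> G $ k"
  using conj_prod_agree[of "l * k" F G l \<omega>] by (simp add: witt_frob_def fps_agree_def)

section \<open>Valuation estimates\<close>

text \<open>Only the small field carries a valuation; the series live over the large one.
  \<open>w\<close> is not normalized: it will be v_L restricted to K.\<close>

locale valued_embedding = tau: field_hom \<tau>
  for \<tau> :: "'k::field \<Rightarrow> 's::field" +
  fixes w :: "'k \<Rightarrow> ereal" and p \<nu> :: nat
  assumes w_eq_infinity: "w x = \<infinity> \<longleftrightarrow> x = 0"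
    and w_not_minfinity: "w x \<noteq> - \<infinity>"
    and w_mult: "w (x * y) = w x + w y"
    and w_add: "min (w x) (w y) \<le> w (x + y)"
    and prime_p: "prime p"
    and w_p: "w (of_nat p) > 0"
begin

lemma w_0 [simp]: "w 0 = \<infinity>"
  by (simp add: w_eq_infinity)

lemma w_1 [simp]: "w 1 = 0"
proof -
  have "w 1 = w 1 + w 1" using w_mult[of 1 1] by simp
  moreover have "\<bar>w 1\<bar> \<noteq> \<infinity>" using w_eq_infinity[of 1] w_not_minfinity[of 1] by (cases "w 1") auto
  ultimately show ?thesis by (cases "w 1") auto
qed

lemma w_uminus [simp]: "w (- x) = w x"
proof -
  have "w (-1) + w (-1) = 0" using w_mult[of "-1" "-1"] by simp
  then have "w (-1) = 0" by (cases "w (-1)") auto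
  then show ?thesis using w_mult[of "-1" x] by simp
qed

lemma w_of_nat_nonneg: "0 \<le> w (of_nat m)"
proof (induction m)
  case (Suc m)
  then show ?case using w_add[of 1 "of_nat m"] by simp
qed simp

lemma w_power: "w (x ^ i) = ereal (real i) * w x"
proof (cases "x = 0")
  case True
  then show ?thesis by (cases i) auto
next
  case False
  then obtain r where "w x = ereal r"
    using w_eq_infinity[of x] w_not_minfinity[of x] by (cases "w x") auto
  then have "w (x ^ i) = ereal (real i * r)"
    by (induction i) (auto simp: w_mult algebra_simps)
  then show ?thesis using \<open>w x = ereal r\<close> by simp
qed

text \<open>The large field has no valuation here, so a bound has to include membership in the image
  of \<open>\<tau>\<close>; this also carries rationality over K through the roots of unity.\<close>

definition vge :: "'s \<Rightarrow> ereal \<Rightarrow> bool" where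
  "vge y b \<longleftrightarrow> (\<exists>x. y = \<tau> x \<and> b \<le> w x)"

lemma vge_0 [simp]: "vge 0 b"
  unfolding vge_def by (rule exI[of _ 0]) simp

lemma vge_mono: "vge y b \<Longrightarrow> c \<le> b \<Longrightarrow> vge y c"
  unfolding vge_def using order_trans by blast

lemma vge_add: "vge y b \<Longrightarrow> vge z b \<Longrightarrow> vge (y + z) b"
  unfolding vge_def by (metis tau.hom_add w_add min.boundedI order_trans)

lemma vge_uminus: "vge y b \<Longrightarrow> vge (- y) b"
  unfolding vge_def by (metis tau.hom_uminus w_uminus)

lemma vge_diff: "vge y b \<Longrightarrow> vge z b \<Longrightarrow> vge (y - z) b"
  using vge_add[of y b "- z"] vge_uminus[of z b] by simp

lemma vge_mult: "vge y b \<Longrightarrow> vge z c \<Longrightarrow> vge (y * z) (b + c)"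
  unfolding vge_def by (metis tau.hom_mult w_mult add_mono)

lemma vge_sum: "(\<And>i. i \<in> I \<Longrightarrow> vge (f i) b) \<Longrightarrow> vge (sum f I) b"
  by (induction I rule: infinite_finite_induct) (auto intro: vge_add)

lemma vge_hom: "vge (\<tau> x) (w x)"
  unfolding vge_def by blast

lemma vge_hom_iff: "vge (\<tau> x) b \<longleftrightarrow> b \<le> w x"
  unfolding vge_def by auto

lemma vge_of_nat: "vge (of_nat m) (w (of_nat m))"
  using vge_hom[of "of_nat m"] by (simp add: tau.hom_of_nat)

lemma vge_of_nat_mult: "vge y b \<Longrightarrow> vge (of_nat m * y) b"
  using vge_mono[OF vge_mult[OF vge_of_nat, of y b m], of b] w_of_nat_nonneg[of m]
  by (simp add: add_increasing)

text \<open>\<open>tv\<close> is the paper's truncated valuation \<open>min {v\<^sub>p, \<nu>}\<close>, on positive integers.\<close>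

definition tv :: "nat \<Rightarrow> nat" where
  "tv k = min (multiplicity p k) \<nu>"

lemma tv_le [simp]: "tv k \<le> \<nu>"
  by (simp add: tv_def)

lemma tv_ge_iff: "k \<ge> 1 \<Longrightarrow> i \<le> tv k \<longleftrightarrow> i \<le> \<nu> \<and> p ^ i dvd k"
  using prime_p by (auto simp: tv_def power_dvd_iff_le_multiplicity prime_nat_iff)

lemma tv_add: "a \<ge> 1 \<Longrightarrow> b \<ge> 1 \<Longrightarrow> min (tv a) (tv b) \<le> tv (a + b)"
  using tv_ge_iff[of a "min (tv a) (tv b)"] tv_ge_iff[of b "min (tv a) (tv b)"]
    tv_ge_iff[of "a + b" "min (tv a) (tv b)"] by auto

lemma tv_dvd: "a dvd b \<Longrightarrow> a \<ge> 1 \<Longrightarrow> b \<ge> 1 \<Longrightarrow> tv a \<le> tv b"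
  using tv_ge_iff[of a "tv a"] tv_ge_iff[of b "tv a"] by (auto intro: dvd_trans)

text \<open>The properties of the indices of inseparability that make the estimates work; \<open>\<epsilon> = 0\<close> gives
  bounds and \<open>\<epsilon> = 1\<close> gives congruences modulo strictly larger valuation.\<close>

definition profile :: "ereal \<Rightarrow> (nat \<Rightarrow> ereal) \<Rightarrow> bool" where
  "profile \<epsilon> d \<longleftrightarrow> 0 \<le> \<epsilon> \<and> (\<forall>j\<le>\<nu>. \<epsilon> \<le> d j) \<and> (\<forall>j\<le>\<nu>. \<forall>i\<le>j. d j \<le> d i) \<and>
     (\<forall>j<\<nu>. d j \<le> w (of_nat p) + d (Suc j))"

definition bnd :: "int \<Rightarrow> (nat \<Rightarrow> ereal) \<Rightarrow> nat \<Rightarrow> ereal" where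
  "bnd t d l = ereal (of_int t * real l) + d (tv l)"

abbreviation good :: "int \<Rightarrow> (nat \<Rightarrow> ereal) \<Rightarrow> 's fps \<Rightarrow> bool" where
  "good t d \<equiv> unit_series (\<lambda>l. {y. vge y (bnd t d l)})"

lemma profile_mono: "profile \<epsilon> d \<Longrightarrow> i \<le> j \<Longrightarrow> j \<le> \<nu> \<Longrightarrow> d j \<le> d i"
  by (simp add: profile_def)

text \<open>Multiplication by \<open>l\<close> changes \<open>tv\<close> only if
  \<open>l = p\<close>, and then by at most one step; the last clause of \<open>profile\<close> says
  that \<open>w p\<close> pays for one step.\<close>

lemma profile_prime_mult:
  assumes d: "profile \<epsilon> d" and l: "prime l" and q: "q \<ge> 1"
  shows "d (tv q) \<le> w (of_nat l) + d (tv (l * q))"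
proof -
  have l0: "l \<noteq> 0" using l by auto
  have m: "multiplicity p (l * q) = multiplicity p l + multiplicity p q"
    using prime_p l0 q by (intro prime_elem_multiplicity_mult_distrib) auto
  show ?thesis
  proof (cases "l = p \<and> multiplicity p q < \<nu>")
    case True
    then have "tv q = multiplicity p q" "tv (l * q) = Suc (multiplicity p q)"
      using m prime_p by (auto simp: tv_def)
    then show ?thesis using d True by (auto simp: profile_def)
  next
    case False
    have "tv (l * q) = tv q"
      using m False l prime_p by (cases "l = p") (auto simp: tv_def prime_multiplicity_other)
    then show ?thesis using w_of_nat_nonneg[of l] by (simp add: add_increasing)
  qed
qed

lemma profile_mult:
  assumes d: "profile \<epsilon> d" and "s \<ge> 1" "q \<ge> 1"
  shows "d (tv q) \<le> w (of_nat s) + d (tv (s * q))"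
  using assms(2,3)
proof (induction s arbitrary: q rule: prime_divisors_induct)
  case (factor l s)
  then have s: "s \<ge> 1" by auto
  have "d (tv q) \<le> w (of_nat l) + d (tv (l * q))"
    using profile_prime_mult[OF d] factor by simp
  also have "\<dots> \<le> w (of_nat l) + (w (of_nat s) + d (tv (s * (l * q))))"
    using factor s prime_gt_0_nat[of l] by (intro add_left_mono factor) (auto simp: Suc_le_eq)
  finally show ?case
    by (simp add: w_mult mult_ac add_ac)
qed auto

text \<open>Since \<open>tv (a + b)\<close> is at least the smaller of \<open>tv a\<close> and
  \<open>tv b\<close>, one of the two \<open>d\<close> values already dominates
  \<open>d (tv (a + b))\<close>; the other one is left over and supplies
  \<open>\<epsilon>\<close>.\<close>

lemma bnd_add:
  assumes d: "profile \<epsilon> d" and ab: "a \<ge> 1" "b \<ge> 1"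
  shows "bnd t d (a + b) + \<epsilon> \<le> bnd t d a + bnd t d b"
proof -
  have e: "\<epsilon> \<le> d (tv a)" "\<epsilon> \<le> d (tv b)" using d by (auto simp: profile_def)
  have "d (tv (a + b)) + \<epsilon> \<le> d (tv a) + d (tv b)"
  proof (cases "tv a \<le> tv (a + b)")
    case True
    then show ?thesis using e(2) profile_mono[OF d True] by (simp add: add_mono)
  next
    case False
    then have "tv b \<le> tv (a + b)" using tv_add[OF ab] by auto
    then show ?thesis using e(1) profile_mono[OF d \<open>tv b \<le> tv (a + b)\<close>]
      by (subst add.commute) (simp add: add_mono)
  qed
  then have "ereal (of_int t * real (a + b)) + (d (tv (a + b)) + \<epsilon>) \<le>
      ereal (of_int t * real (a + b)) + (d (tv a) + d (tv b))" by (rule add_left_mono)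
  also have "ereal (of_int t * real (a + b)) = ereal (of_int t * real a) + ereal (of_int t * real b)"
    by (simp add: algebra_simps)
  finally show ?thesis by (simp add: bnd_def add_ac algebra_simps)
qed

lemma bnd_mult:
  assumes "profile \<epsilon> d" "s \<ge> 1" "k \<ge> 1"
  shows "bnd (t * int s) d k \<le> w (of_nat s) + bnd t d (s * k)"
proof -
  have "ereal (of_int (t * int s) * real k) + d (tv k) \<le>
      ereal (of_int (t * int s) * real k) + (w (of_nat s) + d (tv (s * k)))"
    by (intro add_left_mono profile_mult[OF assms])
  then show ?thesis by (simp add: bnd_def add_ac mult_ac)
qed

lemma le_add_eps: "profile \<epsilon> d \<Longrightarrow> b \<le> b + \<epsilon>"
  using add_left_mono[of 0 \<epsilon> b] by (simp add: profile_def)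

lemma graded_groups_bnd:
  assumes d: "profile \<epsilon> d"
  shows "graded_groups (\<lambda>l. {y. vge y (bnd t d l)})"
  unfolding graded_groups_def
proof (intro conjI allI impI ballI)
  fix a b :: nat and x y
  assume "a \<ge> 1" "b \<ge> 1" "x \<in> {y. vge y (bnd t d a)}" "y \<in> {y. vge y (bnd t d b)}"
  then show "x * y \<in> {y. vge y (bnd t d (a + b))}"
    using vge_mult[of x "bnd t d a" y "bnd t d b"] bnd_add[OF d, of a b t]
      le_add_eps[OF d, of "bnd t d (a + b)"]
    by (auto intro: vge_mono)
qed (auto intro: vge_diff)

lemma good_mult: "profile \<epsilon> d \<Longrightarrow> good t d F \<Longrightarrow> good t d G \<Longrightarrow> good t d (F * G)"
  by (rule unit_series_mult[OF graded_groups_bnd])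

text \<open>Modulo terms gaining \<open>\<epsilon>\<close>, multiplication of series is addition of
  coefficients, because all mixed terms fall under \<open>bnd_add\<close>.\<close>

lemma good_mult_cong:
  assumes d: "profile \<epsilon> d" and F: "good t d F" "good t d G" and l: "l \<ge> 1"
  shows "vge ((F * G) $ l - F $ l - G $ l) (bnd t d l + \<epsilon>)"
proof -
  have "vge (F $ i * G $ (l - i)) (bnd t d l + \<epsilon>)" if "i \<in> {1..<l}" for i
  proof -
    have "vge (F $ i * G $ (l - i)) (bnd t d i + bnd t d (l - i))"
      using F that by (intro vge_mult) (auto simp: unit_series_def)
    moreover have "bnd t d (i + (l - i)) + \<epsilon> \<le> bnd t d i + bnd t d (l - i)"
      using that by (intro bnd_add[OF d]) auto
    ultimately show ?thesis using that by (auto intro: vge_mono)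
  qed
  then have "vge (\<Sum>i\<in>{1..<l}. F $ i * G $ (l - i)) (bnd t d l + \<epsilon>)" by (rule vge_sum)
  then show ?thesis using fps_mult_nth_units[of F G l] F l by (simp add: unit_series_def)
qed

text \<open>Of the \<open>i\<close> available copies of \<open>D\<close> one is kept, one yields
  \<open>\<epsilon>\<close>, and the rest are dropped. \<open>x\<close> may be negative and is
  therefore carried exactly.\<close>

lemma vge_power:
  assumes c: "vge c (ereal x + D)" and D: "0 \<le> \<epsilon>" "\<epsilon> \<le> D" and i: "i \<ge> 2"
  shows "vge (c ^ i) (ereal (real i * x) + D + \<epsilon>)"
  using i
proof (induction i rule: dec_induct)
  case base
  have "vge (c * c) ((ereal x + D) + (ereal x + D))" by (rule vge_mult[OF c c])
  moreover have "ereal (real 2 * x) + D + \<epsilon> \<le> (ereal x + D) + (ereal x + D)"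
  proof -
    have "(ereal x + ereal x + D) + \<epsilon> \<le> (ereal x + ereal x + D) + D"
      using D by (intro add_left_mono)
    then show ?thesis by (simp add: add_ac)
  qed
  ultimately show ?case by (simp add: power2_eq_square vge_mono)
next
  case (step i)
  have "vge (c * c ^ i) ((ereal x + D) + (ereal (real i * x) + D + \<epsilon>))"
    by (rule vge_mult[OF c step.IH])
  moreover have "ereal (real (Suc i) * x) + D + \<epsilon> \<le> (ereal x + D) + (ereal (real i * x) + D + \<epsilon>)"
  proof -
    have "0 \<le> D" using D by simp
    then have "(ereal x + ereal (real i * x) + D + \<epsilon>) + 0 \<le> (ereal x + ereal (real i * x) + D + \<epsilon>) + D"
      by (intro add_left_mono)
    then show ?thesis by (simp add: add_ac algebra_simps)
  qed
  ultimately show ?case by (simp add: vge_mono)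
qed

text \<open>If \<open>l\<close> does not divide \<open>h\<close>, the image involves only
  \<open>c ^ l\<close>, which gains \<open>\<epsilon>\<close>. If \<open>h = l q\<close>, the image
  is \<open>(1 - c X ^ q) ^ l\<close>: the term \<open>i = 1\<close> is exactly \<open>l\<close>
  times the old coefficient, the terms \<open>1 < i < l\<close> have a binomial coefficient
  divisible by \<open>l\<close>, whose valuation pays for passing from \<open>tv h\<close> to
  \<open>tv q\<close>, and \<open>i = l\<close> is again \<open>c ^ l\<close>.\<close>

lemma witt_frob_one_minus_cong:
  assumes l: "prime l" and om: "splits_by_powers \<omega> l" and d: "profile \<epsilon> d"
    and h: "h \<ge> 1" and c: "vge c (bnd t d h)" and k: "k \<ge> 1"
  shows "vge (witt_frob l \<omega> (one_minus c h) $ k - of_nat l * one_minus c h $ (l * k))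
    (bnd (t * int l) d k + \<epsilon>)"
proof -
  have l2: "l \<ge> 2" using l prime_ge_2_nat by blast
  have e: "0 \<le> \<epsilon>" "\<epsilon> \<le> d (tv h)" using d by (auto simp: profile_def)
  have pow: "vge (c ^ i) (ereal (real i * (of_int t * real h)) + d (tv h) + \<epsilon>)" if "i \<ge> 2" for i
    using vge_power[OF c[unfolded bnd_def] e that] .
  have pow_l: "vge (c ^ l) (bnd (t * int l) d h + \<epsilon>)"
    using pow[OF l2] by (simp add: bnd_def mult_ac)
  show ?thesis
  proof (cases "l dvd h")
    case False
    then have "l * k \<noteq> h" by auto
    then show ?thesis using k l2 h False pow_l
      by (auto simp: witt_frob_one_minus[OF l om h] one_minus_nth intro: vge_uminus)
  next
    case True
    then obtain q where q: "h = l * q" by blast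
    then have q1: "q \<ge> 1" using h by (cases q) auto
    have wf: "witt_frob l \<omega> (one_minus c h) $ k =
        (if q dvd k then of_nat (l choose (k div q)) * (- c) ^ (k div q) else 0)"
      using witt_frob_one_minus[OF l om h, of c] q l2 q1 by (simp add: one_minus_power_nth)
    show ?thesis
    proof (cases "q dvd k")
      case False
      then have "l * k \<noteq> h" using q l2 by auto
      then show ?thesis using False wf h k l2 by (simp add: one_minus_nth)
    next
      case True
      then obtain i where i: "k = q * i" by blast
      then have i1: "i \<ge> 1" using k by (cases i) auto
      have wfi: "witt_frob l \<omega> (one_minus c h) $ k = of_nat (l choose i) * (- c) ^ i"
        using wf True i q1 by simp
      show ?thesis
      proof (cases "i = 1")
        case True
        then show ?thesis using wfi i q h l2 by (simp add: one_minus_nth)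
      next
        case False
        then have i2: "i \<ge> 2" using i1 by auto
        have ne: "one_minus c h $ (l * k) = 0" using i q False h k l2 q1 by (simp add: one_minus_nth)
        have neg: "(- c) ^ i = c ^ i \<or> (- c) ^ i = - (c ^ i)" by (cases "even i") auto
        have "vge (of_nat (l choose i) * c ^ i) (bnd (t * int l) d k + \<epsilon>)"
        proof -
          consider "i > l" | "i = l" | "i < l" by linarith
          then show ?thesis
          proof cases
            case 1
            then show ?thesis by (simp add: binomial_eq_0)
          next
            case 2
            then show ?thesis using pow_l i q by (simp add: mult.commute)
          next
            case 3
            then have "l dvd l choose i" using l i1 by (intro dvd_choose_prime) auto
            then obtain z where z: "l choose i = l * z" by blast
            have "vge (of_nat l * (of_nat z * c ^ i))
                (w (of_nat l) + (ereal (real i * (of_int t * real h)) + d (tv h) + \<epsilon>))"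
              by (intro vge_mult vge_of_nat vge_of_nat_mult pow i2)
            moreover have "bnd (t * int l) d k + \<epsilon> \<le>
                w (of_nat l) + (ereal (real i * (of_int t * real h)) + d (tv h) + \<epsilon>)"
            proof -
              have "d (tv k) \<le> d (tv q)"
                using i k q1 by (intro profile_mono[OF d] tv_dvd) auto
              also have "\<dots> \<le> w (of_nat l) + d (tv h)"
                unfolding q by (rule profile_prime_mult[OF d l q1])
              finally have "ereal (real i * (of_int t * real h)) + d (tv k) + \<epsilon> \<le>
                  ereal (real i * (of_int t * real h)) + (w (of_nat l) + d (tv h)) + \<epsilon>"
                by (intro add_right_mono add_left_mono)
              moreover have eq: "of_int (t * int l) * real k = real i * (of_int t * real h)"
                using i q by simp
              ultimately show ?thesis unfolding bnd_def eq by (simp only: add_ac)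
            qed
            ultimately show ?thesis by (auto simp: z mult.assoc intro: vge_mono)
          qed
        qed
        then show ?thesis using wfi ne neg vge_uminus by auto
      qed
    qed
  qed
qed

section \<open>Frobenius operators of arbitrary degree\<close>

definition frob_cong :: "ereal \<Rightarrow> (nat \<Rightarrow> ereal) \<Rightarrow> int \<Rightarrow> nat \<Rightarrow> 's fps \<Rightarrow> 's fps \<Rightarrow> bool" where
  "frob_cong \<epsilon> d t s F F' \<longleftrightarrow>
    (\<forall>k\<ge>1. vge (F' $ k - of_nat s * F $ (s * k)) (bnd (t * int s) d k + \<epsilon>))"

lemma frob_cong_good:
  assumes d: "profile \<epsilon> d" and F: "good t d F" "F' $ 0 = 1" and c: "frob_cong \<epsilon> d t s F F'"
    and s: "s \<ge> 1"
  shows "good (t * int s) d F'"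
proof -
  have "vge (F' $ k) (bnd (t * int s) d k)" if k: "k \<ge> 1" for k
  proof -
    have "vge (F' $ k - of_nat s * F $ (s * k)) (bnd (t * int s) d k)"
      using c k le_add_eps[OF d] vge_mono unfolding frob_cong_def by blast
    moreover have "vge (of_nat s * F $ (s * k)) (w (of_nat s) + bnd t d (s * k))"
      using F k s by (intro vge_mult vge_of_nat) (auto simp: unit_series_def)
    then have "vge (of_nat s * F $ (s * k)) (bnd (t * int s) d k)"
      using bnd_mult[OF d s k] vge_mono by blast
    ultimately show ?thesis using vge_add by fastforce
  qed
  then show ?thesis using F by (simp add: unit_series_def)
qed

text \<open>On both sides a product is a sum of coefficients up to admissible errors, and the
  congruence itself is additive.\<close>

lemma frob_cong_mult:
  assumes d: "profile \<epsilon> d" and s: "s \<ge> 1"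
    and F: "good t d F" "F' $ 0 = 1" "frob_cong \<epsilon> d t s F F'"
    and G: "good t d G" "G' $ 0 = 1" "frob_cong \<epsilon> d t s G G'"
  shows "frob_cong \<epsilon> d t s (F * G) (F' * G')"
  unfolding frob_cong_def
proof (intro allI impI)
  fix k :: nat assume k: "1 \<le> k"
  let ?b = "bnd (t * int s) d k + \<epsilon>"
  have gF: "good (t * int s) d F'" "good (t * int s) d G'"
    using frob_cong_good[OF d] F G s by blast+
  have 1: "vge ((F' * G') $ k - F' $ k - G' $ k) ?b" by (rule good_mult_cong[OF d gF k])
  have sk: "s * k \<ge> 1" using s k by (simp add: Suc_le_eq)
  have "vge (of_nat s * ((F * G) $ (s * k) - F $ (s * k) - G $ (s * k)))
      (w (of_nat s) + (bnd t d (s * k) + \<epsilon>))"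
    using F G by (intro vge_mult vge_of_nat good_mult_cong[OF d _ _ sk]) auto
  moreover have "?b \<le> w (of_nat s) + (bnd t d (s * k) + \<epsilon>)"
    using add_right_mono[OF bnd_mult[OF d s k, of t], of \<epsilon>] by (simp add: add_ac)
  ultimately have 2: "vge (of_nat s * ((F * G) $ (s * k) - F $ (s * k) - G $ (s * k))) ?b"
    using vge_mono by blast
  have 3: "vge (F' $ k - of_nat s * F $ (s * k)) ?b" "vge (G' $ k - of_nat s * G $ (s * k)) ?b"
    using F G k by (auto simp: frob_cong_def)
  have "(F' * G') $ k - of_nat s * (F * G) $ (s * k) =
      ((F' * G') $ k - F' $ k - G' $ k) - of_nat s * ((F * G) $ (s * k) - F $ (s * k) - G $ (s * k))
      + ((F' $ k - of_nat s * F $ (s * k)) + (G' $ k - of_nat s * G $ (s * k)))"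
    by (simp add: algebra_simps)
  then show "vge ((F' * G') $ k - of_nat s * (F * G) $ (s * k)) ?b"
    using vge_add[OF vge_diff[OF 1 2] vge_add[OF 3]] by (simp only:)
qed

lemma witt_frob_cong:
  assumes l: "prime l" and om: "splits_by_powers \<omega> l" and d: "profile \<epsilon> d" and F: "good t d F"
  shows "frob_cong \<epsilon> d t l F (witt_frob l \<omega> F)"
  unfolding frob_cong_def
proof (intro allI impI)
  fix k :: nat assume k: "1 \<le> k"
  have l1: "l \<ge> 1" using l prime_ge_1_nat by blast
  let ?G = "\<lambda>l. {y. vge y (bnd t d l)}"
  have "\<exists>Q. frob_cong \<epsilon> d t l Q (witt_frob l \<omega> Q) \<and> good t d Q \<and> fps_agree (l * k) F Q"
  proof (rule unit_series_approx[where S = ?G])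
    show "graded_groups ?G" by (rule graded_groups_bnd[OF d])
    show "\<exists>cs. set cs \<subseteq> ?G h \<and> x = sum_list cs" if "x \<in> ?G h" for h x
      using that by (intro exI[of _ "[x]"]) simp
    have "witt_frob l \<omega> 1 = witt_frob l \<omega> (one_minus 0 1)" by (simp add: one_minus_def)
    also have "\<dots> = 1"
      using witt_frob_one_minus[OF l om, of 1 0] prime_gt_1_nat[OF l] l1 by (simp add: one_minus_def)
    finally show "frob_cong \<epsilon> d t l 1 (witt_frob l \<omega> 1)"
      using l1 by (simp add: frob_cong_def)
    show "frob_cong \<epsilon> d t l (A * B) (witt_frob l \<omega> (A * B))"
      if "good t d A" "good t d B" "frob_cong \<epsilon> d t l A (witt_frob l \<omega> A)"
        "frob_cong \<epsilon> d t l B (witt_frob l \<omega> B)" for A B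
    proof -
      have "A $ 0 = 1" "B $ 0 = 1" using that by (auto simp: unit_series_def)
      then show ?thesis
        using that frob_cong_mult[OF d l1] witt_frob_mult[OF l om] witt_frob_nth_0 by metis
    qed
    show "frob_cong \<epsilon> d t l (one_minus c h) (witt_frob l \<omega> (one_minus c h))"
      if "h \<ge> 1" "c \<in> ?G h" for c h
      using that witt_frob_one_minus_cong[OF l om d] by (simp add: frob_cong_def)
  qed (use F in auto)
  then obtain Q where Q: "frob_cong \<epsilon> d t l Q (witt_frob l \<omega> Q)" "fps_agree (l * k) F Q" by blast
  then have "witt_frob l \<omega> F $ k = witt_frob l \<omega> Q $ k" "F $ (l * k) = Q $ (l * k)"
    using witt_frob_agree by (auto simp: fps_agree_def)
  then show "vge (witt_frob l \<omega> F $ k - of_nat l * F $ (l * k)) (bnd (t * int l) d k + \<epsilon>)"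
    using Q k by (simp add: frob_cong_def)
qed

text \<open>Records what is used of the Frobenius, so that its construction from roots of unity can
  be forgotten. The formula on binomials is the Witt vector identity F_s V_h = g V_(h/g) F_(s/g)
  with g = gcd(h, s), addition being multiplication of series.\<close>

definition frobenius_op :: "nat \<Rightarrow> ('s fps \<Rightarrow> 's fps) \<Rightarrow> bool" where
  "frobenius_op s \<Psi> \<longleftrightarrow>
     (\<forall>F. F $ 0 = 1 \<longrightarrow> \<Psi> F $ 0 = 1) \<and>
     (\<forall>F G. F $ 0 = 1 \<longrightarrow> G $ 0 = 1 \<longrightarrow> \<Psi> (F * G) = \<Psi> F * \<Psi> G) \<and>
     (\<forall>c h. h \<ge> 1 \<longrightarrow> \<Psi> (one_minus c h) =
        one_minus (c ^ (s div gcd h s)) (h div gcd h s) ^ gcd h s) \<and>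
     (\<forall>\<epsilon> d t F. profile \<epsilon> d \<longrightarrow> good t d F \<longrightarrow> frob_cong \<epsilon> d t s F (\<Psi> F))"

lemma frobenius_op_power:
  assumes "frobenius_op s \<Psi>" "F $ 0 = 1" "m \<ge> 1"
  shows "\<Psi> (F ^ m) = \<Psi> F ^ m"
  using assms(3)
proof (induction m rule: dec_induct)
  case (step m)
  have "(F ^ m) $ 0 = 1" using assms(2) by (simp add: fps_nth_power_0)
  then show ?case using step assms by (simp add: frobenius_op_def)
qed simp

lemma frobenius_op_prime:
  assumes l: "prime l" and om: "splits_by_powers \<omega> l"
  shows "frobenius_op l (witt_frob l \<omega>)"
  unfolding frobenius_op_def
proof (intro conjI allI impI)
  fix c :: 's and h :: nat assume h: "1 \<le> h"
  have "gcd h l = (if l dvd h then l else 1)"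
    using l prime_imp_coprime[OF l, of h] by (auto simp: gcd.commute[of h l])
  moreover have "l > 0" using l prime_gt_0_nat by blast
  ultimately show "witt_frob l \<omega> (one_minus c h) =
      one_minus (c ^ (l div gcd h l)) (h div gcd h l) ^ gcd h l"
    by (simp add: witt_frob_one_minus[OF l om h])
qed (use witt_frob_nth_0 witt_frob_mult[OF l om] witt_frob_cong[OF l om] in auto)

lemma frobenius_op_comp:
  assumes S: "frobenius_op s \<Psi>" "s \<ge> 1" and L: "frobenius_op l \<Phi>" "l \<ge> 1"
  shows "frobenius_op (l * s) (\<lambda>F. \<Phi> (\<Psi> F))"
  unfolding frobenius_op_def
proof (intro conjI allI impI)
  fix F :: "'s fps" assume "F $ 0 = 1"
  then show "\<Phi> (\<Psi> F) $ 0 = 1" using S L by (simp add: frobenius_op_def)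
next
  fix F G :: "'s fps" assume "F $ 0 = 1" "G $ 0 = 1"
  then show "\<Phi> (\<Psi> (F * G)) = \<Phi> (\<Psi> F) * \<Phi> (\<Psi> G)"
    using S L by (simp add: frobenius_op_def)
next
  fix c :: 's and h :: nat assume h: "1 \<le> h"
  define g where "g = gcd h s"
  define h' where "h' = h div g"
  define g' where "g' = gcd h' l"
  have g: "g \<ge> 1" "g dvd h" "g dvd s" using h by (auto simp: g_def Suc_le_eq)
  have h': "h' \<ge> 1" using h g by (auto simp: h'_def dvd_div_eq_0_iff Suc_le_eq intro!: gr0I)
  have g': "g' dvd l" "g' dvd h'" by (auto simp: g'_def)
  \<comment> \<open>Removing \<open>g\<close> from \<open>h\<close> and \<open>s\<close> leaves
    coprime cofactors, so the second operator meets only \<open>gcd h' l\<close>, and the two gcds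
    multiply to \<open>gcd h (l * s)\<close>.\<close>
  have "coprime h' (s div g)" unfolding h'_def g_def using h by (intro div_gcd_coprime) auto
  then have "gcd h' (l * (s div g)) = g'"
    unfolding g'_def by (simp add: gcd_mult_right_right_cancel)
  moreover have "gcd h (l * s) = g * gcd h' (l * (s div g))"
    using gcd_mult_distrib_nat[of g h' "l * (s div g)"] g by (simp add: h'_def mult.left_commute[of g l])
  ultimately have gg: "gcd h (l * s) = g * g'" by simp
  have "\<Psi> (one_minus c h) = one_minus (c ^ (s div g)) h' ^ g"
    using S h by (simp add: frobenius_op_def g_def h'_def)
  then have "\<Phi> (\<Psi> (one_minus c h)) = \<Phi> (one_minus (c ^ (s div g)) h') ^ g"
    using frobenius_op_power[OF L(1) _ g(1)] h' by simp
  also have "\<Phi> (one_minus (c ^ (s div g)) h') =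
      one_minus ((c ^ (s div g)) ^ (l div g')) (h' div g') ^ g'"
    using L h' by (simp add: frobenius_op_def g'_def)
  also have "h' div g' = h div (g * g')" by (simp add: h'_def div_mult2_eq)
  also have "(c ^ (s div g)) ^ (l div g') = c ^ (l * s div (g * g'))"
    using g g' by (simp add: power_mult[symmetric] div_mult_div_if_dvd mult.commute)
  finally show "\<Phi> (\<Psi> (one_minus c h)) =
      one_minus (c ^ (l * s div gcd h (l * s))) (h div gcd h (l * s)) ^ gcd h (l * s)"
    by (simp add: gg power_mult[symmetric] mult.commute)
next
  fix \<epsilon> d t and F :: "'s fps"
  assume d: "profile \<epsilon> d" and F: "good t d F"
  have c1: "frob_cong \<epsilon> d t s F (\<Psi> F)" using S d F by (simp add: frobenius_op_def)
  have F0: "F $ 0 = 1" "\<Psi> F $ 0 = 1" using F S by (auto simp: unit_series_def frobenius_op_def)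
  have "good (t * int s) d (\<Psi> F)" by (rule frob_cong_good[OF d F F0(2) c1 S(2)])
  then have c2: "frob_cong \<epsilon> d (t * int s) l (\<Psi> F) (\<Phi> (\<Psi> F))"
    using L d by (simp add: frobenius_op_def)
  show "frob_cong \<epsilon> d t (l * s) F (\<Phi> (\<Psi> F))"
    unfolding frob_cong_def
  proof (intro allI impI)
    fix k :: nat assume k: "1 \<le> k"
    let ?b = "bnd (t * int (l * s)) d k + \<epsilon>"
    have 1: "vge (\<Phi> (\<Psi> F) $ k - of_nat l * \<Psi> F $ (l * k)) ?b"
      using c2 k by (simp add: frob_cong_def mult_ac)
    have lk: "l * k \<ge> 1" using L k by (simp add: Suc_le_eq)
    \<comment> \<open>The error of \<open>\<Psi>\<close> at \<open>l k\<close> becomes admissible at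
      \<open>k\<close> once multiplied by \<open>l\<close>, by \<open>bnd_mult\<close>.\<close>
    have "vge (of_nat l * (\<Psi> F $ (l * k) - of_nat s * F $ (s * (l * k))))
        (w (of_nat l) + (bnd (t * int s) d (l * k) + \<epsilon>))"
      using c1 lk by (intro vge_mult vge_of_nat) (auto simp: frob_cong_def)
    moreover have "?b \<le> w (of_nat l) + (bnd (t * int s) d (l * k) + \<epsilon>)"
      using add_right_mono[OF bnd_mult[OF d L(2) k, of "t * int s"], of \<epsilon>] by (simp add: add_ac mult_ac)
    ultimately have 2: "vge (of_nat l * (\<Psi> F $ (l * k) - of_nat s * F $ (s * (l * k)))) ?b"
      using vge_mono by blast
    show "vge (\<Phi> (\<Psi> F) $ k - of_nat (l * s) * F $ (l * s * k)) ?b"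
      using vge_add[OF 1 2] by (simp add: algebra_simps)
  qed
qed

lemma exists_frobenius_op:
  assumes closed: "\<forall>f :: 's poly. separable_poly f \<and> degree f > 0 \<longrightarrow> (\<exists>x. poly f x = 0)"
    and "s \<ge> 1"
  shows "\<exists>\<Psi>. frobenius_op s \<Psi>"
  using assms(2)
proof (induction s rule: prime_divisors_induct)
  case (unit s)
  have "frobenius_op 1 (\<lambda>F. F)"
    by (auto simp: frobenius_op_def frob_cong_def)
  then show ?case using unit by auto
next
  case (factor l s)
  then have s: "s \<ge> 1" and l: "l \<ge> 1" by (auto simp: prime_ge_1_nat)
  obtain \<Psi> where "frobenius_op s \<Psi>" using factor s by blast
  moreover obtain \<omega> :: 's where "splits_by_powers \<omega> l"
    using exists_splits_by_powers[OF closed] factor by blast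
  ultimately show ?case
    using frobenius_op_comp[OF _ s frobenius_op_prime l] factor by blast
qed simp

lemma w_eq_of_less:
  assumes "w x < w y"
  shows "w (x + y) = w x"
proof (rule antisym)
  have "min (w (x + y)) (w (- y)) \<le> w (x + y + - y)" by (rule w_add)
  then show "w (x + y) \<le> w x" using assms by (auto simp: min_def split: if_splits)
  show "w x \<le> w (x + y)" using w_add[of x y] assms by (simp add: min_def less_imp_le)
qed

lemma vge_perturb:
  assumes "w x = ereal b" "vge y (ereal b + 1)"
  shows "\<exists>z. \<tau> x + y = \<tau> z \<and> w z = ereal b"
proof -
  obtain x' where x': "y = \<tau> x'" "ereal b + 1 \<le> w x'" using assms(2) by (auto simp: vge_def)
  have "w x < ereal b + 1" by (simp add: one_ereal_def assms(1))
  then have "w x < w x'" using x'(2) by (rule less_le_trans)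
  then show ?thesis using w_eq_of_less x'(1) assms(1) by (metis tau.hom_add)
qed

text \<open>The cofactor \<open>m'\<close> prime to \<open>p\<close> has valuation 0: otherwise a
  Bezout relation \<open>m' x = p y + 1\<close> would give 1 positive valuation.\<close>

lemma w_of_nat:
  assumes "m \<ge> 1"
  shows "w (of_nat m) = ereal (real (multiplicity p m)) * w (of_nat p)"
proof -
  have "\<not> is_unit p" "m \<noteq> 0" using prime_p assms by auto
  then obtain m' where m': "m = p ^ multiplicity p m * m'" "\<not> p dvd m'"
    by (metis multiplicity_decompose')
  have "w (of_nat m') = 0"
  proof (rule ccontr)
    assume "w (of_nat m') \<noteq> 0"
    then have pos: "w (of_nat m') > 0" using w_of_nat_nonneg[of m'] by (simp add: less_le)
    have "coprime m' p" using m' prime_p prime_imp_coprime coprime_commute by blast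
    moreover have "m' \<noteq> 0" using m'(2) by (metis dvd_0_right)
    ultimately obtain x y where xy: "m' * x = p * y + 1"
      by (metis bezout_nat coprime_imp_gcd_eq_1)
    have "of_nat (m' * x) + - of_nat (p * y) = (1::'k)" by (simp only: xy) simp
    then have "min (w (of_nat (m' * x))) (w (- of_nat (p * y))) \<le> w 1"
      using w_add[of "of_nat (m' * x)" "- of_nat (p * y)"] by (simp only:)
    moreover have "w (of_nat (m' * x)) > 0" "w (- of_nat (p * y)) > 0"
      using pos w_p w_of_nat_nonneg[of x] w_of_nat_nonneg[of y]
      by (simp_all add: w_mult add_pos_nonneg)
    ultimately show False by (simp add: min_def split: if_splits)
  qed
  then have "w (of_nat (p ^ multiplicity p m * m')) = ereal (real (multiplicity p m)) * w (of_nat p)"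
    by (simp add: w_mult w_power)
  then show ?thesis using m'(1) by simp
qed

end

text \<open>\<open>a h\<close> is the coefficient of \<open>X\<^sup>h\<close> in \<open>\<Prod>(1 - \<sigma>(\<pi>) X)\<close>, that is \<open>(-1)\<^sup>h c\<^sub>h\<close>.\<close>

locale eisenstein_series = valued_embedding \<tau> w p \<nu>
  for \<tau> :: "'k::field \<Rightarrow> 's::field" and w p \<nu> +
  fixes n u :: nat and a :: "nat \<Rightarrow> 'k"
  assumes n_eq: "n = u * p ^ \<nu>" and u: "\<not> p dvd u"
    and a_0: "a 0 = 1" and a_gt: "\<And>h. h > n \<Longrightarrow> a h = 0"
    and a_n: "w (a n) = ereal (real n)"
    and a_less: "\<And>h. 1 \<le> h \<Longrightarrow> h < n \<Longrightarrow> ereal (real h) < w (a h)"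
    and w_discrete: "\<And>x. x \<noteq> 0 \<Longrightarrow> \<exists>z::int. w x = ereal (real n * of_int z)"
begin

lemma n_ge_1: "n \<ge> 1"
  using n_eq u prime_p prime_gt_0_nat[of p] by (cases "u = 0") (auto simp: Suc_le_eq)

lemma p_power_dvd_n: "i \<le> \<nu> \<Longrightarrow> p ^ i dvd n"
  by (simp add: n_eq le_imp_power_dvd dvd_mult)

lemma multiplicity_n: "multiplicity p n = \<nu>"
proof -
  have "u \<noteq> 0" using u by (metis dvd_0_right)
  then have "multiplicity p n = multiplicity p u + multiplicity p (p ^ \<nu>)"
    unfolding n_eq using prime_p by (intro prime_elem_multiplicity_mult_distrib) auto
  then show ?thesis using u prime_p by (simp add: not_dvd_imp_multiplicity_0)
qed

lemma tv_n: "tv n = \<nu>"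
  by (simp add: tv_def multiplicity_n)

text \<open>The contribution of \<open>c\<^sub>h\<close> to \<open>i\<^sub>j\<close>: among the \<open>j' \<ge> j\<close> that admit \<open>h\<close>, the smallest one,
  \<open>max j (tv h)\<close>, is the best; truncated subtraction gives \<open>max j (tv h) - j = tv h - j\<close>.\<close>

definition contrib :: "nat \<Rightarrow> nat \<Rightarrow> ereal" where
  "contrib h j = (w (a h) - ereal (real h)) + ereal (real (tv h - j)) * w (of_nat p)"

text \<open>\<open>{1..n}\<close> gives the index \<open>i_j\<close>; \<open>{n}\<close> and
  \<open>{1..<n}\<close> give the profiles of the two factors \<open>G_ser\<close> and
  \<open>H_ser\<close>. For \<open>n = 1\<close> the latter set is empty and the value is
  infinite.\<close>

definition idx :: "nat set \<Rightarrow> nat \<Rightarrow> ereal" where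
  "idx A j = (INF h\<in>A. contrib h j)"

lemma w_excess_n: "w (a n) - ereal (real n) = 0"
  by (simp add: a_n)

lemma w_excess_ge_1:
  assumes "1 \<le> h" "h < n"
  shows "1 \<le> w (a h) - ereal (real h)"
proof (cases "a h = 0")
  case False
  then obtain z where z: "w (a h) = ereal (real n * of_int z)" using w_discrete by blast
  then have "real_of_int (int h) < real_of_int (int n * z)" using a_less[OF assms] by simp
  then have "int h + 1 \<le> int n * z" by linarith
  then have "real_of_int (int h + 1) \<le> real_of_int (int n * z)" by linarith
  then show ?thesis using z by (simp add: one_ereal_def)
qed simp

lemma e_term_nonneg: "0 \<le> ereal (real m) * w (of_nat p)"
  using w_p by (simp add: less_imp_le)

lemma contrib_ge_excess: "w (a h) - ereal (real h) \<le> contrib h j"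
  unfolding contrib_def using add_left_mono[OF e_term_nonneg] by (metis add.right_neutral)

lemma contrib_nonneg:
  assumes "1 \<le> h" "h \<le> n"
  shows "0 \<le> contrib h j"
proof (cases "h = n")
  case True
  then show ?thesis using contrib_ge_excess[of n j] w_excess_n by simp
next
  case False
  then have "1 \<le> contrib h j"
    using contrib_ge_excess[of h j] w_excess_ge_1[of h] assms order_trans by auto
  then show ?thesis by (rule order_trans[rotated]) simp
qed

lemma contrib_ge_1: "1 \<le> h \<Longrightarrow> h < n \<Longrightarrow> 1 \<le> contrib h j"
  using contrib_ge_excess[of h j] w_excess_ge_1[of h] order_trans by blast

lemma contrib_antimono:
  assumes "i \<le> j"
  shows "contrib h j \<le> contrib h i"
  unfolding contrib_def
  using assms w_p by (intro add_left_mono ereal_mult_right_mono) (auto simp: less_imp_le)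

lemma contrib_Suc:
  assumes "1 \<le> h" "h \<le> n"
  shows "contrib h j \<le> w (of_nat p) + contrib h (Suc j)"
proof (cases "w (of_nat p)")
  case (real e)
  have "e > 0" using real w_p by simp
  then have "real (tv h - j) * e \<le> e + real (tv h - Suc j) * e"
    by (cases "j < tv h") (auto simp: algebra_simps of_nat_diff)
  then have "ereal (real (tv h - j) * e) \<le> ereal e + ereal (real (tv h - Suc j) * e)" by simp
  then have "(w (a h) - ereal (real h)) + ereal (real (tv h - j) * e) \<le>
      (w (a h) - ereal (real h)) + (ereal e + ereal (real (tv h - Suc j) * e))"
    by (rule add_left_mono)
  then show ?thesis using real
    by (simp only: contrib_def times_ereal.simps) (simp only: add_ac)
next
  \<comment> \<open>Characteristic \<open>p\<close>: the right side is infinite because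
    \<open>contrib\<close> is never negative.\<close>
  case PInf
  then show ?thesis using contrib_nonneg[OF assms, of "Suc j"] by auto
next
  case MInf
  then show ?thesis using w_p by simp
qed

lemma idx_le: "h \<in> A \<Longrightarrow> idx A j \<le> contrib h j"
  unfolding idx_def by (rule INF_lower)

lemma idx_attained:
  assumes "finite A" "A \<noteq> {}"
  obtains h where "h \<in> A" "idx A j = contrib h j"
proof -
  have "Min ((\<lambda>h. contrib h j) ` A) \<in> (\<lambda>h. contrib h j) ` A" using assms by (intro Min_in) auto
  moreover have "idx A j = Min ((\<lambda>h. contrib h j) ` A)"
    unfolding idx_def using assms by (intro Min_Inf[symmetric]) auto
  ultimately show ?thesis using that by auto
qed

lemma idx_profile:
  assumes A: "A \<subseteq> {1..n}" and e: "0 \<le> \<epsilon>" "\<And>h j. h \<in> A \<Longrightarrow> \<epsilon> \<le> contrib h j"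
  shows "profile \<epsilon> (idx A)"
  unfolding profile_def
proof (intro conjI allI impI)
  fix j show "\<epsilon> \<le> idx A j" unfolding idx_def using e by (intro INF_greatest)
next
  fix i j :: nat assume "i \<le> j"
  then show "idx A j \<le> idx A i"
    unfolding idx_def by (intro INF_mono) (auto intro: contrib_antimono)
next
  fix j
  show "idx A j \<le> w (of_nat p) + idx A (Suc j)"
  proof (cases "A = {}")
    case True
    then show ?thesis using w_p by (auto simp: idx_def top_ereal_def)
  next
    case False
    then obtain h where h: "h \<in> A" "idx A (Suc j) = contrib h (Suc j)"
      using idx_attained finite_subset[OF A] by blast
    have "idx A j \<le> contrib h j" by (rule idx_le[OF h(1)])
    also have "\<dots> \<le> w (of_nat p) + contrib h (Suc j)" using h A by (intro contrib_Suc) auto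
    finally show ?thesis by (simp add: h(2))
  qed
qed (use e in auto)

lemma profile_full: "profile 0 (idx {1..n})"
  by (rule idx_profile) (auto intro: contrib_nonneg)

lemma profile_n: "profile 0 (idx {n})"
  using n_ge_1 by (intro idx_profile) (auto intro: contrib_nonneg)

lemma profile_less: "profile 1 (idx {1..<n})"
  by (rule idx_profile) (auto intro: contrib_ge_1)

lemma bnd_idx_le: "h \<in> A \<Longrightarrow> bnd 1 (idx A) h \<le> w (a h)"
proof -
  assume "h \<in> A"
  then have "idx A (tv h) \<le> w (a h) - ereal (real h)"
    using idx_le[of h A "tv h"] by (simp add: contrib_def zero_ereal_def[symmetric])
  then have "ereal (real h) + idx A (tv h) \<le> ereal (real h) + (w (a h) - ereal (real h))"
    by (rule add_left_mono)
  also have "\<dots> = w (a h)" by (cases "w (a h)") auto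
  finally show ?thesis by (simp add: bnd_def)
qed

text \<open>\<open>H = F / G\<close>, where \<open>G = 1 + a\<^sub>n X\<^sup>n\<close> splits off the only coefficient with \<open>w (a h) = h\<close>, so that
  \<open>\<epsilon> = 1\<close> is admissible for \<open>H\<close>.\<close>

definition F_ser :: "'s fps" where
  "F_ser = Abs_fps (\<lambda>h. \<tau> (a h))"

definition G_ser :: "'s fps" where
  "G_ser = one_minus (\<tau> (- a n)) n"

definition H_ser :: "'s fps" where
  "H_ser = Abs_fps (\<lambda>l. if l = 0 then 1 else if n dvd l then 0
     else \<tau> (a (l mod n) * (- a n) ^ (l div n)))"

lemma F_ser_good: "good 1 (idx {1..n}) F_ser"
proof -
  have "vge (\<tau> (a h)) (bnd 1 (idx {1..n}) h)" if "h \<ge> 1" for h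
    using that a_gt[of h] bnd_idx_le[of h "{1..n}"] by (cases "h \<le> n") (auto simp: vge_hom_iff)
  then show ?thesis by (simp add: unit_series_def F_ser_def a_0)
qed

lemma G_ser_good: "good 1 (idx {n}) G_ser"
  unfolding G_ser_def
  by (rule unit_series_one_minus[OF graded_groups_bnd[OF profile_n] n_ge_1])
    (use bnd_idx_le[of n "{n}"] in \<open>simp add: vge_hom_iff\<close>)

text \<open>All \<open>p ^ i\<close> with \<open>i \<le> \<nu>\<close> divide \<open>n\<close>, so
  truncation at \<open>\<nu>\<close> is what makes \<open>tv\<close> see only the residue modulo
  \<open>n\<close>.\<close>

lemma tv_mod:
  assumes "\<not> n dvd l"
  shows "tv (l mod n) = tv l"
proof -
  have 1: "l mod n \<ge> 1" "l \<ge> 1" using assms by (auto simp: Suc_le_eq mod_greater_zero_iff_not_dvd intro: gr0I)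
  have "i \<le> tv (l mod n) \<longleftrightarrow> i \<le> tv l" for i
    using tv_ge_iff[OF 1(1)] tv_ge_iff[OF 1(2)] p_power_dvd_n[of i] by (metis dvd_mod_iff)
  then show ?thesis by (metis order_refl antisym)
qed

lemma H_ser_good: "good 1 (idx {1..<n}) H_ser"
proof -
  have "vge (\<tau> (a (l mod n) * (- a n) ^ (l div n))) (bnd 1 (idx {1..<n}) l)" if l: "\<not> n dvd l" for l
  proof -
    define h where "h = l mod n"
    have h: "h \<in> {1..<n}"
      using l n_ge_1 by (auto simp: h_def Suc_le_eq mod_greater_zero_iff_not_dvd)
    have "bnd 1 (idx {1..<n}) l = ereal (real (l div n) * real n) + bnd 1 (idx {1..<n}) h"
    proof -
      have "real l = real (l div n * n + l mod n)" by (simp only: div_mult_mod_eq)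
      then have "ereal (real l) = ereal (real (l div n) * real n) + ereal (real h)"
        by (simp only: h_def of_nat_add of_nat_mult plus_ereal.simps)
      then show ?thesis using tv_mod[OF l] by (simp only: bnd_def h_def of_int_1 mult_1 add.assoc)
    qed
    also have "\<dots> \<le> ereal (real (l div n) * real n) + w (a h)"
      by (intro add_left_mono bnd_idx_le h)
    also have "\<dots> = w (a h * (- a n) ^ (l div n))"
      by (simp add: w_mult w_power a_n add.commute)
    finally show ?thesis by (simp add: vge_hom_iff h_def)
  qed
  then show ?thesis by (auto simp: unit_series_def H_ser_def)
qed

text \<open>Dividing by \<open>1 + a n X ^ n\<close> turns the part \<open>1 + a n X ^ n\<close> of
  \<open>F_ser\<close> into 1, which is why \<open>H_ser\<close> vanishes at positive multiples of
  \<open>n\<close>, and each \<open>a h X ^ h\<close> with \<open>0 < h < n\<close> into a geometric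
  series.\<close>

lemma F_ser_eq: "F_ser = G_ser * H_ser"
proof (rule fps_ext)
  fix l
  let ?c = "\<tau> (- a n)"
  have GH: "(G_ser * H_ser) $ l = H_ser $ l - (if n \<le> l then ?c * H_ser $ (l - n) else 0)"
    by (simp add: G_ser_def one_minus_mult_nth)
  consider "l = 0" | "0 < l" "l < n" | "l = n" | "l > n" by linarith
  then show "F_ser $ l = (G_ser * H_ser) $ l"
  proof cases
    case 1
    then show ?thesis using n_ge_1 by (subst GH) (simp add: F_ser_def H_ser_def a_0)
  next
    case 2
    then have "\<not> n dvd l" by (auto dest: dvd_imp_le)
    then show ?thesis using 2 by (subst GH) (simp add: F_ser_def H_ser_def)
  next
    case 3
    then show ?thesis using n_ge_1
      by (subst GH) (simp add: F_ser_def H_ser_def tau.hom_uminus)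
  next
    case 4
    then have *: "n dvd l - n \<longleftrightarrow> n dvd l" by (metis dvd_minus_self less_imp_not_less)
    have "l div n = Suc ((l - n) div n)" "l mod n = (l - n) mod n"
      using 4 n_ge_1 by (auto simp: div_if[of l n] mod_if[of l n])
    then have "H_ser $ l = ?c * H_ser $ (l - n)"
      using 4 * by (simp add: H_ser_def tau.hom_mult[symmetric] mult_ac)
    then show ?thesis using 4 by (subst GH) (simp add: F_ser_def a_gt)
  qed
qed

lemma contrib_integral:
  assumes "contrib h j = ereal y"
  shows "\<exists>z::int. y = real_of_int (int n * z - int h)"
proof -
  have "a h \<noteq> 0" using assms w_p by (auto simp: contrib_def)
  then obtain z where z: "w (a h) = ereal (real n * of_int z)" using w_discrete by blast
  show ?thesis
  proof (cases "tv h \<le> j")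
    case True
    then have "y = real n * of_int z - real h" using assms z
      by (simp add: contrib_def zero_ereal_def[symmetric])
    then show ?thesis by (intro exI[of _ z]) simp
  next
    case False
    have "w (of_nat p) \<noteq> \<infinity>" using assms z False by (auto simp: contrib_def)
    then have "of_nat p \<noteq> (0::'k)" by auto
    then obtain z' where z': "w (of_nat p) = ereal (real n * of_int z')" using w_discrete by blast
    have "y = real n * of_int z - real h + real (tv h - j) * (real n * of_int z')"
      using assms z z' by (simp add: contrib_def)
    then show ?thesis by (intro exI[of _ "z + int (tv h - j) * z'"]) (simp add: algebra_simps)
  qed
qed

text \<open>Values of \<open>w\<close> lie in \<open>n \<int>\<close>, so a finite \<open>contrib h j\<close> is congruent to \<open>- h\<close> modulo \<open>n\<close>.\<close>

lemma unique_contrib: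
  assumes j: "idx {1..n} j = ereal (of_int N)"
  obtains h0 where "h0 \<in> {1..n}" "contrib h0 j = ereal (of_int N)" "int n dvd N + int h0"
    "\<And>h. h \<in> {1..n} \<Longrightarrow> h \<noteq> h0 \<Longrightarrow> ereal (of_int N) + 1 \<le> contrib h j"
proof -
  have "{1..n} \<noteq> {}" using n_ge_1 by simp
  then obtain h0 where h0: "h0 \<in> {1..n}" "contrib h0 j = ereal (of_int N)"
    using idx_attained[of "{1..n}" j] j by (metis finite_atLeastAtMost)
  obtain z0 where "real_of_int N = real_of_int (int n * z0 - int h0)"
    using contrib_integral[OF h0(2)] by blast
  then have z0: "N = int n * z0 - int h0" by linarith
  show ?thesis
  proof (rule that[OF h0])
    show "int n dvd N + int h0" by (simp add: z0)
    fix h assume h: "h \<in> {1..n}" "h \<noteq> h0"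
    have le: "ereal (of_int N) \<le> contrib h j" using idx_le[OF h(1)] j by metis
    show "ereal (of_int N) + 1 \<le> contrib h j"
    proof (cases "contrib h j")
      case (real y)
      then obtain z where z: "y = real_of_int (int n * z - int h)"
        using contrib_integral by blast
      have "int n * z - int h \<noteq> N"
      proof
        assume "int n * z - int h = N"
        then have "int n * (z - z0) = int h - int h0" using z0 by (simp add: algebra_simps)
        then have "int n dvd int h - int h0" by (metis dvd_triv_left)
        moreover have "\<bar>int h - int h0\<bar> < int n" using h h0 by auto
        ultimately have "int h - int h0 = 0" by (metis dvd_imp_le_int abs_of_nat not_less)
        then show False using h by simp
      qed
      moreover have "real_of_int N \<le> real_of_int (int n * z - int h)"
        using le unfolding real z by simp
      then have "N \<le> int n * z - int h" by (simp only: of_int_le_iff)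
      ultimately have "N + 1 \<le> int n * z - int h" by linarith
      then have "real_of_int (N + 1) \<le> y" unfolding z by linarith
      then show ?thesis using real by (simp add: one_ereal_def)
    qed (use le in auto)
  qed
qed

section \<open>Exact valuation of the coefficient of degree p^j\<close>

lemma tv_p_power: "j \<le> \<nu> \<Longrightarrow> tv (p ^ j) = j"
  using prime_p by (simp add: tv_def)

lemma frobenius_op_good:
  "frobenius_op s \<Psi> \<Longrightarrow> s \<ge> 1 \<Longrightarrow> profile \<epsilon> d \<Longrightarrow> good t d F \<Longrightarrow> good (t * int s) d (\<Psi> F)"
  by (rule frob_cong_good) (auto simp: frobenius_op_def unit_series_def)

lemma frobenius_G_ser_nth:
  assumes Psi: "frobenius_op s \<Psi>" and s: "s \<ge> 1"
  shows "\<Psi> G_ser $ k = (if n div gcd n s dvd k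
    then of_nat (gcd n s choose (k div (n div gcd n s))) *
      (- \<tau> ((- a n) ^ (s div gcd n s))) ^ (k div (n div gcd n s)) else 0)"
proof -
  have "n div gcd n s \<ge> 1"
    using n_ge_1 by (auto simp: Suc_le_eq div_greater_zero_iff intro: gcd_le1_nat)
  moreover have "\<Psi> G_ser = one_minus (\<tau> ((- a n) ^ (s div gcd n s))) (n div gcd n s) ^ gcd n s"
    using Psi n_ge_1 by (simp add: frobenius_op_def G_ser_def tau.hom_power)
  ultimately show ?thesis by (simp add: one_minus_power_nth)
qed

lemma frobenius_F_ser_nth:
  assumes Psi: "frobenius_op s \<Psi>" and "k \<ge> 1"
  shows "\<Psi> F_ser $ k = \<Psi> G_ser $ k + \<Psi> H_ser $ k + (\<Sum>i\<in>{1..<k}. \<Psi> G_ser $ i * \<Psi> H_ser $ (k - i))"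
proof -
  have 0: "G_ser $ 0 = 1" "H_ser $ 0 = 1"
    using G_ser_good H_ser_good by (auto simp: unit_series_def)
  then have "\<Psi> F_ser = \<Psi> G_ser * \<Psi> H_ser" "\<Psi> G_ser $ 0 = 1" "\<Psi> H_ser $ 0 = 1"
    using Psi by (auto simp: frobenius_op_def F_ser_eq)
  then show ?thesis using fps_mult_nth_units[of "\<Psi> G_ser" "\<Psi> H_ser" k] assms by simp
qed

text \<open>The decisive term is \<open>s\<close> times the coefficient of \<open>H_ser\<close> at
  \<open>s k\<close>, that is, \<open>s\<close> times \<open>a h0\<close> and a power of
  \<open>- a n\<close>, of valuation \<open>s k + contrib h0 j\<close>. \<open>\<Psi> G_ser\<close>
  lies at least 1 higher at \<open>k\<close> and vanishes strictly between 0 and \<open>k\<close>,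
  so no mixed products arise.\<close>

lemma exact_less:
  assumes Psi: "frobenius_op s \<Psi>" and s: "s \<ge> 1" and j: "j \<le> \<nu>"
    and N: "idx {1..n} j = ereal (of_int N)" and dvd: "int n dvd int (s * p ^ j) + N"
    and pN: "int p ^ j dvd N"
    and h0: "h0 \<in> {1..<n}" "contrib h0 j = ereal (of_int N)" "int n dvd N + int h0"
      "\<And>h. h \<in> {1..n} \<Longrightarrow> h \<noteq> h0 \<Longrightarrow> ereal (of_int N) + 1 \<le> contrib h j"
  shows "\<exists>x. \<Psi> F_ser $ (p ^ j) = \<tau> x \<and> w x = ereal (real (s * p ^ j) + of_int N)"
proof -
  define k where "k = p ^ j"
  have k: "k \<ge> 1" "tv k = j" using prime_p prime_gt_0_nat j by (auto simp: k_def Suc_le_eq tv_p_power)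
  let ?B = "ereal (real (s * k) + of_int N)"
  \<comment> \<open>If \<open>tv h0 = \<nu>\<close>, then
    \<open>contrib n j \<le> contrib h0 j\<close> because \<open>a n\<close> has excess 0, against
    the gap of 1 at \<open>n\<close>. Hence \<open>tv h0\<close> is an untruncated
    multiplicity.\<close>
  have tvlt: "tv h0 < \<nu>"
  proof (rule ccontr)
    assume "\<not> tv h0 < \<nu>"
    then have tv: "tv h0 = \<nu>" using tv_le[of h0] by simp
    let ?e = "ereal (real (\<nu> - j)) * w (of_nat p)"
    have "contrib n j = ?e" by (simp add: contrib_def tv_n w_excess_n)
    then have 1: "ereal (of_int N) + 1 \<le> ?e" using h0(1) h0(4)[of n] by simp
    have "0 \<le> w (a h0) - ereal (real h0)" using a_less[of h0] h0(1) w_excess_ge_1[of h0]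
      by (auto intro: order_trans[of 0 1])
    then have "?e \<le> contrib h0 j" by (simp add: contrib_def tv add_increasing)
    then have "ereal (of_int N) + 1 \<le> ereal (of_int N)" using order_trans[OF 1] h0(2) by metis
    then show False by (simp add: one_ereal_def)
  qed
  have pjh0: "p ^ j dvd h0"
  proof -
    have "int p ^ j dvd int n" using p_power_dvd_n[OF j] by (metis of_nat_dvd_iff of_nat_power)
    then have "int p ^ j dvd N + int h0" using h0(3) dvd_trans by blast
    then have "int p ^ j dvd int h0" using pN by (simp add: dvd_add_right_iff)
    then show ?thesis by (metis of_nat_dvd_iff of_nat_power)
  qed
  have sk_mod: "(s * k) mod n = h0"
  proof -
    have "int n dvd int (s * k) - int h0"
      using dvd_diff[OF dvd h0(3)] by (simp add: k_def)
    then have "[int (s * k) = int h0] (mod int n)" by (simp add: cong_iff_dvd_diff)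
    then have "[s * k = h0] (mod n)" by (simp only: cong_int_iff)
    then show ?thesis using h0(1) by (simp add: cong_def)
  qed
  have ndvd: "\<not> n dvd s * k" using sk_mod h0(1) by (auto simp: dvd_eq_mod_eq_0)
  \<comment> \<open>As \<open>s k\<close> is congruent to \<open>h0\<close> modulo \<open>n\<close>,
    the multiplicity of \<open>p\<close> in \<open>s k\<close> is \<open>tv h0\<close>; so the
    valuation of \<open>s\<close> is exactly the \<open>w p\<close> term of
    \<open>contrib h0 j\<close>.\<close>
  have mult_s: "multiplicity p s = tv h0 - j"
  proof -
    have "tv (s * k) = tv h0" using tv_mod[OF ndvd] sk_mod by simp
    then have "multiplicity p (s * k) = tv h0" using tvlt by (auto simp: tv_def min_def split: if_splits)
    moreover have "multiplicity p (s * k) = multiplicity p s + j"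
      using prime_p s unfolding k_def by (subst prime_elem_multiplicity_mult_distrib) auto
    ultimately show ?thesis by simp
  qed
  define x0 where "x0 = of_nat s * (a h0 * (- a n) ^ (s * k div n))"
  have sH: "of_nat s * H_ser $ (s * k) = \<tau> x0"
    using ndvd sk_mod by (auto simp: H_ser_def x0_def tau.hom_mult tau.hom_of_nat)
  have wx0: "w x0 = ?B"
  proof -
    have "w x0 = ereal (real (tv h0 - j)) * w (of_nat p) + (w (a h0) + ereal (real (s * k div n) * real n))"
      using w_of_nat[OF s] mult_s by (simp add: x0_def w_mult w_power a_n)
    also have "w (a h0) = (w (a h0) - ereal (real h0)) + ereal (real h0)"
      by (cases "w (a h0)") auto
    also have "ereal (real (tv h0 - j)) * w (of_nat p) + ((w (a h0) - ereal (real h0)) + ereal (real h0)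
        + ereal (real (s * k div n) * real n)) =
        contrib h0 j + ereal (real (s * k div n) * real n + real h0)"
      unfolding contrib_def plus_ereal.simps(1)[symmetric] by (simp only: add_ac)
    also have "real (s * k div n) * real n + real h0 = real (s * k div n * n + s * k mod n)"
      unfolding sk_mod by simp
    also have "\<dots> = real (s * k)" by (simp only: div_mult_mod_eq)
    finally show ?thesis by (simp add: h0(2))
  qed
  have idxl: "idx {1..<n} j = ereal (of_int N)"
  proof (rule antisym)
    show "idx {1..<n} j \<le> ereal (of_int N)" using idx_le[OF h0(1), of j] h0(2) by simp
    show "ereal (of_int N) \<le> idx {1..<n} j"
      unfolding N[symmetric] idx_def by (rule INF_superset_mono) auto
  qed
  have Hk: "vge (\<Psi> H_ser $ k - \<tau> x0) (?B + 1)"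
  proof -
    have "frob_cong 1 (idx {1..<n}) 1 s H_ser (\<Psi> H_ser)"
      using Psi profile_less H_ser_good by (simp add: frobenius_op_def)
    then have "vge (\<Psi> H_ser $ k - of_nat s * H_ser $ (s * k)) (bnd (1 * int s) (idx {1..<n}) k + 1)"
      using k(1) unfolding frob_cong_def by blast
    then show ?thesis using idxl by (simp add: sH bnd_def k(2))
  qed
  have Gk: "vge (\<Psi> G_ser $ k) (?B + 1)"
  proof -
    have "good (1 * int s) (idx {n}) (\<Psi> G_ser)"
      by (rule frobenius_op_good[OF Psi s profile_n G_ser_good])
    then have "vge (\<Psi> G_ser $ k) (ereal (real (s * k)) + contrib n j)"
      using k by (auto simp: unit_series_def bnd_def idx_def)
    moreover have "ereal (of_int N) + 1 \<le> contrib n j" using h0(1) by (intro h0(4)) auto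
    then have "ereal (real (s * k)) + (ereal (of_int N) + 1) \<le> ereal (real (s * k)) + contrib n j"
      by (rule add_left_mono)
    then have "?B + 1 \<le> ereal (real (s * k)) + contrib n j" by (simp add: one_ereal_def add.assoc)
    ultimately show ?thesis by (rule vge_mono)
  qed
  \<comment> \<open>\<open>\<Psi> G_ser\<close> is a series in \<open>X ^ ?q\<close>. The
    multiplicity of \<open>p\<close> in \<open>?g\<close> is at most that in \<open>s\<close>, hence
    at most \<open>\<nu> - j\<close>, which leaves \<open>p ^ j\<close> as a divisor of
    \<open>?q\<close>.\<close>
  have G0: "\<Psi> G_ser $ i = 0" if i: "i \<in> {1..<k}" for i
  proof -
    let ?g = "gcd n s" let ?q = "n div gcd n s"
    have "n = ?q * ?g" by simp
    moreover have "?q \<noteq> 0" "?g \<noteq> 0" using n_ge_1 \<open>n = ?q * ?g\<close> by (metis mult_0 not_one_le_zero, simp)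
    ultimately have "\<nu> = multiplicity p ?q + multiplicity p ?g"
      using multiplicity_n prime_p prime_elem_multiplicity_mult_distrib[of p ?q ?g] by simp
    moreover have "multiplicity p ?g \<le> multiplicity p s"
      using s by (intro dvd_imp_multiplicity_le) auto
    ultimately have "j \<le> multiplicity p ?q" using mult_s tvlt j tv_ge_iff[of h0 j] pjh0 h0(1) by auto
    then have "k dvd ?q" unfolding k_def by (rule multiplicity_dvd')
    then have "\<not> ?q dvd i" 
      using i dvd_trans[of k ?q i] dvd_imp_le[of k i] by auto
    then show ?thesis using frobenius_G_ser_nth[OF Psi s] by simp
  qed
  have "\<Psi> F_ser $ k = \<Psi> G_ser $ k + \<Psi> H_ser $ k"
    using frobenius_F_ser_nth[OF Psi k(1)] G0 by simp
  then have "\<Psi> F_ser $ k = \<tau> x0 + (\<Psi> G_ser $ k + (\<Psi> H_ser $ k - \<tau> x0))" by simp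
  then show ?thesis using vge_perturb[OF wx0 vge_add[OF Gk Hk]] by (simp add: k_def)
qed

text \<open>Now \<open>N\<close> is \<open>(\<nu> - j)\<close> times \<open>w p\<close>, and it
  arises from a binomial coefficient: \<open>\<Psi> G_ser\<close> is a power
  \<open>(1 - y X ^ q) ^ g\<close>, and the coefficient at \<open>k\<close> contains
  \<open>g choose (k div q)\<close>, of multiplicity \<open>\<nu> - j\<close>. All terms involving
  \<open>H_ser\<close> lie at least 1 higher.\<close>

lemma exact_n:
  assumes Psi: "frobenius_op s \<Psi>" and s: "s \<ge> 1" and j: "j \<le> \<nu>"
    and dvd: "int n dvd int (s * p ^ j) + N"
    and h0: "contrib n j = ereal (of_int N)" "int n dvd N + int n"
      "\<And>h. h \<in> {1..n} \<Longrightarrow> h \<noteq> n \<Longrightarrow> ereal (of_int N) + 1 \<le> contrib h j"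
  shows "\<exists>x. \<Psi> F_ser $ (p ^ j) = \<tau> x \<and> w x = ereal (real (s * p ^ j) + of_int N)"
proof -
  define k where "k = p ^ j"
  have k: "k \<ge> 1" "tv k = j" using prime_p prime_gt_0_nat j by (auto simp: k_def Suc_le_eq tv_p_power)
  let ?B = "ereal (real (s * k) + of_int N)"
  have N: "ereal (of_int N) = ereal (real (\<nu> - j)) * w (of_nat p)"
    using h0(1) by (simp add: contrib_def tv_n w_excess_n)
  define g where "g = gcd n s"
  define q where "q = n div g"
  have g: "g \<ge> 1" "g dvd n" "g dvd s" using n_ge_1 by (auto simp: g_def Suc_le_eq)
  have nqg: "n = q * g" using g by (simp add: q_def)
  have "n dvd s * k"
  proof -
    have "int n dvd N" using h0(2) by (simp add: dvd_add_left_iff)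
    then have "int n dvd int (s * k)" using dvd by (simp add: k_def dvd_add_left_iff)
    then show ?thesis by (simp only: of_nat_dvd_iff)
  qed
  moreover have "s * k = (s div g) * k * g" using g by simp
  ultimately have "q * g dvd (s div g) * k * g" using nqg by simp
  \<comment> \<open>\<open>q\<close> is coprime to \<open>s div g\<close>, so it divides
    \<open>k = p ^ j\<close> and is itself a power of \<open>p\<close>.\<close>
  then have "q dvd (s div g) * k" using g(1) by (auto simp: mult.commute[of _ g])
  moreover have "coprime q (s div g)"
    unfolding q_def g_def using n_ge_1 by (intro div_gcd_coprime) auto
  ultimately have "q dvd k" by (simp add: coprime_dvd_mult_right_iff)
  then obtain b where b: "b \<le> j" "q = p ^ b"
    unfolding k_def using prime_p divides_primepow_nat by blast
  have p0: "p > 0" using prime_p prime_gt_0_nat by blast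
  have kq: "k div q = p ^ (j - b)" using b p0 by (simp add: k_def power_diff)
  have geq: "g = p ^ (j - b) * (u * p ^ (\<nu> - j))"
  proof -
    have "p ^ b * g = p ^ b * (p ^ (j - b) * (u * p ^ (\<nu> - j)))"
    proof -
      have "\<nu> = b + (j - b) + (\<nu> - j)" using b j by simp
      then have "p ^ \<nu> = p ^ b * p ^ (j - b) * p ^ (\<nu> - j)" by (metis power_add)
      then have "p ^ b * (p ^ (j - b) * (u * p ^ (\<nu> - j))) = u * p ^ \<nu>" by (simp only: mult_ac)
      then show ?thesis using nqg n_eq b(2) by (simp only:)
    qed
    then show ?thesis using p0 by simp
  qed
  have u0: "u > 0" using u by (metis dvd_0_right gr0I)
  \<comment> \<open>By \<open>const_p_fac\<close>, \<open>p ^ a * m choose p ^ a\<close> has the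
    same multiplicity of \<open>p\<close> as \<open>m\<close>; here \<open>a = j - b\<close> and
    \<open>m = u p ^ (\<nu> - j)\<close>.\<close>
  have mult_binom: "multiplicity p (g choose p ^ (j - b)) = \<nu> - j"
  proof -
    have "multiplicity p (g choose p ^ (j - b)) = multiplicity p (u * p ^ (\<nu> - j))"
      unfolding geq using u0 p0 prime_p by (intro const_p_fac) auto
    also have "\<dots> = multiplicity p u + multiplicity p (p ^ (\<nu> - j))"
      using prime_p u0 p0 by (intro prime_elem_multiplicity_mult_distrib) auto
    also have "\<dots> = \<nu> - j" using u prime_p by (simp add: not_dvd_imp_multiplicity_0)
    finally show ?thesis .
  qed
  define x0 where "x0 = of_nat (g choose p ^ (j - b)) * (- ((- a n) ^ (s div g))) ^ p ^ (j - b)"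
  have Gk: "\<Psi> G_ser $ k = \<tau> x0"
    using frobenius_G_ser_nth[OF Psi s, of k] \<open>q dvd k\<close> kq
    by (simp add: g_def[symmetric] q_def[symmetric] x0_def tau.hom_mult tau.hom_power tau.hom_uminus tau.hom_of_nat)
  have wx0: "w x0 = ?B"
  proof -
    have "p ^ (j - b) \<le> g" unfolding geq using u0 p0 by simp
    then have "w (of_nat (g choose p ^ (j - b))) = ereal (of_int N)"
      using mult_binom N by (subst w_of_nat) (auto simp: Suc_le_eq)
    moreover have "p ^ (j - b) * (s div g) * n = s * k"
    proof -
      have "p ^ (j - b) * (s div g) * n = (p ^ (j - b) * q) * ((s div g) * g)"
        by (simp add: nqg mult_ac)
      also have "\<dots> = k * s" using b g by (simp add: k_def power_add[symmetric])
      finally show ?thesis by simp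
    qed
    then have "real (p ^ (j - b)) * (real (s div g) * real n) = real (s * k)"
      by (metis of_nat_mult mult.assoc)
    ultimately show ?thesis
      by (simp add: x0_def w_mult w_power a_n add.commute)
  qed
  have goodG: "good (1 * int s) (idx {n}) (\<Psi> G_ser)"
    by (rule frobenius_op_good[OF Psi s profile_n G_ser_good])
  have goodH: "good (1 * int s) (idx {1..<n}) (\<Psi> H_ser)"
    by (rule frobenius_op_good[OF Psi s profile_less H_ser_good])
  have idxl: "ereal (of_int N) + 1 \<le> idx {1..<n} j"
    unfolding idx_def using h0(3) by (intro INF_greatest) auto
  have Hk: "vge (\<Psi> H_ser $ k) (?B + 1)"
  proof -
    have "vge (\<Psi> H_ser $ k) (ereal (real (s * k)) + idx {1..<n} j)"
      using goodH k by (auto simp: unit_series_def bnd_def)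
    moreover have "ereal (real (s * k)) + (ereal (of_int N) + 1) \<le> ereal (real (s * k)) + idx {1..<n} j"
      using idxl by (rule add_left_mono)
    then have "?B + 1 \<le> ereal (real (s * k)) + idx {1..<n} j" by (simp add: one_ereal_def add.assoc)
    ultimately show ?thesis by (rule vge_mono)
  qed
  \<comment> \<open>By \<open>tv_add\<close> one of the two indices has \<open>tv\<close> at most
    \<open>j\<close>. On the side of \<open>G_ser\<close> it contributes \<open>N\<close> and the
    other factor at least 1; on the side of \<open>H_ser\<close> it alone contributes
    \<open>N + 1\<close>.\<close>
  have cross: "vge (\<Psi> G_ser $ i * \<Psi> H_ser $ (k - i)) (?B + 1)" if i: "i \<in> {1..<k}" for i
  proof -
    let ?dn = "idx {n}" and ?dl = "idx {1..<n}"
    have "vge (\<Psi> G_ser $ i * \<Psi> H_ser $ (k - i)) (bnd (1 * int s) ?dn i + bnd (1 * int s) ?dl (k - i))"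
      using goodG goodH i by (intro vge_mult) (auto simp: unit_series_def)
    moreover have "ereal (of_int N) + 1 \<le> ?dn (tv i) + ?dl (tv (k - i))"
    proof -
      have "tv i \<le> j \<or> tv (k - i) \<le> j"
        using tv_add[of i "k - i"] i k(2) by (auto simp: Suc_le_eq min_def split: if_splits)
      then show ?thesis
      proof
        assume "tv i \<le> j"
        then have "ereal (of_int N) \<le> ?dn (tv i)"
          using profile_mono[OF profile_n \<open>tv i \<le> j\<close> j] h0(1) by (simp add: idx_def)
        moreover have "1 \<le> ?dl (tv (k - i))" using profile_less by (simp add: profile_def)
        ultimately show ?thesis by (rule add_mono)
      next
        assume "tv (k - i) \<le> j"
        then have "ereal (of_int N) + 1 \<le> ?dl (tv (k - i))"
          using profile_mono[OF profile_less _ j] idxl order_trans by blast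
        moreover have "0 \<le> ?dn (tv i)" using profile_n by (simp add: profile_def)
        ultimately show ?thesis by (simp add: add_increasing)
      qed
    qed
    then have "ereal (real (s * k)) + (ereal (of_int N) + 1) \<le>
        ereal (real (s * k)) + (?dn (tv i) + ?dl (tv (k - i)))" by (rule add_left_mono)
    moreover have "real (s * k) = real s * real i + real s * real (k - i)"
      using i by (simp add: of_nat_diff algebra_simps)
    then have "ereal (real (s * k)) + (?dn (tv i) + ?dl (tv (k - i))) =
        bnd (1 * int s) ?dn i + bnd (1 * int s) ?dl (k - i)"
      unfolding bnd_def by (simp only: plus_ereal.simps(1)[symmetric] of_int_mult of_int_1 mult_1 of_int_of_nat_eq add_ac)
    ultimately have "?B + 1 \<le> bnd (1 * int s) ?dn i + bnd (1 * int s) ?dl (k - i)"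
      by (simp add: one_ereal_def add.assoc)
    with \<open>vge _ (bnd _ ?dn i + _)\<close> show ?thesis by (rule vge_mono)
  qed
  have "vge (\<Sum>i\<in>{1..<k}. \<Psi> G_ser $ i * \<Psi> H_ser $ (k - i)) (?B + 1)"
    using cross by (rule vge_sum)
  then have "vge (\<Psi> H_ser $ k + (\<Sum>i\<in>{1..<k}. \<Psi> G_ser $ i * \<Psi> H_ser $ (k - i))) (?B + 1)"
    using Hk vge_add by blast
  from vge_perturb[OF wx0 this] show ?thesis
    using frobenius_F_ser_nth[OF Psi k(1)] Gk by (simp add: k_def[symmetric] add.assoc)
qed

lemma exact_value:
  assumes Psi: "frobenius_op s \<Psi>" and s: "s \<ge> 1" and j: "j \<le> \<nu>"
    and N: "idx {1..n} j = ereal (of_int N)" and dvd: "int n dvd int (s * p ^ j) + N"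
    and pN: "int p ^ j dvd N"
  shows "\<exists>x. \<Psi> F_ser $ (p ^ j) = \<tau> x \<and> w x = ereal (real (s * p ^ j) + of_int N)"
proof -
  obtain h0 where h0: "h0 \<in> {1..n}" "contrib h0 j = ereal (of_int N)" "int n dvd N + int h0"
    "\<And>h. h \<in> {1..n} \<Longrightarrow> h \<noteq> h0 \<Longrightarrow> ereal (of_int N) + 1 \<le> contrib h j"
    using unique_contrib[OF N] by metis
  show ?thesis
  proof (cases "h0 = n")
    case True
    then show ?thesis using exact_n[OF Psi s j dvd] h0 by simp
  next
    case False
    then show ?thesis using exact_less[OF Psi s j N dvd pN _ h0(2-4)] h0(1) by simp
  qed
qed

end

section \<open>Totally ramified extensions\<close>

lemma poly_euclid_combination:
  fixes f g :: "'a::field poly"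
  shows "\<exists>d r s. d = r * f + s * g \<and> d dvd f \<and> d dvd g"
proof (induction "if g = 0 then 0 else Suc (degree g)" arbitrary: f g rule: less_induct)
  case less
  show ?case
  proof (cases "g = 0")
    case True
    then show ?thesis by (intro exI[of _ f] exI[of _ 1] exI[of _ 0]) auto
  next
    case False
    have "(if f mod g = 0 then 0 else Suc (degree (f mod g))) < (if g = 0 then 0 else Suc (degree g))"
      using False degree_mod_less[of g f] by auto
    then obtain d r s where d: "d = r * g + s * (f mod g)" "d dvd g" "d dvd f mod g"
      using less[of "f mod g" g] by metis
    have "d dvd f" using d by (metis dvd_mod_iff)
    moreover have "d = s * f + (r - s * (f div g)) * g"
    proof -
      have eq: "f mod g = f - f div g * g" by (simp only: minus_div_mult_eq_mod)
      show ?thesis unfolding d(1) eq by (simp add: algebra_simps)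
    qed
    ultimately show ?thesis using d(2) by blast
  qed
qed

lemma coprime_poly_combination:
  fixes f g :: "'a::field poly"
  assumes "coprime f g"
  shows "\<exists>r s. r * f + s * g = 1"
proof -
  obtain d r s where d: "d = r * f + s * g" "d dvd f" "d dvd g"
    using poly_euclid_combination by blast
  then have "d dvd 1" using assms by (simp add: coprime_def)
  then obtain e where "1 = d * e" by blast
  then have "(e * r) * f + (e * s) * g = 1" using d(1) by (simp add: algebra_simps)
  then show ?thesis by blast
qed

text \<open>A Bezout identity for \<open>f\<close> and its derivative survives any field
  extension.\<close>

lemma (in field_hom) separable_poly_map_poly:
  assumes "separable_poly f"
  shows "separable_poly (map_poly hom f)"
proof -
  interpret mp: map_poly_comm_ring_hom hom ..
  obtain r s where "r * f + s * pderiv f = 1"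
    using coprime_poly_combination assms unfolding separable_poly_def by blast
  then have "map_poly hom r * map_poly hom f + map_poly hom s * pderiv (map_poly hom f) = 1"
    by (metis mp.hom_add mp.hom_mult mp.hom_one map_poly_pderiv)
  then have "d dvd 1" if "d dvd map_poly hom f" "d dvd pderiv (map_poly hom f)" for d
    using that by (metis dvd_add dvd_mult)
  then show ?thesis unfolding separable_poly_def by (intro coprimeI) auto
qed

text \<open>Roots are split off one at a time; a root occurring twice would give a common factor of
  \<open>g\<close> and its derivative.\<close>

lemma separable_poly_splits:
  assumes closed: "\<forall>f :: 'a::field poly. separable_poly f \<and> degree f > 0 \<longrightarrow> (\<exists>x. poly f x = 0)"
  shows "separable_poly g \<Longrightarrow> lead_coeff g = 1 \<Longrightarrow>
    \<exists>R. finite R \<and> card R = degree g \<and> (g :: 'a poly) = (\<Prod>x\<in>R. [:- x, 1:])"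
proof (induction "degree g" arbitrary: g)
  case 0
  then have "g = 1" by (metis degree_0_id one_pCons)
  then show ?case by (intro exI[of _ "{}"]) auto
next
  case (Suc m)
  then obtain x where x: "poly g x = 0" using closed by (metis zero_less_Suc)
  then obtain g' where g': "g = [:- x, 1:] * g'" by (auto simp: poly_eq_0_iff_dvd)
  have "g' \<noteq> 0" using g' Suc by auto
  then have deg: "degree g = Suc (degree g')" unfolding g' by (subst degree_mult_eq) auto
  have lead: "lead_coeff g' = 1" using Suc.prems(2) g' by (simp only: lead_coeff_mult) simp
  have "separable_poly g'" using separable_poly_dvd[OF Suc.prems(1)] g' by (metis dvd_triv_right)
  then obtain R where R: "finite R" "card R = degree g'" "g' = (\<Prod>x\<in>R. [:- x, 1:])"
    using Suc deg lead by (metis nat.inject)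
  have "x \<notin> R"
  proof
    assume "x \<in> R"
    then have "poly g' x = 0" using R by (auto simp: poly_prod)
    then have "[:- x, 1:] dvd g'" by (simp add: poly_eq_0_iff_dvd)
    moreover have "pderiv g = [:- x, 1:] * pderiv g' + g' * pderiv [:- x, 1:]"
      unfolding g' by (rule pderiv_mult)
    ultimately have "[:- x, 1:] dvd pderiv g" by (metis dvd_add dvd_mult2 dvd_triv_left)
    then have "[:- x, 1:] dvd (1 :: 'a poly)"
      using Suc.prems(1) g' unfolding separable_poly_def coprime_def by (metis dvd_triv_left)
    then show False by (simp add: is_unit_iff_degree)
  qed
  then have "g = (\<Prod>x\<in>insert x R. [:- x, 1:])" using R g' by simp
  moreover have "card (insert x R) = degree g" using R \<open>x \<notin> R\<close> deg by simp
  ultimately show ?case using R(1) by blast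
qed

lemma fps_prod_one_minus_reflect:
  fixes R :: "'a::field set"
  assumes "finite R"
  shows "(\<Prod>x\<in>R. one_minus x 1) = fps_of_poly (reflect_poly (\<Prod>x\<in>R. [:- x, 1:]))"
proof -
  have "reflect_poly [:- x, 1:] = [:1, - x:]" for x :: 'a
    by (rule poly_eqI) (auto simp: coeff_reflect_poly coeff_pCons split: nat.splits)
  then show ?thesis
    by (simp only: reflect_poly_prod fps_of_poly_prod fps_of_poly_linear_one_minus)
qed

section \<open>Elementary facts on discrete valuations\<close>

context
  fixes v :: "'a::field \<Rightarrow> ereal"
  assumes v: "discrete_valuation v"
begin

lemma dv_inf: "v x = \<infinity> \<longleftrightarrow> x = 0"
  using v by (simp add: discrete_valuation_def)

lemma dv_0: "v 0 = \<infinity>"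
  by (simp add: dv_inf)

lemma dv_range: "v ` (UNIV - {0}) = range (\<lambda>m::int. ereal (of_int m))"
  using v by (simp add: discrete_valuation_def)

lemma dv_int: "x \<noteq> 0 \<Longrightarrow> \<exists>z::int. v x = ereal (of_int z)"
  using imageI[of x "UNIV - {0}" v] unfolding dv_range by auto

lemma dv_surj: "\<exists>x. x \<noteq> 0 \<and> v x = ereal (of_int z)"
proof -
  have "ereal (of_int z) \<in> v ` (UNIV - {0})" unfolding dv_range by blast
  then show ?thesis by auto
qed

lemma dv_ninf: "v x \<noteq> - \<infinity>"
  using dv_inf[of x] dv_int[of x] by (cases "x = 0") auto

lemma dv_mult: "v (x * y) = v x + v y"
  using v by (simp add: discrete_valuation_def)

lemma dv_add: "min (v x) (v y) \<le> v (x + y)"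
  using v by (simp add: discrete_valuation_def)

lemma dv_one: "v 1 = 0"
proof -
  obtain z :: int where "v 1 = ereal (of_int z)" using dv_int[of 1] by auto
  then show ?thesis using dv_mult[of 1 1] by simp
qed

lemma dv_uminus: "v (- x) = v x"
proof -
  obtain z :: int where z: "v (-1) = ereal (of_int z)" using dv_int[of "-1"] by auto
  then have "v (-1) = 0" using dv_mult[of "-1" "-1"] dv_one by simp
  then show ?thesis using dv_mult[of "-1" x] by simp
qed

lemma dv_power: "x \<noteq> 0 \<Longrightarrow> v x = ereal y \<Longrightarrow> v (x ^ k) = ereal (real k * y)"
  by (induction k) (auto simp: dv_mult dv_one algebra_simps)

lemma dv_sum_ge: "(\<And>i. i \<in> I \<Longrightarrow> b \<le> v (f i)) \<Longrightarrow> b \<le> v (sum f I)"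
proof (induction I rule: infinite_finite_induct)
  case (insert i I)
  then have "b \<le> min (v (f i)) (v (sum f I))" by simp
  also have "\<dots> \<le> v (f i + sum f I)" by (rule dv_add)
  finally show ?case using insert by simp
qed (auto simp: dv_0)

lemma dv_sum_gt: "b < \<infinity> \<Longrightarrow> (\<And>i. i \<in> I \<Longrightarrow> b < v (f i)) \<Longrightarrow> b < v (sum f I)"
proof (induction I rule: infinite_finite_induct)
  case (insert i I)
  then have "b < min (v (f i)) (v (sum f I))" by simp
  also have "\<dots> \<le> v (f i + sum f I)" by (rule dv_add)
  finally show ?case using insert by simp
qed (auto simp: dv_0)

text \<open>Several terms may vanish and share the value infinity, hence the restriction to nonzero
  \<open>f i\<close>.\<close>

lemma dv_sum_distinct:
  assumes I: "finite I" "I \<noteq> {}"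
    and dist: "\<And>i j. i \<in> I \<Longrightarrow> j \<in> I \<Longrightarrow> v (f i) = v (f j) \<Longrightarrow> f i \<noteq> 0 \<Longrightarrow> i = j"
  obtains i where "i \<in> I" "v (sum f I) = v (f i)" "\<And>j. j \<in> I \<Longrightarrow> v (f i) \<le> v (f j)"
proof -
  have "Min ((\<lambda>i. v (f i)) ` I) \<in> (\<lambda>i. v (f i)) ` I" using I by (intro Min_in) auto
  then obtain i where i: "i \<in> I" "Min ((\<lambda>i. v (f i)) ` I) = v (f i)" by auto
  have le: "v (f i) \<le> v (f j)" if "j \<in> I" for j
    unfolding i(2)[symmetric] using I that by (intro Min_le) auto
  have "v (sum f I) = v (f i)"
  proof (cases "f i = 0")
    case True
    have "f j = 0" if "j \<in> I" for j
    proof -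
      have "v (f j) = \<infinity>" using le[OF that] True by (simp add: dv_0)
      then show ?thesis by (simp add: dv_inf)
    qed
    then show ?thesis using True by simp
  next
    case False
    have "v (f i) < v (sum f (I - {i}))"
    proof (rule dv_sum_gt)
      show "v (f i) < \<infinity>" using False dv_inf[of "f i"] by (cases "v (f i)") auto
      show "v (f i) < v (f j)" if "j \<in> I - {i}" for j
        using le[of j] dist[of i j] False that i by (auto simp: less_le)
    qed
    moreover have "sum f I = f i + sum f (I - {i})" using I i by (simp add: sum.remove)
    moreover have "v (x + y) = v x" if "v x < v y" for x y
    proof (rule antisym)
      show "v x \<le> v (x + y)" using dv_add[of x y] that by (simp add: min_def less_imp_le)
      have "min (v (x + y)) (v y) \<le> v x" using dv_add[of "x + y" "- y"] by (simp add: dv_uminus)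
      then show "v (x + y) \<le> v x" using that by (simp add: min_def split: if_splits)
    qed
    ultimately show ?thesis by simp
  qed
  then show ?thesis using that i le by blast
qed

end

lemma (in field_hom) vector_space_hom: "vector_space (\<lambda>c x. hom c * x)"
  by (simp add: vector_space_def module_def hom_add hom_mult distrib_left distrib_right mult.assoc)

text \<open>In the quotient, \<open>k\<close> times the unit is the coset of \<open>k\<close>; for
  \<open>k = p\<close> it is the zero coset, so \<open>p\<close> lies in the maximal ideal. The
  cosets are computed directly from the definitions.\<close>

lemma residue_char_pos:
  assumes v: "discrete_valuation v" and R: "perfect_of_char (residue_field v) p"
  shows "v (of_nat p) > 0"
proof -
  let ?M = "max_ideal_power v 1" and ?V = "valuation_ring v"
  let ?R = "residue_field v"
  have zero: "\<zero>\<^bsub>?R\<^esub> = ?M" "\<one>\<^bsub>?R\<^esub> = ?M +>\<^bsub>?V\<^esub> \<one>\<^bsub>?V\<^esub>"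
    by (auto simp: residue_field_def FactRing_def)
  have coset: "?M +>\<^bsub>?V\<^esub> x = {m + x | m. m \<in> ?M}" for x
    by (auto simp: a_r_coset_def' valuation_ring_def)
  have M0: "0 \<in> ?M" by (simp add: max_ideal_power_def dv_0[OF v])
  have Madd: "x + y \<in> ?M" if "x \<in> ?M" "y \<in> ?M" for x y
    using that dv_add[OF v, of x y] by (auto simp: max_ideal_power_def min_def split: if_splits)
  have sum: "(?M +>\<^bsub>?V\<^esub> x) \<oplus>\<^bsub>?R\<^esub> (?M +>\<^bsub>?V\<^esub> y) = ?M +>\<^bsub>?V\<^esub> (x + y)" for x y
  proof -
    have "(?M +>\<^bsub>?V\<^esub> x) \<oplus>\<^bsub>?R\<^esub> (?M +>\<^bsub>?V\<^esub> y) = {a + b | a b. a \<in> ?M +>\<^bsub>?V\<^esub> x \<and> b \<in> ?M +>\<^bsub>?V\<^esub> y}"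
      by (auto simp: residue_field_def FactRing_def set_add_def' valuation_ring_def)
    also have "\<dots> = {m + (x + y) | m. m \<in> ?M}"
    proof (intro Set.set_eqI iffI)
      fix z assume "z \<in> {a + b | a b. a \<in> ?M +>\<^bsub>?V\<^esub> x \<and> b \<in> ?M +>\<^bsub>?V\<^esub> y}"
      then obtain m m' where "m \<in> ?M" "m' \<in> ?M" "z = (m + x) + (m' + y)" unfolding coset by blast
      then show "z \<in> {m + (x + y) | m. m \<in> ?M}" using Madd[of m m'] by (auto simp: algebra_simps intro!: exI[of _ "m + m'"])
    next
      fix z assume "z \<in> {m + (x + y) | m. m \<in> ?M}"
      then obtain m where m: "m \<in> ?M" "z = m + (x + y)" by blast
      then have "z = (m + x) + (0 + y)" by (simp add: algebra_simps)
      then show "z \<in> {a + b | a b. a \<in> ?M +>\<^bsub>?V\<^esub> x \<and> b \<in> ?M +>\<^bsub>?V\<^esub> y}"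
        unfolding coset using m M0 by blast
    qed
    finally show ?thesis by (simp add: coset)
  qed
  have M_coset: "?M = ?M +>\<^bsub>?V\<^esub> 0" by (auto simp: coset)
  have one: "\<one>\<^bsub>?V\<^esub> = 1" by (simp add: valuation_ring_def)
  have "[k] \<cdot>\<^bsub>?R\<^esub> \<one>\<^bsub>?R\<^esub> = ?M +>\<^bsub>?V\<^esub> (of_nat k)" for k :: nat
  proof (induction k)
    case 0
    then show ?case using M_coset zero by (simp add: add_pow_def nat_pow_def)
  next
    case (Suc k)
    have "[Suc k] \<cdot>\<^bsub>?R\<^esub> \<one>\<^bsub>?R\<^esub> = [k] \<cdot>\<^bsub>?R\<^esub> \<one>\<^bsub>?R\<^esub> \<oplus>\<^bsub>?R\<^esub> \<one>\<^bsub>?R\<^esub>"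
      by (simp add: add_pow_def nat_pow_def)
    then show ?case using Suc sum[of "of_nat k" 1] zero(2) one by (simp add: add.commute)
  qed
  then have "?M +>\<^bsub>?V\<^esub> (of_nat p) = ?M" using R zero by (simp add: perfect_of_char_def)
  moreover have "of_nat p \<in> ?M +>\<^bsub>?V\<^esub> (of_nat p)" using M0 unfolding coset by force
  ultimately have "1 \<le> v (of_nat p)" by (simp add: max_ideal_power_def one_ereal_def)
  then show ?thesis using less_le_trans[of 0 1 "v (of_nat p)"] by simp
qed

lemma poly_eq_sum_lessThan:
  fixes g :: "'a::comm_semiring_1 poly"
  assumes "degree g < m"
  shows "poly g x = (\<Sum>i<m. coeff g i * x ^ i)"
proof -
  have "poly g x = (\<Sum>i\<le>degree g. coeff g i * x ^ i)" by (rule poly_altdef)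
  also have "\<dots> = (\<Sum>i<m. coeff g i * x ^ i)"
    using assms by (intro sum.mono_neutral_left) (auto simp: coeff_eq_0)
  finally show ?thesis .
qed

context field_hom
begin

lemma poly_map_poly_arith:
  "poly (map_poly hom (f + g)) x = poly (map_poly hom f) x + poly (map_poly hom g) x"
  "poly (map_poly hom (f - g)) x = poly (map_poly hom f) x - poly (map_poly hom g) x"
  "poly (map_poly hom (f * g)) x = poly (map_poly hom f) x * poly (map_poly hom g) x"
proof -
  interpret mp: map_poly_comm_ring_hom hom ..
  show "poly (map_poly hom (f + g)) x = poly (map_poly hom f) x + poly (map_poly hom g) x"
    "poly (map_poly hom (f - g)) x = poly (map_poly hom f) x - poly (map_poly hom g) x"
    "poly (map_poly hom (f * g)) x = poly (map_poly hom f) x * poly (map_poly hom g) x"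
    by (simp_all add: mp.hom_add mp.hom_minus mp.hom_mult)
qed

lemma poly_map_poly_sum_lessThan:
  assumes "degree g < m"
  shows "poly (map_poly hom g) x = (\<Sum>i<m. hom (coeff g i) * x ^ i)"
proof -
  have "degree (map_poly hom g) < m" using assms degree_map_poly_le[of hom g] by simp
  then show ?thesis by (simp add: poly_eq_sum_lessThan coeff_map_poly)
qed

end

section \<open>Powers of a uniformizer as a basis; the Eisenstein polynomial\<close>

locale totally_ramified_ext =
  i: field_hom \<iota> + k: field_hom \<kappa> + t: field_hom "\<lambda>x. \<kappa> (\<iota> x)"
  for \<iota> :: "'k::field \<Rightarrow> 'l::field" and \<kappa> :: "'l \<Rightarrow> 's::field" +
  fixes vK :: "'k \<Rightarrow> ereal" and vL :: "'l \<Rightarrow> ereal" and \<pi> :: 'l and p n u \<nu> :: nat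
  assumes vK: "discrete_valuation vK"
    and sep: "separable_closure (\<kappa> \<circ> \<iota>)"
    and deg: "ext_degree \<iota> = n" and n_eq: "n = u * p ^ \<nu>" and u: "\<not> p dvd u"
    and ram: "totally_ramified \<iota> vK vL"
    and pi: "vL \<pi> = 1"
    and prime_p: "prime p" and vK_p: "vK (of_nat p) > 0"
begin

definition tau :: "'k \<Rightarrow> 's" where
  "tau x = \<kappa> (\<iota> x)"

definition w :: "'k \<Rightarrow> ereal" where
  "w x = vL (\<iota> x)"

lemma tau_eq: "\<kappa> \<circ> \<iota> = tau"
  by (simp add: fun_eq_iff tau_def)

lemma hom_tau: "field_hom tau"
  using t.field_hom_axioms by (simp add: tau_def[abs_def])

lemma vL: "discrete_valuation vL"
  using ram by (simp add: totally_ramified_def)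

lemma w_vK: "w x = ereal (real n) * vK x"
  using ram deg by (simp add: totally_ramified_def w_def)

lemma n_pos: "n > 0"
proof -
  have "u \<noteq> 0" using u by (metis dvd_0_right)
  then show ?thesis using n_eq prime_gt_0_nat[OF prime_p] by simp
qed

lemma w_discrete: "x \<noteq> 0 \<Longrightarrow> \<exists>z::int. vK x = ereal (of_int z) \<and> w x = ereal (real n * of_int z)"
  using dv_int[OF vK, of x] by (auto simp: w_vK)

lemma pi_nz: "\<pi> \<noteq> 0"
  using pi dv_inf[OF vL, of \<pi>] by auto

lemma vL_pi_power: "vL (\<pi> ^ i) = ereal (real i)"
  using dv_power[OF vL pi_nz, of 1 i] pi by (simp add: one_ereal_def)

lemma vL_term: "vL (\<iota> b * \<pi> ^ i) = w b + ereal (real i)"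
  by (simp add: dv_mult[OF vL] w_def vL_pi_power)

lemma vL_term_int:
  assumes "b \<noteq> 0"
  shows "\<exists>z::int. vL (\<iota> b * \<pi> ^ i) = ereal (of_int (int n * z + int i))"
  using w_discrete[OF assms] by (auto simp: vL_term)

text \<open>Values of \<open>w\<close> are multiples of \<open>n\<close>, so the valuation of the
  term determines its exponent modulo \<open>n\<close>. The window may start anywhere: at 0 for
  polynomials in \<open>\<pi>\<close>, at 1 where positive exponents are required.\<close>

lemma term_distinct:
  assumes ij: "i \<in> {m..<m + n}" "j \<in> {m..<m + n}"
    and eq: "vL (\<iota> b * \<pi> ^ i) = vL (\<iota> c * \<pi> ^ j)" and nz: "\<iota> b * \<pi> ^ i \<noteq> 0"
  shows "i = j"
proof -
  have b: "b \<noteq> 0" using nz by auto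
  have "vL (\<iota> c * \<pi> ^ j) \<noteq> \<infinity>" using eq nz dv_inf[OF vL] by metis
  then have c: "c \<noteq> 0" by (auto simp: dv_0[OF vL])
  obtain y z where y: "vL (\<iota> b * \<pi> ^ i) = ereal (of_int (int n * y + int i))"
    and z: "vL (\<iota> c * \<pi> ^ j) = ereal (of_int (int n * z + int j))"
    using vL_term_int[OF b, of i] vL_term_int[OF c, of j] by blast
  have "int n * y + int i = int n * z + int j"
    using eq unfolding y z by (simp only: ereal.inject of_int_eq_iff)
  then have "int n * (y - z) = int j - int i" by (simp add: algebra_simps)
  then have "int n dvd int j - int i" by (metis dvd_triv_left)
  moreover have "\<bar>int j - int i\<bar> < int n" using ij by auto
  ultimately have "int j - int i = 0" by (metis dvd_imp_le_int abs_of_nat not_less)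
  then show ?thesis by simp
qed

lemma lincomb_val:
  obtains i where "i \<in> {m..<m + n}"
    "vL (\<Sum>i\<in>{m..<m + n}. \<iota> (b i) * \<pi> ^ i) = vL (\<iota> (b i) * \<pi> ^ i)"
    "\<And>j. j \<in> {m..<m + n} \<Longrightarrow> vL (\<iota> (b i) * \<pi> ^ i) \<le> vL (\<iota> (b j) * \<pi> ^ j)"
proof (rule dv_sum_distinct[OF vL, of "{m..<m + n}" "\<lambda>i. \<iota> (b i) * \<pi> ^ i"])
  show "{m..<m + n} \<noteq> {}" using n_pos by simp
  show "i = j" if "i \<in> {m..<m + n}" "j \<in> {m..<m + n}"
    "vL (\<iota> (b i) * \<pi> ^ i) = vL (\<iota> (b j) * \<pi> ^ j)" "\<iota> (b i) * \<pi> ^ i \<noteq> 0" for i j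
    using term_distinct that by blast
qed (use that in auto)

lemma lincomb_ge:
  assumes "j \<in> {m..<m + n}"
  shows "vL (\<Sum>i\<in>{m..<m + n}. \<iota> (b i) * \<pi> ^ i) \<le> vL (\<iota> (b j) * \<pi> ^ j)"
  using assms by (metis lincomb_val[where m = m and b = b])

lemma lincomb_zero:
  assumes "(\<Sum>i\<in>{m..<m + n}. \<iota> (b i) * \<pi> ^ i) = 0" "j \<in> {m..<m + n}"
  shows "b j = 0"
proof -
  have "vL (\<iota> (b j) * \<pi> ^ j) = \<infinity>"
    using lincomb_ge[OF assms(2), of b] assms(1) by (simp add: dv_0[OF vL])
  then show ?thesis using pi_nz by (simp add: dv_inf[OF vL])
qed

lemma lincomb_exists: "\<exists>b. \<alpha> = (\<Sum>i\<in>{m..<m + n}. \<iota> (b i) * \<pi> ^ i)"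
proof -
  interpret VS: vector_space "\<lambda>c x. \<iota> c * x" by (rule i.vector_space_hom)
  have dim: "VS.dim (UNIV :: 'l set) = n" using deg by (simp add: ext_degree_def)
  obtain B where B: "VS.independent B" "UNIV \<subseteq> VS.span B" "card B = VS.dim (UNIV :: 'l set)"
    using VS.basis_exists[of UNIV] by metis
  \<comment> \<open>An infinite basis would have \<open>card B = 0\<close>, whereas the degree
    \<open>n\<close> is positive.\<close>
  have "finite B" using B(3) dim n_pos by (metis card_ge_0_finite)
  interpret FD: finite_dimensional_vector_space "\<lambda>c x. \<iota> c * x" B
    by unfold_locales (use B \<open>finite B\<close> in auto)
  define S where "S = (\<lambda>i. \<pi> ^ i) ` {m..<m + n}"
  have inj: "inj_on (\<lambda>i. \<pi> ^ i) {m..<m + n}"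
  proof (rule inj_onI)
    fix i j assume "\<pi> ^ i = \<pi> ^ j"
    then have "ereal (real i) = ereal (real j)" using vL_pi_power by metis
    then show "i = j" by simp
  qed
  have sum_S: "(\<Sum>x\<in>S. \<iota> (c x) * x) = (\<Sum>i\<in>{m..<m + n}. \<iota> (c (\<pi> ^ i)) * \<pi> ^ i)" for c
    unfolding S_def by (simp add: sum.reindex[OF inj])
  have fin: "finite S" by (simp add: S_def)
  have "VS.independent S"
  proof
    assume "VS.dependent S"
    then obtain c x where cx: "x \<in> S" "c x \<noteq> 0" "(\<Sum>x\<in>S. \<iota> (c x) * x) = 0"
      unfolding VS.dependent_finite[OF fin] by blast
    then obtain i where "i \<in> {m..<m + n}" "x = \<pi> ^ i" by (auto simp: S_def)
    then show False using lincomb_zero[where m = m and b = "\<lambda>i. c (\<pi> ^ i)" and j = i] cx sum_S by simp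
  qed
  moreover have "card S = n" by (simp add: S_def card_image[OF inj])
  ultimately have "UNIV \<subseteq> VS.span S"
    using FD.card_ge_dim_independent[of S UNIV] dim by simp
  then have "\<alpha> \<in> range (\<lambda>c. \<Sum>x\<in>S. \<iota> (c x) * x)" using VS.span_finite[OF fin] by auto
  then show ?thesis using sum_S by auto
qed

abbreviation ev :: "'k poly \<Rightarrow> 'l" where
  "ev g \<equiv> poly (map_poly \<iota> g) \<pi>"

lemma ev_eq_0_degree:
  assumes "ev g = 0" "g \<noteq> 0"
  shows "n \<le> degree g"
proof (rule ccontr)
  assume "\<not> n \<le> degree g"
  then have d: "degree g < n" by simp
  then have "(\<Sum>i\<in>{0..<0 + n}. \<iota> (coeff g i) * \<pi> ^ i) = 0"
    using assms i.poly_map_poly_sum_lessThan[OF d, of \<pi>] by (simp add: lessThan_atLeast0)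
  then have "coeff g i = 0" if "i < n" for i using lincomb_zero that by fastforce
  then show False using d assms by (metis leading_coeff_0_iff)
qed

definition f :: "'k poly" where
  "f = min_poly \<iota> \<pi>"

lemma f_props: "lead_coeff f = 1" "degree f = n" "ev f = 0"
proof -
  obtain b where b: "\<pi> ^ n = (\<Sum>i\<in>{0..<0 + n}. \<iota> (b i) * \<pi> ^ i)" using lincomb_exists by blast
  define r where "r = (\<Sum>i<n. monom (b i) i)"
  define f0 where "f0 = monom 1 n - r"
  have cr: "coeff r i = (if i < n then b i else 0)" for i
    by (simp add: r_def coeff_sum)
  have dr: "degree r < n" using n_pos by (intro le_less_trans[OF degree_le[of "n - 1"]]) (auto simp: cr)
  have c0: "coeff f0 n = 1" "coeff f0 i = 0" if "i > n" for i
    using that by (auto simp: f0_def cr)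
  have cn: "coeff f0 n = 1" by (simp add: f0_def cr)
  have d0: "degree f0 = n"
    by (rule antisym) (use c0 cn in \<open>auto intro!: degree_le le_degree\<close>)
  have "ev r = \<pi> ^ n"
    using i.poly_map_poly_sum_lessThan[OF dr, of \<pi>] b by (simp add: cr lessThan_atLeast0)
  moreover have "ev (monom 1 n) = \<pi> ^ n"
    by (simp add: map_poly_monom poly_monom)
  ultimately have e0: "ev f0 = 0" by (simp add: f0_def i.poly_map_poly_arith)
  have "min_poly \<iota> \<pi> = f0"
    unfolding min_poly_def
  proof (rule the_equality)
    show "lead_coeff f0 = 1 \<and> ev f0 = 0 \<and> (\<forall>g. g \<noteq> 0 \<and> ev g = 0 \<longrightarrow> degree f0 \<le> degree g)"
      using cn d0 e0 ev_eq_0_degree by auto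
    fix g assume g: "lead_coeff g = 1 \<and> ev g = 0 \<and> (\<forall>h. h \<noteq> 0 \<and> ev h = 0 \<longrightarrow> degree g \<le> degree h)"
    have "g \<noteq> 0" "f0 \<noteq> 0" using g cn by auto
    then have dg: "degree g = n" using g ev_eq_0_degree[of g] d0 e0 by (auto intro!: antisym)
    have "ev (g - f0) = 0" using g e0 by (simp add: i.poly_map_poly_arith)
    moreover have "g - f0 = 0 \<or> degree (g - f0) < n"
    proof (cases "g - f0 = 0")
      case False
      have "degree (g - f0) \<le> n" using dg d0 by (intro degree_diff_le) auto
      moreover have "coeff (g - f0) n = 0" using g dg cn by auto
      ultimately show ?thesis using False by (metis le_neq_implies_less leading_coeff_0_iff)
    qed simp
    ultimately show "g = f0" using ev_eq_0_degree[of "g - f0"] by (metis eq_iff_diff_eq_0 not_less)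
  qed
  then show "lead_coeff f = 1" "degree f = n" "ev f = 0" using cn d0 e0 by (simp_all add: f_def)
qed

lemma ev_eq_0_iff: "ev g = 0 \<longleftrightarrow> f dvd g"
proof
  assume "f dvd g"
  then show "ev g = 0" using f_props(3) by (auto simp: i.poly_map_poly_arith elim!: dvdE)
next
  assume g: "ev g = 0"
  have "g = f * (g div f) + g mod f" by simp
  then have "ev g = ev f * ev (g div f) + ev (g mod f)" by (metis i.poly_map_poly_arith(1,3))
  then have "ev (g mod f) = 0" using g f_props(3) by simp
  moreover have "f \<noteq> 0" using f_props n_pos by auto
  then have "g mod f = 0 \<or> degree (g mod f) < n" using degree_mod_less[of f g] f_props by auto
  ultimately have "g mod f = 0" using ev_eq_0_degree[of "g mod f"] not_less by blast
  then show "f dvd g" by (simp add: dvd_eq_mod_eq_0)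
qed

lemma kappa_ev: "\<kappa> (ev g) = poly (map_poly tau g) (\<kappa> \<pi>)"
proof -
  have "map_poly \<kappa> (map_poly \<iota> g) = map_poly tau g"
    by (rule poly_eqI) (simp add: coeff_map_poly tau_def)
  then show ?thesis by (metis k.poly_map_poly)
qed

text \<open>\<open>\<kappa> \<pi>\<close> is a root of some separable polynomial over K, and
  \<open>f\<close> divides it.\<close>

lemma separable_f: "separable_poly f"
proof -
  obtain g where g: "separable_poly g" "poly (map_poly tau g) (\<kappa> \<pi>) = 0"
    using sep unfolding separable_closure_def tau_eq by blast
  then have "\<kappa> (ev g) = 0" by (simp add: kappa_ev)
  then have "f dvd g" by (simp add: ev_eq_0_iff)
  then show ?thesis using separable_poly_dvd g(1) by blast
qed

lemma sep_closed: "\<forall>f :: 's poly. separable_poly f \<and> degree f > 0 \<longrightarrow> (\<exists>x. poly f x = 0)"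
  using sep by (simp add: separable_closure_def)

text \<open>The guard matters: for \<open>h > n\<close> truncated subtraction would return the
  constant coefficient instead of 0.\<close>

definition coef :: "nat \<Rightarrow> 'k" where
  "coef h = (if h \<le> n then coeff f (n - h) else 0)"

text \<open>\<open>\<pi> ^ n\<close> is a combination of lower powers whose nonzero terms have
  distinct valuations. So every term has valuation at least \<open>n\<close>, one has exactly
  \<open>n\<close>, and its exponent, divisible by \<open>n\<close>, must be 0.\<close>

lemma eisenstein_coeff:
  shows "\<And>i. i < n \<Longrightarrow> ereal (real n) \<le> w (coeff f i) + ereal (real i)"
    and "w (coeff f 0) = ereal (real n)"
proof -
  define b where "b = (\<lambda>i. - coeff f i)"
  have "ev f = (\<Sum>i<Suc n. \<iota> (coeff f i) * \<pi> ^ i)"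
    using f_props by (intro i.poly_map_poly_sum_lessThan) simp
  then have "\<pi> ^ n = - (\<Sum>i<n. \<iota> (coeff f i) * \<pi> ^ i)"
    using f_props by (simp add: eq_neg_iff_add_eq_0 add.commute)
  also have "\<dots> = (\<Sum>i\<in>{0..<0 + n}. \<iota> (b i) * \<pi> ^ i)"
    by (simp add: b_def i.hom_uminus sum_negf lessThan_atLeast0)
  finally have S: "vL (\<Sum>i\<in>{0..<0 + n}. \<iota> (b i) * \<pi> ^ i) = ereal (real n)"
    using vL_pi_power by metis
  have wb: "vL (\<iota> (b i) * \<pi> ^ i) = w (coeff f i) + ereal (real i)" for i
    using dv_uminus[OF vL] by (simp add: vL_term w_def b_def i.hom_uminus)
  show "ereal (real n) \<le> w (coeff f i) + ereal (real i)" if "i < n" for i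
    using lincomb_ge[of i 0 b] S wb that by simp
  obtain i where i: "i \<in> {0..<0 + n}" "ereal (real n) = vL (\<iota> (b i) * \<pi> ^ i)"
    using lincomb_val[of 0 b] S by metis
  then have "b i \<noteq> 0" by (auto simp: dv_0[OF vL])
  then obtain z where "ereal (real n) = ereal (of_int (int n * z + int i))"
    using vL_term_int i(2) by metis
  then have "real_of_int (int n) = real_of_int (int n * z + int i)" by simp
  then have "int n = int n * z + int i" by (simp only: of_int_eq_iff)
  then have "int i = int n * (1 - z)" by (simp add: algebra_simps)
  then have "int n dvd int i" by simp
  then have "i = 0" using i(1) by (auto dest: dvd_imp_le)
  then show "w (coeff f 0) = ereal (real n)" using i(2) wb[of 0] by (simp add: zero_ereal_def[symmetric])
qed

sublocale es: eisenstein_series tau w p \<nu> n u coef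
proof -
  interpret t': field_hom tau by (rule hom_tau)
  show "eisenstein_series tau w p \<nu> n u coef"
  proof
    show "w x = \<infinity> \<longleftrightarrow> x = 0" for x by (simp add: w_def dv_inf[OF vL])
    show "w x \<noteq> - \<infinity>" for x by (simp add: w_def dv_ninf[OF vL])
    show "w (x * y) = w x + w y" for x y by (simp add: w_def i.hom_mult dv_mult[OF vL])
    show "min (w x) (w y) \<le> w (x + y)" for x y by (simp add: w_def i.hom_add dv_add[OF vL])
    show "0 < w (of_nat p)" using vK_p n_pos by (cases "vK (of_nat p)") (auto simp: w_vK)
    show "coef 0 = 1" using f_props by (simp add: coef_def)
    show "coef h = 0" if "h > n" for h using that by (simp add: coef_def)
    show "w (coef n) = ereal (real n)" using eisenstein_coeff(2) by (simp add: coef_def)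
    show "\<exists>z::int. w x = ereal (real n * of_int z)" if "x \<noteq> 0" for x
      using w_discrete[OF that] by blast
    fix h :: nat assume h: "1 \<le> h" "h < n"
    show "ereal (real h) < w (coef h)"
    proof (cases "coef h = 0")
      case True
      then show ?thesis by (simp add: w_def dv_0[OF vL])
    next
      case False
      then obtain z where z: "w (coef h) = ereal (real n * of_int z)" using w_discrete by blast
      have "ereal (real n) \<le> w (coeff f (n - h)) + ereal (real (n - h))"
        using h by (intro eisenstein_coeff) auto
      then have "real n \<le> real n * of_int z + real (n - h)" using z h by (simp add: coef_def)
      then have "real_of_int (int h) \<le> real_of_int (int n * z)" using h by (simp add: of_nat_diff)
      then have "int h \<le> int n * z" by (simp only: of_int_le_iff)
      moreover have "int h \<noteq> int n * z"
      proof
        assume "int h = int n * z"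
        then have "int n dvd int h" by simp
        then show False using h by (auto dest: dvd_imp_le)
      qed
      ultimately have "int h < int n * z" by simp
      then have "real_of_int (int h) < real_of_int (int n * z)" by (simp only: of_int_less_iff)
      then show ?thesis using z by simp
    qed
  qed (use n_eq u prime_p in auto)
qed

end

section \<open>Embeddings and norms of series over L\<close>

definition fps_map :: "('a::zero \<Rightarrow> 'b) \<Rightarrow> 'a fps \<Rightarrow> 'b fps" where
  "fps_map h Q = Abs_fps (\<lambda>k. h (Q $ k))"

lemma fps_map_nth [simp]: "fps_map h Q $ k = h (Q $ k)"
  by (simp add: fps_map_def)

lemma (in field_hom) fps_map_mult: "fps_map hom (P * Q) = fps_map hom P * fps_map hom Q"
  by (rule fps_ext) (simp add: fps_mult_nth hom_sum hom_mult)

lemma (in field_hom) fps_map_one_minus: "h \<ge> 1 \<Longrightarrow> fps_map hom (one_minus c h) = one_minus (hom c) h"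
  by (rule fps_ext) (simp add: one_minus_nth hom_uminus)

lemma (in valued_embedding) frobenius_op_prod:
  assumes Psi: "frobenius_op s \<Psi>" and I: "finite I"
  shows "\<Psi> (\<Prod>i\<in>I. one_minus (y i) 1) = (\<Prod>i\<in>I. one_minus (y i ^ s) 1)"
  using I
proof (induction I rule: finite_induct)
  case empty
  \<comment> \<open>Multiplicativity alone makes \<open>\<Psi> 1\<close> only idempotent; its
    constant term excludes 0.\<close>
  have "(1 :: 's fps) $ 0 = 1" by simp
  then have "\<Psi> (1 * 1) = \<Psi> 1 * \<Psi> 1" "\<Psi> 1 $ 0 = 1"
    using Psi unfolding frobenius_op_def by blast+
  then have "\<Psi> 1 \<noteq> 0" "\<Psi> 1 * \<Psi> 1 = \<Psi> 1 * 1" by auto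
  then show ?case by (metis mult_left_cancel prod.empty)
next
  case (insert i I)
  have "\<Psi> (one_minus (y i) 1) = one_minus (y i ^ s) 1" using Psi by (simp add: frobenius_op_def)
  then show ?case using insert Psi by (simp add: frobenius_op_def)
qed

context totally_ramified_ext
begin

abbreviation emb :: "('l \<Rightarrow> 's) set" where
  "emb \<equiv> embeddings \<iota> \<kappa>"

lemma emb_hom: "\<sigma> \<in> emb \<Longrightarrow> field_hom \<sigma>"
  by (simp add: embeddings_def)

lemma emb_iota: "\<sigma> \<in> emb \<Longrightarrow> \<sigma> (\<iota> c) = tau c"
  by (auto simp: embeddings_def tau_def fun_eq_iff)

lemma emb_ev:
  assumes "\<sigma> \<in> emb"
  shows "\<sigma> (ev g) = poly (map_poly tau g) (\<sigma> \<pi>)"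
proof -
  interpret s: field_hom \<sigma> by (rule emb_hom[OF assms])
  have "map_poly \<sigma> (map_poly \<iota> g) = map_poly tau g"
    using emb_iota[OF assms] by (intro poly_eqI) (simp add: coeff_map_poly)
  then show ?thesis by (metis s.poly_map_poly)
qed

lemma ev_surj: "\<exists>g. ev g = \<alpha>"
proof -
  obtain b where b: "\<alpha> = (\<Sum>i\<in>{0..<0 + n}. \<iota> (b i) * \<pi> ^ i)" using lincomb_exists by blast
  define g where "g = (\<Sum>i<n. monom (b i) i)"
  have c: "coeff g i = (if i < n then b i else 0)" for i by (simp add: g_def coeff_sum)
  have "degree g < n" using n_pos by (intro le_less_trans[OF degree_le[of "n - 1"]]) (auto simp: c)
  then have "ev g = \<alpha>"
    using i.poly_map_poly_sum_lessThan[of g n \<pi>] b by (simp add: c lessThan_atLeast0)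
  then show ?thesis by blast
qed

definition roots :: "'s set" where
  "roots = {x. poly (map_poly tau f) x = 0}"

lemma roots_split:
  "finite roots" "card roots = n" "map_poly tau f = (\<Prod>x\<in>roots. [:- x, 1:])"
proof -
  have "lead_coeff (map_poly tau f) = 1" "degree (map_poly tau f) = n"
    using f_props by (auto simp: coeff_map_poly)
  then obtain R where R: "finite R" "card R = n" "map_poly tau f = (\<Prod>x\<in>R. [:- x, 1:])"
    using separable_poly_splits[OF sep_closed es.tau.separable_poly_map_poly[OF separable_f]] by auto
  then have "roots = R" by (auto simp: roots_def poly_prod)
  then show "finite roots" "card roots = n" "map_poly tau f = (\<Prod>x\<in>roots. [:- x, 1:])"
    using R by auto
qed

text \<open>Every element of L is a polynomial in \<open>\<pi>\<close>; the embedding evaluates such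
  a polynomial at \<open>x\<close>. The choice is immaterial because two of them differ by a
  multiple of \<open>f\<close>.\<close>

lemma root_embedding:
  assumes x: "x \<in> roots"
  shows "\<exists>\<sigma>\<in>emb. \<sigma> \<pi> = x"
proof -
  let ?e = "\<lambda>g. poly (map_poly tau g) x"
  define \<sigma> where "\<sigma> = (\<lambda>\<alpha>. ?e (SOME g. ev g = \<alpha>))"
  have s: "\<sigma> (ev g) = ?e g" for g
  proof -
    define g' where "g' = (SOME g'. ev g' = ev g)"
    have "ev g' = ev g" unfolding g'_def by (rule someI[of _ g]) simp
    then have "f dvd g' - g" by (simp add: ev_eq_0_iff[symmetric] i.poly_map_poly_arith)
    then obtain q where "g' - g = f * q" by blast
    then have "?e g' - ?e g = ?e f * ?e q" by (metis es.tau.poly_map_poly_arith(2,3))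
    then show ?thesis using x by (simp add: \<sigma>_def g'_def roots_def)
  qed
  have c: "\<sigma> (\<iota> c) = tau c" for c
    using s[of "[:c:]"] i.poly_map_poly_sum_lessThan[of "[:c:]" 1 \<pi>]
      es.tau.poly_map_poly_sum_lessThan[of "[:c:]" 1 x] by simp
  have "field_hom \<sigma>"
  proof
    show "\<sigma> 0 = 0" using c[of 0] by simp
    show "\<sigma> 1 = 1" using c[of 1] by simp
    fix \<alpha> \<beta>
    obtain g h where gh: "\<alpha> = ev g" "\<beta> = ev h" using ev_surj by metis
    show "\<sigma> (\<alpha> + \<beta>) = \<sigma> \<alpha> + \<sigma> \<beta>" "\<sigma> (\<alpha> * \<beta>) = \<sigma> \<alpha> * \<sigma> \<beta>"
      unfolding gh i.poly_map_poly_arith[symmetric] s by (rule es.tau.poly_map_poly_arith)+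
  qed
  then have "\<sigma> \<in> emb" using c by (simp add: embeddings_def fun_eq_iff tau_def)
  moreover have "\<sigma> \<pi> = x" 
    using s[of "[:0, 1:]"] i.poly_map_poly_sum_lessThan[of "[:0, 1:]" 2 \<pi>]
      es.tau.poly_map_poly_sum_lessThan[of "[:0, 1:]" 2 x] by (simp add: numeral_2_eq_2)
  ultimately show ?thesis by blast
qed

lemma bij_emb_roots: "bij_betw (\<lambda>\<sigma>. \<sigma> \<pi>) emb roots"
  unfolding bij_betw_def
proof
  show "inj_on (\<lambda>\<sigma>. \<sigma> \<pi>) emb"
  proof (rule inj_onI, rule ext)
    fix \<sigma> \<sigma>' \<alpha> assume "\<sigma> \<in> emb" "\<sigma>' \<in> emb" "\<sigma> \<pi> = \<sigma>' \<pi>"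
    then show "\<sigma> \<alpha> = \<sigma>' \<alpha>" using ev_surj[of \<alpha>] emb_ev by metis
  qed
  have "\<sigma> \<pi> \<in> roots" if "\<sigma> \<in> emb" for \<sigma>
  proof -
    interpret s: field_hom \<sigma> by (rule emb_hom[OF that])
    show ?thesis using emb_ev[OF that, of f] f_props(3) by (simp add: roots_def)
  qed
  then show "(\<lambda>\<sigma>. \<sigma> \<pi>) ` emb = roots" using root_embedding by blast
qed

lemma finite_emb: "finite emb"
  using bij_emb_roots roots_split(1) bij_betw_finite by blast

lemma prod_emb_F_ser: "(\<Prod>\<sigma>\<in>emb. one_minus (\<sigma> \<pi>) 1) = es.F_ser"
proof -
  have "(\<Prod>\<sigma>\<in>emb. one_minus (\<sigma> \<pi>) 1) = (\<Prod>x\<in>roots. one_minus x 1)"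
    by (rule prod.reindex_bij_betw[OF bij_emb_roots])
  also have "\<dots> = fps_of_poly (reflect_poly (map_poly tau f))"
    by (simp only: fps_prod_one_minus_reflect[OF roots_split(1)] roots_split(3)[symmetric])
  also have "\<dots> = es.F_ser"
    by (rule fps_ext) (auto simp: coeff_reflect_poly es.F_ser_def coef_def coeff_map_poly f_props)
  finally show ?thesis .
qed

lemma prod_emb_power:
  assumes "es.frobenius_op s \<Psi>"
  shows "(\<Prod>\<sigma>\<in>emb. one_minus (\<sigma> \<pi> ^ s) 1) = \<Psi> es.F_ser"
  using es.frobenius_op_prod[OF assms finite_emb, of "\<lambda>\<sigma>. \<sigma> \<pi>"] prod_emb_F_ser by simp

text \<open>The product is \<open>\<Psi> F_ser\<close> with \<open>b X ^ h\<close> substituted for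
  \<open>X\<close>. At degree \<open>h q\<close> the hypothesis gives the linear part
  \<open>r h q\<close>, and going from \<open>tv q\<close> to \<open>tv (h q)\<close> can only lower
  the index.\<close>

lemma prod_emb_monomial:
  assumes s: "s \<ge> 1" and h: "h \<ge> 1" and v: "ereal (of_int r * real h) \<le> vL (\<iota> b * \<pi> ^ s)"
  shows "es.good r (es.idx {1..n}) (\<Prod>\<sigma>\<in>emb. one_minus (\<sigma> (\<iota> b * \<pi> ^ s)) h)"
proof -
  obtain \<Psi> where Psi: "es.frobenius_op s \<Psi>" using es.exists_frobenius_op[OF sep_closed s] by blast
  have g: "es.good (1 * int s) (es.idx {1..n}) (\<Psi> es.F_ser)"
    by (rule es.frobenius_op_good[OF Psi s es.profile_full es.F_ser_good])
  have s_eq: "\<sigma> (\<iota> b * \<pi> ^ s) = tau b * \<sigma> \<pi> ^ s" if "\<sigma> \<in> emb" for \<sigma>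
  proof -
    interpret s: field_hom \<sigma> by (rule emb_hom[OF that])
    show ?thesis by (simp add: s.hom_mult s.hom_power emb_iota[OF that])
  qed
  have nth: "(\<Prod>\<sigma>\<in>emb. one_minus (\<sigma> (\<iota> b * \<pi> ^ s)) h) $ l =
      (if h dvd l then tau b ^ (l div h) * \<Psi> es.F_ser $ (l div h) else 0)" for l
  proof -
    have "(\<Prod>\<sigma>\<in>emb. one_minus (\<sigma> (\<iota> b * \<pi> ^ s)) h) = (\<Prod>\<sigma>\<in>emb. one_minus (tau b * \<sigma> \<pi> ^ s) h)"
      using s_eq by (intro prod.cong) auto
    then show ?thesis
      using prod_one_minus_nth[OF finite_emb h, of "\<lambda>\<sigma>. tau b * \<sigma> \<pi> ^ s" l]
        prod_one_minus_scale_nth[OF finite_emb, of "tau b" "\<lambda>\<sigma>. \<sigma> \<pi> ^ s" "l div h"]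
        prod_emb_power[OF Psi] by simp
  qed
  have "es.vge (tau b ^ q * \<Psi> es.F_ser $ q) (es.bnd r (es.idx {1..n}) (h * q))" if q: "q \<ge> 1" for q
  proof (cases "b = 0")
    case True
      show ?thesis using True q by (simp add: power_0_left)
  next
    case False
    then obtain z where z: "w b = ereal (real n * of_int z)" using w_discrete by blast
    have "es.vge (tau (b ^ q) * \<Psi> es.F_ser $ q) (w (b ^ q) + es.bnd (1 * int s) (es.idx {1..n}) q)"
      using g q by (intro es.vge_mult es.vge_hom) (auto simp: unit_series_def)
    moreover have "es.bnd r (es.idx {1..n}) (h * q) \<le> w (b ^ q) + es.bnd (1 * int s) (es.idx {1..n}) q"
    proof -
      let ?W = "real n * of_int z"
      have "of_int r * real h \<le> ?W + real s" using v z by (simp add: vL_term)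
      then have "real q * (of_int r * real h) \<le> real q * (?W + real s)" by (intro mult_left_mono) auto
      then have 1: "ereal (of_int r * real (h * q)) \<le> ereal (real q * ?W) + ereal (real s * real q)"
        by (simp add: algebra_simps)
      have "es.idx {1..n} (es.tv (h * q)) \<le> es.idx {1..n} (es.tv q)"
        using h q by (intro es.profile_mono[OF es.profile_full] es.tv_dvd) auto
      then show ?thesis using add_mono[OF 1] z
        by (simp add: es.bnd_def es.w_power add.assoc[symmetric])
    qed
    ultimately have "es.vge (tau (b ^ q) * \<Psi> es.F_ser $ q) (es.bnd r (es.idx {1..n}) (h * q))"
      by (rule es.vge_mono)
    moreover have "tau (b ^ q) = tau b ^ q" by (simp add: tau_def i.hom_power k.hom_power)
    ultimately show ?thesis by simp
  qed
  then have *: "es.vge ((\<Prod>\<sigma>\<in>emb. one_minus (\<sigma> (\<iota> b * \<pi> ^ s)) h) $ l) (es.bnd r (es.idx {1..n}) l)"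
    if "l \<ge> 1" for l
    using that h nth[of l] by (auto elim!: dvdE simp: Suc_le_eq)
  show ?thesis using * h by (simp add: unit_series_def)
qed

text \<open>Modulo high powers of \<open>X\<close>, the series \<open>1 - \<alpha> X\<close> is a product of binomials
  \<open>1 - b \<pi>\<^sup>s X\<^sup>h\<close> with \<open>b\<close> in \<open>K\<close>, whose norms are under control.\<close>

lemma prod_emb_good:
  assumes \<alpha>: "ereal (of_int r) \<le> vL \<alpha>"
  shows "es.good r (es.idx {1..n}) (\<Prod>\<sigma>\<in>emb. one_minus (\<sigma> \<alpha>) 1)"
proof -
  let ?d = "es.idx {1..n}"
  define N where "N = (\<lambda>Q. \<Prod>\<sigma>\<in>emb. fps_map \<sigma> Q)"
  define G where "G = (\<lambda>h::nat. {x. ereal (of_int r * real h) \<le> vL x})"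
  define S where "S = (\<lambda>h::nat. {c \<in> G h. \<exists>b s. s \<ge> 1 \<and> c = \<iota> b * \<pi> ^ s})"
  have N_one_minus: "N (one_minus c h) = (\<Prod>\<sigma>\<in>emb. one_minus (\<sigma> c) h)" if "h \<ge> 1" for c h
    unfolding N_def using field_hom.fps_map_one_minus[OF emb_hom that] by (intro prod.cong) auto
  have G: "graded_groups G"
    unfolding graded_groups_def
  proof (intro conjI allI impI ballI)
    fix h :: nat and x y assume "x \<in> G h" "y \<in> G h"
    then show "x - y \<in> G h" using dv_add[OF vL, of x "- y"]
      by (auto simp: G_def dv_uminus[OF vL] min_def split: if_splits)
  next
    fix a b :: nat and x y assume "x \<in> G a" "y \<in> G b"
    then have "ereal (of_int r * real a) + ereal (of_int r * real b) \<le> vL x + vL y"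
      unfolding G_def by (intro add_mono) auto
    then show "x * y \<in> G (a + b)" by (simp add: G_def dv_mult[OF vL] algebra_simps)
  qed (simp add: G_def dv_0[OF vL])
  have F: "unit_series G (one_minus \<alpha> 1)"
    using \<alpha> by (intro unit_series_one_minus[OF G]) (auto simp: G_def)
  have main: "\<exists>Q. es.good r ?d (N Q) \<and> unit_series G Q \<and> fps_agree m (one_minus \<alpha> 1) Q" for m
  proof (rule unit_series_approx[OF G _ _ F, where S = S])
    show "S h \<subseteq> G h" for h by (auto simp: S_def)
    show "\<exists>cs. set cs \<subseteq> S h \<and> x = sum_list cs" if "x \<in> G h" for h x
    proof -
      \<comment> \<open>Exponents run from 1 to \<open>n\<close>, not from 0, because Frobenius
        operators are available for \<open>s \<ge> 1\<close>. The nonzero terms have distinct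
        valuations, so no term falls below \<open>x\<close>.\<close>
      obtain b where b: "x = (\<Sum>i\<in>{1..<1 + n}. \<iota> (b i) * \<pi> ^ i)" using lincomb_exists by blast
      have "\<iota> (b i) * \<pi> ^ i \<in> S h" if "i \<in> {1..<1 + n}" for i
      proof -
        have "vL x \<le> vL (\<iota> (b i) * \<pi> ^ i)" unfolding b by (rule lincomb_ge[OF that])
        then have "\<iota> (b i) * \<pi> ^ i \<in> G h" using \<open>x \<in> G h\<close> by (auto simp: G_def)
        then show ?thesis using that by (auto simp: S_def)
      qed
      moreover have "x = sum_list (map (\<lambda>i. \<iota> (b i) * \<pi> ^ i) [1..<1 + n])"
        unfolding b by (subst sum_list_distinct_conv_sum_set) (simp_all only: distinct_upt set_upt)
      ultimately show ?thesis
        by (intro exI[of _ "map (\<lambda>i. \<iota> (b i) * \<pi> ^ i) [1..<1 + n]"]) auto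
    qed
    \<comment> \<open>Writing 1 as \<open>1 - 0 X\<close> lets the monomial bound with
      \<open>b = 0\<close> cover it.\<close>
    have "N 1 = N (one_minus 0 1)" by (simp add: one_minus_def)
    also have "\<dots> = (\<Prod>\<sigma>\<in>emb. one_minus (\<sigma> (\<iota> 0 * \<pi> ^ 1)) 1)" by (subst N_one_minus) simp_all
    finally show "es.good r ?d (N 1)"
      using prod_emb_monomial[of 1 1 r 0] by (simp add: dv_0[OF vL])
    show "es.good r ?d (N (A * B))" if "es.good r ?d (N A)" "es.good r ?d (N B)" for A B
    proof -
      have "N (A * B) = N A * N B"
        unfolding N_def prod.distrib[symmetric]
        using field_hom.fps_map_mult[OF emb_hom] by (intro prod.cong) auto
      then show ?thesis using es.good_mult[OF es.profile_full that] by simp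
    qed
    show "es.good r ?d (N (one_minus c h))" if "h \<ge> 1" "c \<in> S h" for c h
      using that prod_emb_monomial by (auto simp: S_def G_def N_one_minus)
  qed
  have "es.vge (N (one_minus \<alpha> 1) $ l) (es.bnd r ?d l)" if l: "l \<ge> 1" for l
  proof -
    obtain Q where Q: "es.good r ?d (N Q)" "fps_agree l (one_minus \<alpha> 1) Q" using main by blast
    have "fps_agree l (N (one_minus \<alpha> 1)) (N Q)"
      unfolding N_def by (rule fps_agree_prod) (use Q(2) in \<open>auto simp: fps_agree_def\<close>)
    then show ?thesis using Q(1) l by (simp add: fps_agree_def unit_series_def)
  qed
  then show ?thesis by (simp add: unit_series_def N_one_minus)
qed

section \<open>Indices of inseparability as minima of contributions\<close>

lemma vp_trunc_tv:
  assumes "h \<ge> 1"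
  shows "vp_trunc p \<nu> (int h) = enat (es.tv h)"
proof -
  have "multiplicity (int p) (int h) = multiplicity p h"
  proof -
    have "\<not> is_unit p" "\<not> is_unit (int p)" "h \<noteq> 0" "int h \<noteq> 0"
      using assms prime_p by (auto simp: prime_nat_iff)
    then have "i \<le> multiplicity (int p) (int h) \<longleftrightarrow> i \<le> multiplicity p h" for i
      by (metis power_dvd_iff_le_multiplicity of_nat_dvd_iff of_nat_power)
    then show ?thesis by (metis order_refl antisym)
  qed
  then show ?thesis using assms by (simp add: vp_trunc_def vp_def es.tv_def min_def)
qed

lemma vK_min_poly_c:
  assumes "h \<le> n"
  shows "ereal (real n) * vK (min_poly_c \<iota> \<pi> h) = w (coef h)"
proof -
  have "min_poly_c \<iota> \<pi> h = (-1) ^ h * coef h"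
    using assms deg by (simp add: min_poly_c_def coef_def f_def)
  then have "min_poly_c \<iota> \<pi> h = coef h \<or> min_poly_c \<iota> \<pi> h = - coef h"
    by (cases "even h") auto
  then show ?thesis using dv_uminus[OF vK] by (auto simp: w_vK)
qed

lemma insep_index_unif_eq:
  "insep_index_unif \<iota> vK p \<nu> \<pi> j' =
    Min ((\<lambda>h. w (coef h) - ereal (real h)) ` {h \<in> {1..n}. es.tv h \<le> j'})"
proof -
  have "{ereal (real n) * vK (min_poly_c \<iota> \<pi> h) - ereal (real h) | h.
      1 \<le> h \<and> h \<le> n \<and> vp_trunc p \<nu> (int h) \<le> enat j'} =
    (\<lambda>h. w (coef h) - ereal (real h)) ` {h \<in> {1..n}. es.tv h \<le> j'}"
  proof -
    have "{h. 1 \<le> h \<and> h \<le> n \<and> vp_trunc p \<nu> (int h) \<le> enat j'} = {h \<in> {1..n}. es.tv h \<le> j'}"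
      using vp_trunc_tv by auto
    then show ?thesis
      unfolding setcompr_eq_image using vK_min_poly_c by (intro image_cong) auto
  qed
  then show ?thesis by (simp only: insep_index_unif_def deg)
qed

lemma insep_index_ereal_eq:
  assumes j: "j \<le> \<nu>"
  shows "insep_index_ereal \<iota> vK vL p \<nu> \<pi> j = es.idx {1..n} j"
proof -
  let ?e = "w (of_nat p)"
  define U where "U = (\<lambda>j'. Min ((\<lambda>h. w (coef h) - ereal (real h)) ` {h \<in> {1..n}. es.tv h \<le> j'}))"
  have e: "vL (of_nat p) = ?e" by (simp add: w_def i.hom_of_nat)
  have e0: "0 \<le> ?e" using es.w_p by simp
  have eq: "insep_index_ereal \<iota> vK vL p \<nu> \<pi> j =
      Min ((\<lambda>j'. U j' + ereal (real (j' - j)) * ?e) ` {j..\<nu>})"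
    unfolding insep_index_ereal_def insep_index_unif_eq e U_def
    unfolding setcompr_eq_image atLeastAtMost_def atLeast_def atMost_def Collect_conj_eq ..
  \<comment> \<open>Every set of admissible \<open>h\<close> contains 1; nonemptiness is needed
    because \<open>Min\<close> of the empty set is unspecified.\<close>
  have "es.tv 1 = 0" using es.tv_ge_iff[of 1 "Suc 0"] prime_p by (auto simp: not_less_eq_eq prime_nat_iff)
  then have ne: "1 \<in> {h \<in> {1..n}. es.tv h \<le> j'}" for j' using n_pos by auto
  show ?thesis
    unfolding eq
  proof (rule antisym)
    show "Min ((\<lambda>j'. U j' + ereal (real (j' - j)) * ?e) ` {j..\<nu>}) \<le> es.idx {1..n} j"
      unfolding es.idx_def
    proof (rule INF_greatest)
      fix h assume h: "h \<in> {1..n}"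
      define j' where "j' = max j (es.tv h)"
      have j': "j' \<in> {j..\<nu>}" using j by (simp add: j'_def)
      have "Min ((\<lambda>j'. U j' + ereal (real (j' - j)) * ?e) ` {j..\<nu>}) \<le> U j' + ereal (real (j' - j)) * ?e"
        using j' by (intro Min_le) auto
      also have "U j' \<le> w (coef h) - ereal (real h)"
        unfolding U_def using h by (intro Min_le) (auto simp: j'_def)
      then have "U j' + ereal (real (j' - j)) * ?e \<le> es.contrib h j"
        unfolding es.contrib_def by (intro add_mono) (auto simp: j'_def max_def)
      finally show "Min ((\<lambda>j'. U j' + ereal (real (j' - j)) * ?e) ` {j..\<nu>}) \<le> es.contrib h j" .
    qed
    have "Min ((\<lambda>j'. U j' + ereal (real (j' - j)) * ?e) ` {j..\<nu>}) \<in>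
        (\<lambda>j'. U j' + ereal (real (j' - j)) * ?e) ` {j..\<nu>}" using j by (intro Min_in) auto
    then obtain j' where j': "j' \<in> {j..\<nu>}"
      "Min ((\<lambda>j'. U j' + ereal (real (j' - j)) * ?e) ` {j..\<nu>}) = U j' + ereal (real (j' - j)) * ?e"
      by auto
    have "U j' \<in> (\<lambda>h. w (coef h) - ereal (real h)) ` {h \<in> {1..n}. es.tv h \<le> j'}"
      unfolding U_def
    proof (rule Min_in)
      show "(\<lambda>h. w (coef h) - ereal (real h)) ` {h \<in> {1..n}. es.tv h \<le> j'} \<noteq> {}" using ne by blast
    qed simp
    then obtain h where h: "h \<in> {1..n}" "es.tv h \<le> j'" "U j' = w (coef h) - ereal (real h)" by auto
    have "es.idx {1..n} j \<le> es.contrib h j" by (rule es.idx_le[OF h(1)])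
    also have "\<dots> \<le> U j' + ereal (real (j' - j)) * ?e"
      unfolding es.contrib_def h(3) using h(2) e0
      by (intro add_left_mono ereal_mult_right_mono) auto
    finally show "es.idx {1..n} j \<le> Min ((\<lambda>j'. U j' + ereal (real (j' - j)) * ?e) ` {j..\<nu>})"
      using j'(2) by simp
  qed
qed

text \<open>If \<open>w p\<close> is finite or \<open>\<nu> = 0\<close>, the contribution of
  \<open>h = n\<close> is finite. Otherwise the characteristic is \<open>p\<close> and separability
  gives a nonzero coefficient of \<open>f\<close> at an exponent prime to \<open>p\<close>; as
  \<open>p\<close> divides \<open>n\<close>, the matching \<open>h\<close> is prime to
  \<open>p\<close> too, and its contribution has no \<open>w p\<close> term.\<close>

lemma idx_finite:
  assumes j: "j \<le> \<nu>"
  shows "\<exists>N::int. es.idx {1..n} j = ereal (of_int N)"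
proof -
  let ?e = "w (of_nat p)"
  have "\<exists>h\<in>{1..n}. es.contrib h j \<noteq> \<infinity>"
  proof (cases "?e = \<infinity> \<and> \<nu> > 0")
    case False
    have "es.contrib n j \<noteq> \<infinity>"
    proof (cases "?e = \<infinity>")
      case True
      then have "\<nu> - j = 0" using False by simp
      then show ?thesis by (simp add: es.contrib_def es.tv_n es.w_excess_n zero_ereal_def[symmetric])
    next
      case fin: False
      then obtain y where "?e = ereal y" using es.w_not_minfinity by (cases ?e) auto
      then show ?thesis by (simp add: es.contrib_def es.tv_n es.w_excess_n)
    qed
    then show ?thesis using n_pos by (intro bexI[of _ n]) auto
  next
    case True
    then have p0: "of_nat p = (0::'k)" using es.w_eq_infinity by blast
    have "pderiv f \<noteq> 0"
    proof
      assume "pderiv f = 0"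
      then have "is_unit f" using separable_f by (simp add: separable_poly_def)
      then show False using f_props n_pos by (simp add: is_unit_iff_degree)
    qed
    then obtain m where m: "coeff (pderiv f) m \<noteq> 0" using poly_eqI[of "pderiv f" 0] by auto
    have c: "coeff f (Suc m) \<noteq> 0" and ndvd: "\<not> p dvd Suc m"
    proof -
      have "of_nat (Suc m) * coeff f (Suc m) \<noteq> 0" using m unfolding coeff_pderiv .
      then have *: "of_nat (Suc m) \<noteq> (0::'k)" "coeff f (Suc m) \<noteq> 0" by auto
      then show "coeff f (Suc m) \<noteq> 0" by simp
      show "\<not> p dvd Suc m"
      proof
        assume "p dvd Suc m"
        then obtain q where "Suc m = p * q" by blast
        then have "of_nat (Suc m) = of_nat p * (of_nat q :: 'k)" by (metis of_nat_mult)
        then show False using * p0 by simp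
      qed
    qed
    have le: "Suc m \<le> n" using c f_props(2) le_degree by metis
    have pn: "p dvd n" using es.p_power_dvd_n[of 1] True by simp
    define h where "h = n - Suc m"
    have hm: "h + Suc m = n" using le by (simp add: h_def)
    have "\<not> p dvd h"
    proof
      assume "p dvd h"
      then have "p dvd Suc m" using pn hm by (metis dvd_add_right_iff)
      then show False using ndvd by simp
    qed
    then have h: "1 \<le> h" "h \<le> n" using hm by (auto simp: Suc_le_eq intro!: gr0I)
    have "es.tv h = 0" using \<open>\<not> p dvd h\<close> by (simp add: es.tv_def not_dvd_imp_multiplicity_0)
    moreover have "n - h = Suc m" using hm by simp
    then have "coef h \<noteq> 0" using c h by (simp add: coef_def)
    then obtain z where "w (coef h) = ereal (real n * of_int z)" using w_discrete by blast
    ultimately have "es.contrib h j \<noteq> \<infinity>" by (simp add: es.contrib_def zero_ereal_def[symmetric])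
    then show ?thesis using h by auto
  qed
  then obtain h where h: "h \<in> {1..n}" "es.contrib h j \<noteq> \<infinity>" by blast
  have "es.idx {1..n} j \<noteq> \<infinity>" using es.idx_le[OF h(1), of j] h(2) by auto
  moreover have "0 \<le> es.idx {1..n} j" using es.profile_full j by (auto simp: es.profile_def)
  moreover have "{1..n} \<noteq> {}" using n_pos by simp
  then obtain h0 where "es.idx {1..n} j = es.contrib h0 j"
    using es.idx_attained[of "{1..n}" j] by (metis finite_atLeastAtMost)
  ultimately obtain y where y: "es.contrib h0 j = ereal y" "es.idx {1..n} j = ereal y"
    by (cases "es.idx {1..n} j") auto
  then show ?thesis using es.contrib_integral[OF y(1)] by metis
qed

lemma insep_index_idx:
  assumes j: "j \<le> \<nu>"
  shows "es.idx {1..n} j = ereal (of_int (insep_index \<iota> vK vL p \<nu> \<pi> j))"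
  using idx_finite[OF j] insep_index_ereal_eq[OF j] by (auto simp: insep_index_def)

section \<open>Values of the symmetric functions of conjugates\<close>

lemma conj_sym_eqI:
  assumes "(\<Prod>\<sigma>\<in>emb. one_minus (\<sigma> \<alpha>) 1) $ k = tau x"
  shows "conj_sym \<iota> \<kappa> k \<alpha> = (-1) ^ k * x"
proof -
  have inj: "inj tau" using es.tau.inj_f by (simp add: inj_def)
  have "elem_sym k (\<lambda>\<sigma>. \<sigma> \<alpha>) emb = (-1) ^ k * tau x"
    using prod_one_minus_elem_sym[OF finite_emb, of "\<lambda>\<sigma>. \<sigma> \<alpha>" k] assms
    by (cases "even k") (auto simp: minus_equation_iff)
  also have "\<dots> = tau ((-1) ^ k * x)" by (simp add: es.tau.hom_mult es.tau.hom_power es.tau.hom_uminus)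
  finally show ?thesis unfolding conj_sym_def tau_eq by (simp add: the_inv_f_f[OF inj])
qed

lemma vK_sign: "vK ((-1) ^ k * x) = vK x"
  using dv_uminus[OF vK, of x] by (cases "even k") auto

lemma conj_sym_lower:
  assumes j: "j \<le> \<nu>" and \<alpha>: "\<alpha> \<in> max_ideal_power vL r"
  shows "ereal (of_int (insep_index \<iota> vK vL p \<nu> \<pi> j + r * int p ^ j)) \<le>
    w (conj_sym \<iota> \<kappa> (p ^ j) \<alpha>)"
proof -
  have "p ^ j \<ge> 1" using prime_p prime_ge_1_nat by auto
  then have "es.vge ((\<Prod>\<sigma>\<in>emb. one_minus (\<sigma> \<alpha>) 1) $ (p ^ j)) (es.bnd r (es.idx {1..n}) (p ^ j))"
    using prod_emb_good[of r \<alpha>] \<alpha> by (simp add: unit_series_def max_ideal_power_def)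
  then obtain x where x: "(\<Prod>\<sigma>\<in>emb. one_minus (\<sigma> \<alpha>) 1) $ (p ^ j) = tau x"
    "es.bnd r (es.idx {1..n}) (p ^ j) \<le> w x" by (auto simp: es.vge_def)
  have "w (conj_sym \<iota> \<kappa> (p ^ j) \<alpha>) = w x"
    using conj_sym_eqI[OF x(1)] by (simp add: w_vK vK_sign)
  moreover have "es.bnd r (es.idx {1..n}) (p ^ j) =
      ereal (of_int (insep_index \<iota> vK vL p \<nu> \<pi> j + r * int p ^ j))"
    unfolding es.bnd_def es.tv_p_power[OF j] insep_index_idx[OF j] by simp
  ultimately show ?thesis using x(2) by simp
qed

text \<open>The equation i_j + p^j v_L(\<alpha>) = n m prescribes the valuation of
  \<open>\<alpha>\<close>: it is integral because \<open>p ^ j\<close> divides \<open>n\<close> and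
  the index, and at least \<open>r\<close> by the assumption on \<open>m\<close>.\<close>

lemma conj_sym_attained:
  assumes j: "j \<le> \<nu>" and pN: "int p ^ j dvd insep_index \<iota> vK vL p \<nu> \<pi> j"
    and m: "insep_index \<iota> vK vL p \<nu> \<pi> j + r * int p ^ j \<le> int n * m"
  shows "\<exists>\<alpha>\<in>max_ideal_power vL r. vK (conj_sym \<iota> \<kappa> (p ^ j) \<alpha>) = ereal (of_int m)"
proof -
  define N where "N = insep_index \<iota> vK vL p \<nu> \<pi> j"
  have pj: "int p ^ j > 0" using prime_p prime_gt_0_nat by auto
  have "int p ^ j dvd int n" using es.p_power_dvd_n[OF j] by (metis of_nat_dvd_iff of_nat_power)
  then have "int p ^ j dvd int n * m - N" using pN by (simp add: N_def)
  then obtain S where S: "int n * m - N = int p ^ j * S" by blast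
  have Sr: "r \<le> S"
  proof -
    have "int p ^ j * r \<le> int p ^ j * S" using m S by (simp add: N_def mult.commute)
    then show ?thesis using pj by simp
  qed
  \<comment> \<open>The valuation \<open>S\<close> may be negative while \<open>s \<ge> 1\<close> is
    required. Raising the exponent by \<open>n M\<close> and taking \<open>b\<close> with v_K(b) = -
    M leaves the valuation at \<open>S\<close>; \<open>M = |S| + 1\<close> is large enough.\<close>
  define M where "M = \<bar>S\<bar> + 1"
  define s where "s = nat (S + int n * M)"
  have "M \<le> int n * M" using n_pos by (simp add: M_def)
  then have "1 \<le> S + int n * M" unfolding M_def by linarith
  then have s: "int s = S + int n * M" "s \<ge> 1" by (auto simp: s_def)
  obtain b where b: "b \<noteq> 0" "vK b = ereal (of_int (- M))" using dv_surj[OF vK, of "- M"] by blast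
  define \<alpha> where "\<alpha> = \<iota> b * \<pi> ^ s"
  have wb: "w b = ereal (- (real n * of_int M))" by (simp add: w_vK b)
  have "vL \<alpha> = ereal (of_int (int s - int n * M))" by (simp add: \<alpha>_def vL_term wb)
  then have "vL \<alpha> = ereal (of_int S)" by (simp only: s) simp
  then have in_r: "\<alpha> \<in> max_ideal_power vL r" using Sr by (simp add: max_ideal_power_def)
  obtain \<Psi> where Psi: "es.frobenius_op s \<Psi>" using es.exists_frobenius_op[OF sep_closed s(2)] by blast
  have "int (s * p ^ j) + N = int n * (m + M * int p ^ j)"
    using S by (simp add: s(1) algebra_simps)
  then have "int n dvd int (s * p ^ j) + N" by simp
  then obtain x where x: "\<Psi> es.F_ser $ (p ^ j) = tau x" "w x = ereal (real (s * p ^ j) + of_int N)"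
    using es.exact_value[OF Psi s(2) j insep_index_idx[OF j]] pN by (auto simp: N_def)
  have "(\<Prod>\<sigma>\<in>emb. one_minus (\<sigma> \<alpha>) 1) = (\<Prod>\<sigma>\<in>emb. one_minus (tau b * \<sigma> \<pi> ^ s) 1)"
  proof (rule prod.cong)
    fix \<sigma> assume "\<sigma> \<in> emb"
    then interpret s: field_hom \<sigma> by (rule emb_hom)
    show "one_minus (\<sigma> \<alpha>) 1 = one_minus (tau b * \<sigma> \<pi> ^ s) 1"
      using emb_iota[OF \<open>\<sigma> \<in> emb\<close>] by (simp add: \<alpha>_def s.hom_mult s.hom_power)
  qed simp
  then have "(\<Prod>\<sigma>\<in>emb. one_minus (\<sigma> \<alpha>) 1) $ (p ^ j) = tau (b ^ (p ^ j) * x)"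
    using prod_one_minus_scale_nth[OF finite_emb, of "tau b" "\<lambda>\<sigma>. \<sigma> \<pi> ^ s" "p ^ j"]
      prod_emb_power[OF Psi] x(1) by (simp add: es.tau.hom_mult es.tau.hom_power)
  then have "conj_sym \<iota> \<kappa> (p ^ j) \<alpha> = (-1) ^ (p ^ j) * (b ^ (p ^ j) * x)" by (rule conj_sym_eqI)
  then have eq: "vK (conj_sym \<iota> \<kappa> (p ^ j) \<alpha>) = vK (b ^ (p ^ j) * x)" by (simp add: vK_sign)
  have "w (b ^ (p ^ j) * x) = ereal (real_of_int (int (s * p ^ j) + N - int p ^ j * (int n * M)))"
    by (simp add: es.w_mult es.w_power wb x(2))
  also have "int (s * p ^ j) + N - int p ^ j * (int n * M) = int n * m"
    using S by (simp add: s(1) algebra_simps)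
  finally have *: "ereal (real n) * vK (b ^ (p ^ j) * x) = ereal (real n * of_int m)"
    by (simp add: w_vK)
  then have "vK (b ^ (p ^ j) * x) = ereal (of_int m)"
    using n_pos by (cases "vK (b ^ (p ^ j) * x)") auto
  then show ?thesis using in_r eq by auto
qed

end

theorem theorem5p1:
  fixes \<iota> :: "'k::field \<Rightarrow> 'l::field"
    and \<kappa> :: "'l \<Rightarrow> 's::field"
    and vK :: "'k \<Rightarrow> ereal" and vL :: "'l \<Rightarrow> ereal"
    and \<pi> :: 'l
    and p n u \<nu> j :: nat
  assumes "discrete_valuation vK" and "complete_valuation vK"
    and "perfect_of_char (residue_field vK) p"
    and "field_hom \<iota>" and "field_hom \<kappa>"
    and "separable_closure (\<kappa> \<circ> \<iota>)"
    and "ext_degree \<iota> = n" and "n = u * p ^ \<nu>" and "\<not> p dvd u"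
    and "totally_ramified \<iota> vK vL"
    and "vL \<pi> = 1"
    and "j \<le> \<nu>"
    and "enat j \<le> min (vp p (insep_index \<iota> vK vL p \<nu> \<pi> j)) (enat \<nu>)"
  shows "\<forall>r::int.
      valuation_ring_span vK (conj_sym \<iota> \<kappa> (p ^ j) ` max_ideal_power vL r) =
        max_ideal_power vK
          \<lceil>real_of_int (insep_index \<iota> vK vL p \<nu> \<pi> j + r * int p ^ j) / real n\<rceil> \<and>
      min_val_conj_sym \<iota> \<kappa> vK vL (p ^ j) r =
        ereal (real_of_int
          \<lceil>real_of_int (insep_index \<iota> vK vL p \<nu> \<pi> j + r * int p ^ j) / real n\<rceil>)"
proof -
  define N where "N = insep_index \<iota> vK vL p \<nu> \<pi> j"
  define C where "C = conj_sym \<iota> \<kappa> (p ^ j)"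
  have prime: "prime p" using assms(3) by (simp add: perfect_of_char_def)
  have "field_hom (\<kappa> \<circ> \<iota>)" using assms(6) by (simp add: separable_closure_def)
  then have hom: "field_hom (\<lambda>x. \<kappa> (\<iota> x))" by (simp add: o_def)
  interpret totally_ramified_ext \<iota> \<kappa> vK vL \<pi> p n u \<nu>
    by (intro totally_ramified_ext.intro totally_ramified_ext_axioms.intro)
      (use assms hom prime residue_char_pos in auto)
  \<comment> \<open>At \<open>N = 0\<close> the value of \<open>vp\<close> is infinite and carries
    no multiplicity, but divisibility is trivial.\<close>
  have pN: "int p ^ j dvd N"
  proof (cases "N = 0")
    case False
    then have "j \<le> multiplicity (int p) N" using assms(13) by (simp add: N_def vp_def)
    then show ?thesis by (rule multiplicity_dvd')
  qed simp
  show ?thesis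
  proof
    fix r :: int
    define m where "m = \<lceil>real_of_int (N + r * int p ^ j) / real n\<rceil>"
    \<comment> \<open>The bound from \<open>conj_sym_lower\<close> is rounded up because
      \<open>vK\<close> takes integer values.\<close>
    have lower: "ereal (of_int m) \<le> vK (C \<alpha>)" if "\<alpha> \<in> max_ideal_power vL r" for \<alpha>
    proof (cases "C \<alpha> = 0")
      case True
      then show ?thesis by (simp add: dv_0[OF vK])
    next
      case False
      then obtain z where z: "vK (C \<alpha>) = ereal (of_int z)" "w (C \<alpha>) = ereal (real n * of_int z)"
        using w_discrete by blast
      have "real_of_int (N + r * int p ^ j) \<le> real n * of_int z"
        using conj_sym_lower[OF assms(12) that] unfolding C_def[symmetric] N_def[symmetric] z
        by (simp only: ereal_less_eq)
      then have "real_of_int (N + r * int p ^ j) / real n \<le> of_int z"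
        using n_pos by (simp add: field_simps)
      then have "m \<le> z" by (simp add: m_def ceiling_le_iff)
      then show ?thesis by (simp add: z)
    qed
    have "real_of_int (N + r * int p ^ j) / real n \<le> of_int m"
      unfolding m_def by (rule le_of_int_ceiling)
    then have "real_of_int (N + r * int p ^ j) \<le> real_of_int (int n * m)"
      using n_pos by (simp add: field_simps)
    then have "N + r * int p ^ j \<le> int n * m" by (simp only: of_int_le_iff)
    then obtain \<alpha> where \<alpha>: "\<alpha> \<in> max_ideal_power vL r" "vK (C \<alpha>) = ereal (of_int m)"
      using conj_sym_attained[OF assms(12)] pN unfolding N_def C_def by blast
    have "valuation_ring_span vK (C ` max_ideal_power vL r) = max_ideal_power vK m"
    proof (rule subset_antisym; rule subsetI)
      fix y assume "y \<in> valuation_ring_span vK (C ` max_ideal_power vL r)"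
      then obtain l :: nat and a s where y: "y = (\<Sum>i<l. a i * s i)"
        "\<forall>i<l. a i \<in> max_ideal_power vK 0 \<and> s i \<in> C ` max_ideal_power vL r"
        unfolding valuation_ring_span_def by blast
      have "ereal (of_int m) \<le> vK (a i * s i)" if "i \<in> {..<l}" for i
      proof -
        have "0 \<le> vK (a i)" "ereal (of_int m) \<le> vK (s i)"
          using y(2) that lower by (auto simp: max_ideal_power_def zero_ereal_def)
        then have "0 + ereal (of_int m) \<le> vK (a i) + vK (s i)" by (rule add_mono)
        then show ?thesis by (simp add: dv_mult[OF vK])
      qed
      then have "ereal (of_int m) \<le> vK y" unfolding y(1) by (rule dv_sum_ge[OF vK])
      then show "y \<in> max_ideal_power vK m" by (simp add: max_ideal_power_def)
    next
      fix y assume "y \<in> max_ideal_power vK m"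
      then have y: "ereal (of_int m) \<le> vK y" by (simp add: max_ideal_power_def)
      \<comment> \<open>One generator suffices: \<open>C \<alpha>\<close> has valuation exactly
        \<open>m\<close>, so \<open>y / C \<alpha>\<close> is integral.\<close>
      have nz: "C \<alpha> \<noteq> 0" using \<alpha>(2) by (auto simp: dv_0[OF vK])
      have "vK y = vK (y / C \<alpha>) + ereal (of_int m)"
        using dv_mult[OF vK, of "y / C \<alpha>" "C \<alpha>"] nz \<alpha>(2) by simp
      then have "0 \<le> vK (y / C \<alpha>)" using y by (cases "vK (y / C \<alpha>)") auto
      then have "y / C \<alpha> \<in> max_ideal_power vK 0" by (simp add: max_ideal_power_def zero_ereal_def)
      moreover have "y = (\<Sum>i<(1::nat). (y / C \<alpha>) * C \<alpha>)" using nz by simp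
      ultimately show "y \<in> valuation_ring_span vK (C ` max_ideal_power vL r)"
        unfolding valuation_ring_span_def using \<alpha>(1)
        by (intro CollectI exI[of _ "1::nat"] exI[of _ "\<lambda>_. y / C \<alpha>"] exI[of _ "\<lambda>_. C \<alpha>"]) auto
    qed
    moreover have "(INF \<alpha>\<in>max_ideal_power vL r. vK (C \<alpha>)) = ereal (of_int m)"
    proof (rule antisym)
      show "(INF \<alpha>\<in>max_ideal_power vL r. vK (C \<alpha>)) \<le> ereal (of_int m)"
        using INF_lower[OF \<alpha>(1), of "\<lambda>\<alpha>. vK (C \<alpha>)"] \<alpha>(2) by simp
      show "ereal (of_int m) \<le> (INF \<alpha>\<in>max_ideal_power vL r. vK (C \<alpha>))"
        using lower by (rule INF_greatest)
    qed
    ultimately show "valuation_ring_span vK (conj_sym \<iota> \<kappa> (p ^ j) ` max_ideal_power vL r) =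
        max_ideal_power vK
          \<lceil>real_of_int (insep_index \<iota> vK vL p \<nu> \<pi> j + r * int p ^ j) / real n\<rceil> \<and>
      min_val_conj_sym \<iota> \<kappa> vK vL (p ^ j) r =
        ereal (real_of_int
          \<lceil>real_of_int (insep_index \<iota> vK vL p \<nu> \<pi> j + r * int p ^ j) / real n\<rceil>)"
      unfolding min_val_conj_sym_def C_def m_def N_def by blast
  qed
qed

end
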